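(* Let $s\ge2$, $1\le k<n$, $\epsilon,\delta\in(0,1)$, and let $R>0$ be a constant such that $\|\mathcal W\mathcal P\mathcal S\|_2\le R$. Suppose that $m\ge\frac{3\nu^{(1)}}{c_{A,k,s}\delta^2}\log\frac{4k}{\epsilon}$ if the sampling follows regime 1, or that $m_t\ge\frac{3\nu^{(2)}(t)}{c_{A,k,s}\delta^2}\log\frac{4k}{\epsilon}$ for all $t=0,\dots,s-1$ if the sampling follows regime 2. Put $M=\sum_{t=0}^{s-1}m_t$ (with $m_t=m$ in regime 1). With probability at least $1-\epsilon$ (over the random sampling), the following holds for all $w_{\mathrm{aug}}\in\mathrm{span}(\widetilde U_k)$, all $e\in\mathbb R^{M}$, all $\gamma>0$, and all real polynomial functions $g$ that are nonnegative and non-decreasing on $[0,\infty)$ with $g(\theta_{k+1})>0$. Let $z=\mathcal S\pi_{A,s}(w_{\mathrm{aug}})+e$, let $w_{\mathrm{aug}}^*$ be the solution of $$w_{\mathrm{aug}}^*\in\arg\min_{\overline v\in\mathbb R^{2n}}\ \|\mathcal W\mathcal P(\mathcal S\pi_{A,s}(\overline v)-z)\|_2^2+\gamma\,\overline v^\top g(\widetilde L)\,\overline v,\qquad \widetilde L=\begin{bmatrix}L&\mathbf 0\\ \mathbf 0&L\end{bmatrix},$$ and set $\alpha^*=\widetilde U_k\widetilde U_k^\top w_{\mathrm{aug}}^*$ and $\beta^*=(I_{2n}-\widetilde U_k\widetilde U_k^\top)w_{\mathrm{aug}}^*$. Then $$\|\alpha^*-w_{\mathrm{aug}}\|_2\le\left(\frac{2+\frac{R\,C_{A,n,s}}{\sqrt{\gamma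 g(\theta_{k+1})}}}{\sqrt{(1-\delta)c_{A,k,s}}}\right)\|\mathcal W\mathcal Pe\|_2+\left(\frac{R\,C_{A,n,s}\sqrt{\frac{g(\theta_k)}{g(\theta_{k+1})}}+\sqrt{\gamma g(\theta_k)}}{\sqrt{(1-\delta)c_{A,k,s}}}\right)\|w_{\mathrm{aug}}\|_2$$ and $$\|\beta^*\|_2\le\frac{\|\mathcal W\mathcal Pe\|_2}{\sqrt{\gamma g(\theta_{k+1})}}+\sqrt{\frac{g(\theta_k)}{g(\theta_{k+1})}}\,\|w_{\mathrm{aug}}\|_2 .$$
   Context: Graph setting. $\mathcal G$ is a simple undirected weighted graph on $n$ nodes with symmetric weighted adjacency matrix $W\in\mathbb R^{n\times n}$ (positive weights on edges, $0$ otherwise), degree matrix $D=\mathrm{diag}(\sum_jW(i,j))_{i}$ with positive diagonal entries, and normalized Laplacian $L=I-D^{-1/2}WD^{-1/2}$. Fix an eigendecomposition $L=U\Theta U^\top$ with $U\in\mathbb R^{n\times n}$ orthogonal and $\Theta=\mathrm{diag}(\theta_1,\dots,\theta_n)$, $0=\theta_1\le\dots\le\theta_n$. The known operator $A\in\mathbb R^{n\times n}$ has the form $A=U\Lambda U^\top$ with $\Lambda=\mathrm{diag}(\lambda_1,\dots,\lambda_n)$ real diagonal. For $1\le k\le n$ let $U_k=U(:,1{:}k)$ be the matrix of the first $k$ columns of $U$, $\Lambda_k=\mathrm{diag}(\lambda_1,\dots,\lambda_k)$, $\Lambda_k^0=I$, $\bar\Lambda_k^0=\mathbf 0$ and $\bar\Lambda_k^t=\sum_{j=0}^{t-1}\Lambda_k^j$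 for $t\ge1$. Let $\widetilde U_k=\begin{bmatrix}U_k&\mathbf 0\\ \mathbf 0&U_k\end{bmatrix}\in\mathbb R^{2n\times 2k}$; $\mathrm{span}$ denotes column space. Operator $\pi_{A,s}$. $\pi_{A,s}:\mathbb R^{2n}\to\mathbb R^{sn}$ is the linear map whose $t$-th block ($t=0,\dots,s-1$) of length $n$ is $U_k\begin{bmatrix}\Lambda_k^t&\bar\Lambda_k^t\end{bmatrix}\widetilde U_k^\top v$. (If $w_{\mathrm{aug}}=\begin{bmatrix}x_0\\ w\end{bmatrix}$ with $x_0,w\in\mathrm{span}(U_k)$ and $x_{t+1}=Ax_t+w$, then $\pi_{A,s}(w_{\mathrm{aug}})$ stacks $x_0,\dots,x_{s-1}$.) Constants. For $1\le r\le n$ let $Y^{(r)}=\sum_{t=0}^{s-1}\begin{bmatrix}\Lambda_r^{t}\\ \bar\Lambda_r^{t}\end{bmatrix}\begin{bmatrix}\Lambda_r^{t}&\bar\Lambda_r^{t}\end{bmatrix}\in\mathbb R^{2r\times2r}$. Then $c_{A,r,s}:=\lambda_{\min}(Y^{(r)})$ and $C_{A,r,s}:=\lambda_{\max}(Y^{(r)})$; $C_{A,n,s}$ is the case $r=n$. Sampling. For each $t$, $\mathbf p_t$ is a probability distribution on $[n]=\{1,\dots,n\}$ with $\mathbf p_t(i)>0$ for all $i$. At time $t$, the sampled nodes are $\Omega_t=\{\omega_{1,t},\dots,\omega_{m_t,t}\}$ (with repetitions allowed). Regime 1: all $\mathbf p_t$ equal $\mathbf p_0$, $m_t=m$, and one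 set of $m$ indices is drawn i.i.d. (with replacement) from $\mathbf p_0$ and used at every time, i.e. $\omega_{j,t}=\omega_j$ for all $t$. Regime 2: at each time $t$, $m_t$ indices are drawn independently with replacement from $\mathbf p_t$, independently across times. $S_t\in\mathbb R^{m_t\times n}$ is the matrix with $S_t(i,j)=1$ if $j=\omega_{i,t}$ and $0$ otherwise. $M_t=\frac1{\sqrt{m_t}}I\in\mathbb R^{m_t\times m_t}$, $P_{\Omega_t}=\mathrm{diag}(\mathbf p_t(\omega_{1,t}),\dots,\mathbf p_t(\omega_{m_t,t}))$. $\mathcal W$, $\mathcal P$, $\mathcal S$ are block diagonal with diagonal blocks $M_t$, $P_{\Omega_t}^{-1/2}$, $S_t$ ($t=0,\dots,s-1$) respectively. Graph spectral weighted coherence. With $\delta_\ell$ the $\ell$-th standard basis vector of $\mathbb R^n$ and $\|\cdot\|_2$ the spectral norm for matrices and the Euclidean norm for vectors, $$\nu^{(1)}=\max_{1\le\ell\le n}\frac1{\mathbf p_0(\ell)}\left\|\sum_{t=0}^{s-1}\begin{bmatrix}\Lambda_k^t\\ \bar\Lambda_k^t\end{bmatrix}U_k^\top\delta_\ell\delta_\ell^\top U_k\begin{bmatrix}\Lambda_k^t&\bar\Lambda_k^t\end{bmatrix}\right\|_2,\qquad \nu^{(2)}(t)=\max_{1\le\ell\le n}\frac1{\mathbf p_t(\ell)}\left\|\delta_\ell^\top U_k\begin{bmatrix}\Lambda_k^t&\bar\Lambda_k^t\end{bmatrix}\right\|_2^2 .$$ *)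

theory Defs
  imports "HOL-Probability.Probability" "Jordan_Normal_Form.Spectral_Radius"
begin

unbundle no vec_syntax
unbundle no inner_syntax
hide_type (open) Finite_Cartesian_Product.vec
hide_const (open) Finite_Cartesian_Product.vec Finite_Cartesian_Product.mat
  Finite_Cartesian_Product.row

(* All indices start at 0: nodes are 0, ..., n - 1, and theta i, lam i stand for the
   (i + 1)-st eigenvalues.  In particular theta (k - 1) and theta k are the k-th and the
   (k + 1)-st eigenvalue in the usual numbering from 1. *)

definition l2_norm_vec :: "real vec \<Rightarrow> real" where
  "l2_norm_vec v = sqrt (v \<bullet> v)"

definition spectral_norm :: "real mat \<Rightarrow> real" where
  "spectral_norm A =
    Sup {l2_norm_vec (A *\<^sub>v v) | v. v \<in> carrier_vec (dim_col A) \<and> l2_norm_vec v \<le> 1}"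

(* Only meant for matrices with at least one real eigenvalue, such as the symmetric ones
   of positive dimension: Min and Max are unspecified on the empty set. *)
definition lambda_min :: "real mat \<Rightarrow> real" where
  "lambda_min A = Min (spectrum A)"

definition lambda_max :: "real mat \<Rightarrow> real" where
  "lambda_max A = Max (spectrum A)"

(* The type of matrices is not an additive monoid (no type-wide zero), so big sums carry
   their dimensions explicitly. *)
definition sum_mat :: "nat \<Rightarrow> nat \<Rightarrow> (nat \<Rightarrow> real mat) \<Rightarrow> nat set \<Rightarrow> real mat" where
  "sum_mat nr nc F T = mat nr nc (\<lambda>(i, j). \<Sum>t\<in>T. F t $$ (i, j))"

definition poly_mat_eval :: "real poly \<Rightarrow> real mat \<Rightarrow> real mat" where
  "poly_mat_eval g B =
    sum_mat (dim_row B) (dim_row B) (\<lambda>i. coeff g i \<cdot>\<^sub>m (B ^\<^sub>m i)) {..degree g}"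

definition normalized_laplacian :: "nat \<Rightarrow> real mat \<Rightarrow> real mat" where
  "normalized_laplacian n W =
    (let Dinvsqrt = mat_diag n (\<lambda>i. 1 / sqrt (\<Sum>j<n. W $$ (i, j)))
     in 1\<^sub>m n - Dinvsqrt * W * Dinvsqrt)"

definition diag2 :: "real mat \<Rightarrow> real mat" where
  "diag2 B = diag_block_mat [B, B]"

definition first_cols :: "real mat \<Rightarrow> nat \<Rightarrow> real mat" where
  "first_cols U k = mat (dim_row U) k (\<lambda>(i, j). U $$ (i, j))"

definition Lam :: "nat \<Rightarrow> (nat \<Rightarrow> real) \<Rightarrow> real mat" where
  "Lam r lam = mat_diag r lam"

definition Lam_bar :: "nat \<Rightarrow> (nat \<Rightarrow> real) \<Rightarrow> nat \<Rightarrow> real mat" where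
  "Lam_bar r lam t = sum_mat r r (\<lambda>j. Lam r lam ^\<^sub>m j) {..<t}"

(* The r x 2r matrix with the two square blocks side by side. *)
definition Lam_row :: "nat \<Rightarrow> (nat \<Rightarrow> real) \<Rightarrow> nat \<Rightarrow> real mat" where
  "Lam_row r lam t =
    four_block_mat (Lam r lam ^\<^sub>m t) (Lam_bar r lam t) (0\<^sub>m 0 r) (0\<^sub>m 0 r)"

definition Lam_col :: "nat \<Rightarrow> (nat \<Rightarrow> real) \<Rightarrow> nat \<Rightarrow> real mat" where
  "Lam_col r lam t = (Lam r lam ^\<^sub>m t) @\<^sub>r Lam_bar r lam t"

definition pi_op :: "real mat \<Rightarrow> (nat \<Rightarrow> real) \<Rightarrow> nat \<Rightarrow> nat \<Rightarrow> real vec \<Rightarrow> real vec" where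
  "pi_op U lam k s v =
    (let n = dim_row U; Uk = first_cols U k
     in vec (s * n) (\<lambda>i. ((Uk * Lam_row k lam (i div n) * transpose_mat (diag2 Uk)) *\<^sub>v v)
                          $ (i mod n)))"

definition Y_mat :: "(nat \<Rightarrow> real) \<Rightarrow> nat \<Rightarrow> nat \<Rightarrow> real mat" where
  "Y_mat lam r s =
    sum_mat (2 * r) (2 * r) (\<lambda>t. Lam_col r lam t * Lam_row r lam t) {..<s}"

definition c_const :: "(nat \<Rightarrow> real) \<Rightarrow> nat \<Rightarrow> nat \<Rightarrow> real" where
  "c_const lam r s = lambda_min (Y_mat lam r s)"

definition C_const :: "(nat \<Rightarrow> real) \<Rightarrow> nat \<Rightarrow> nat \<Rightarrow> real" where
  "C_const lam r s = lambda_max (Y_mat lam r s)"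

(* A realisation of the sampled nodes is om, with om t j the j-th node drawn at time t.
   Values outside t < s, j < m t are irrelevant and fixed to 0 by the product measures. *)

definition regime1_law :: "nat \<Rightarrow> nat pmf \<Rightarrow> (nat \<Rightarrow> nat \<Rightarrow> nat) pmf" where
  "regime1_law m0 p0 = map_pmf (\<lambda>om t. om) (Pi_pmf {..<m0} 0 (\<lambda>_. p0))"

definition regime2_law ::
  "nat \<Rightarrow> (nat \<Rightarrow> nat) \<Rightarrow> (nat \<Rightarrow> nat pmf) \<Rightarrow> (nat \<Rightarrow> nat \<Rightarrow> nat) pmf" where
  "regime2_law s m p =
    Pi_pmf {..<s} (\<lambda>_. 0) (\<lambda>t. Pi_pmf {..<m t} 0 (\<lambda>_. p t))"

definition samp_mat :: "nat \<Rightarrow> nat \<Rightarrow> (nat \<Rightarrow> nat) \<Rightarrow> real mat" where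
  "samp_mat n mt omt = mat mt n (\<lambda>(i, j). if j = omt i then 1 else 0)"

definition S_block ::
  "nat \<Rightarrow> nat \<Rightarrow> (nat \<Rightarrow> nat) \<Rightarrow> (nat \<Rightarrow> nat \<Rightarrow> nat) \<Rightarrow> real mat" where
  "S_block n s m om = diag_block_mat (map (\<lambda>t. samp_mat n (m t) (om t)) [0..<s])"

(* Block diagonal with the blocks P^(-1/2), P the diagonal matrix of the probabilities
   of the sampled nodes. *)
definition P_block ::
  "nat \<Rightarrow> (nat \<Rightarrow> nat) \<Rightarrow> (nat \<Rightarrow> nat pmf) \<Rightarrow> (nat \<Rightarrow> nat \<Rightarrow> nat) \<Rightarrow> real mat" where
  "P_block s m p om =
    diag_block_mat
      (map (\<lambda>t. mat_diag (m t) (\<lambda>j. 1 / sqrt (pmf (p t) (om t j)))) [0..<s])"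

definition W_block :: "nat \<Rightarrow> (nat \<Rightarrow> nat) \<Rightarrow> real mat" where
  "W_block s m =
    diag_block_mat (map (\<lambda>t. (1 / sqrt (real (m t))) \<cdot>\<^sub>m 1\<^sub>m (m t)) [0..<s])"

definition coherence1 ::
  "real mat \<Rightarrow> (nat \<Rightarrow> real) \<Rightarrow> nat \<Rightarrow> nat \<Rightarrow> nat pmf \<Rightarrow> real" where
  "coherence1 U lam k s p0 =
    (let n = dim_row U; Uk = first_cols U k; \<delta> = (\<lambda>l. mat_of_cols n [unit_vec n l])
     in MAX l\<in>{..<n}. 1 / pmf p0 l *
          spectral_norm (sum_mat (2 * k) (2 * k)
            (\<lambda>t. Lam_col k lam t * transpose_mat Uk * \<delta> l * transpose_mat (\<delta> l)
                  * Uk * Lam_row k lam t) {..<s}))"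

(* The row vector delta_l^T U_k [Lam^t, Lam_bar^t] is represented by its transpose. *)
definition coherence2 ::
  "real mat \<Rightarrow> (nat \<Rightarrow> real) \<Rightarrow> nat \<Rightarrow> (nat \<Rightarrow> nat pmf) \<Rightarrow> nat \<Rightarrow> real" where
  "coherence2 U lam k p t =
    (let n = dim_row U; Uk = first_cols U k
     in MAX l\<in>{..<n}. 1 / pmf (p t) l *
          (l2_norm_vec (transpose_mat (Uk * Lam_row k lam t) *\<^sub>v unit_vec n l))\<^sup>2)"

definition objective ::
  "real mat \<Rightarrow> real mat \<Rightarrow> (real vec \<Rightarrow> real vec) \<Rightarrow> real vec \<Rightarrow> real \<Rightarrow> real mat \<Rightarrow> real vec \<Rightarrow> real"
where
  "objective WP S F z \<gamma> G v =
    (l2_norm_vec (WP *\<^sub>v (S *\<^sub>v F v - z)))\<^sup>2 + \<gamma> * (v \<bullet> (G *\<^sub>v v))"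

end

theory Submission
  imports Defs
begin

text \<open>
  The operator pi_op sees a vector v only through its coordinates Uaug^T v. It therefore annihilates
  the component beta of the minimizer, and the data term of the objective depends on alpha alone.
  Write E for the norm of the weighted noise and gk, gk1 for the values of g at the k-th and the
  (k + 1)-st eigenvalue of L. Comparing the objective at the minimizer with its value at w shows that
  the squared data misfit plus the penalty is at most E^2 + gamma gk |w|^2. The penalty is at least
  gamma gk1 |beta|^2, because g is non-decreasing and nonnegative on the spectrum of L; this is the
  bound on beta. The misfit is at most E + sqrt (gamma gk) |w|, so the weighted samples of
  pi_op (alpha - w) have norm at most 2 E + sqrt (gamma gk) |w|. This comparison is
  regularized_recovery_bound, fed by laplacian_filter_bounds. It yields the bound on alpha as soon as
  the sampling is a stable embedding of the span of Uaug: the squared norm of the weighted samples of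
  pi_op (Uaug y) must be at least (1 - delta) c |y|^2 for all y.

  The stable embedding is the probabilistic part. The squared norm of the weighted samples of
  pi_op (Uaug y) is a quadratic form in y given by a sum of independent positive semidefinite
  matrices X of order d = 2 k, whose expectation is the observability Gramian Y, with least eigenvalue
  c. The coherence and the number of samples bound the largest eigenvalue of each summand by
  rho = c delta^2 / (3 log (4 k / epsilon)).
  The lower tail is controlled by a matrix Chernoff inequality. In the second regime the summands
  have different means, and each single mean may be singular although Y is not, so it does not suffice
  to bound the factors of a product of moment generating functions separately. The remedy is to centre
  the exponent by a multiple of the mean. After scaling to rho = 1, put
  Z = (theta - 3/4 theta^2) M - theta X with M the mean of X. Since e^x \<le> 1 + x + 3/4 x^2 on the
  spectrum of Z and X^2 is at most X, the expectation of e^Z is at most the identity: the linear term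
  contributes -3/4 theta^2 M and the quadratic term at most +3/4 theta^2 M. By the Golden--Thompson inequality tr e^(H + Z) is at most tr (e^H e^Z), so
  adding an independent Z to H does not increase the expected trace of the exponential
  (expectation_trace_exp_add_le). Independent summands can then be added one at a time
  (trace_exp_contraction_Pi_pmf), and Markov's inequality with theta = 2 delta / 3 bounds the failure
  probability by d exp (- c delta^2 / (3 rho)), which is epsilon / 2 here.

  The exponential of a matrix enters only through the powers (1 + H / N)^N with N = 2^j. For these
  the Golden--Thompson inequality, up to an error of order 1 / N, follows from
  tr (P Q)^N \<le> tr (P^N Q^N) for symmetric P and Q, which is a repeated application of the
  Cauchy--Schwarz inequality for the trace.
\<close>

section \<open>Euclidean norm and quadratic forms\<close>

lemma l2_norm_vec_eq_L2_set: "l2_norm_vec v = L2_set (\<lambda>i. v $ i) {0..<dim_vec v}"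
  by (simp add: l2_norm_vec_def L2_set_def scalar_prod_def power2_eq_square)

lemma scalar_prod_self_nonneg: "0 \<le> v \<bullet> (v :: real vec)"
  by (simp add: scalar_prod_def sum_nonneg)

lemma l2_norm_vec_nonneg [simp]: "0 \<le> l2_norm_vec v"
  by (simp add: l2_norm_vec_def scalar_prod_self_nonneg)

lemma l2_norm_vec_square: "(l2_norm_vec v)\<^sup>2 = v \<bullet> v"
  by (simp add: l2_norm_vec_def scalar_prod_self_nonneg)

lemma abs_scalar_prod_le:
  assumes "u \<in> carrier_vec d" "v \<in> carrier_vec d"
  shows "\<bar>u \<bullet> v\<bar> \<le> l2_norm_vec u * l2_norm_vec v"
proof -
  have "\<bar>u \<bullet> v\<bar> \<le> (\<Sum>i\<in>{0..<d}. \<bar>u $ i\<bar> * \<bar>v $ i\<bar>)"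
    using assms by (simp add: scalar_prod_def abs_mult[symmetric])
  also have "\<dots> \<le> l2_norm_vec u * l2_norm_vec v"
    using L2_set_mult_ineq[of "\<lambda>i. u $ i" "\<lambda>i. v $ i" "{0..<d}"] assms
    by (simp add: l2_norm_vec_eq_L2_set)
  finally show ?thesis .
qed

lemma l2_norm_vec_triangle:
  assumes "u \<in> carrier_vec d" "v \<in> carrier_vec d"
  shows "l2_norm_vec (u + v) \<le> l2_norm_vec u + l2_norm_vec v"
proof -
  have "L2_set (\<lambda>i. (u + v) $ i) {0..<d} = L2_set (\<lambda>i. u $ i + v $ i) {0..<d}"
    using assms by (intro L2_set_cong) auto
  then show ?thesis
    using L2_set_triangle_ineq[of "\<lambda>i. u $ i" "\<lambda>i. v $ i" "{0..<d}"] assms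
    by (simp add: l2_norm_vec_eq_L2_set)
qed

lemma l2_norm_vec_smult: "l2_norm_vec (c \<cdot>\<^sub>v v) = \<bar>c\<bar> * l2_norm_vec v"
proof -
  have "(c \<cdot>\<^sub>v v) \<bullet> (c \<cdot>\<^sub>v v) = c\<^sup>2 * (v \<bullet> v)"
    by (simp add: power2_eq_square)
  then show ?thesis by (simp add: l2_norm_vec_def real_sqrt_mult)
qed

lemma l2_norm_vec_zero_iff:
  assumes "v \<in> carrier_vec d"
  shows "l2_norm_vec v = 0 \<longleftrightarrow> v = 0\<^sub>v d"
  using assms
  by (auto simp: l2_norm_vec_eq_L2_set L2_set_eq_0_iff intro!: eq_vecI)

lemma l2_norm_unit_vec: "i < d \<Longrightarrow> l2_norm_vec (unit_vec d i) = 1"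
  by (simp add: l2_norm_vec_def)

abbreviation quad_form :: "real mat \<Rightarrow> real vec \<Rightarrow> real" where
  "quad_form A v \<equiv> v \<bullet> (A *\<^sub>v v)"

lemma quadratic_form_transpose:
  fixes A :: "real mat"
  assumes "A \<in> carrier_mat nr nc" "u \<in> carrier_vec nr" "v \<in> carrier_vec nc"
  shows "u \<bullet> (A *\<^sub>v v) = (A\<^sup>T *\<^sub>v u) \<bullet> v"
  using assms transpose_vec_mult_scalar[OF assms(1,3,2)]
  by (simp add: comm_scalar_prod[of _ nr] comm_scalar_prod[of _ nc])

lemma symmetric_mat_move:
  fixes A :: "real mat"
  assumes "A \<in> carrier_mat d d" "A\<^sup>T = A" "u \<in> carrier_vec d" "v \<in> carrier_vec d"
  shows "u \<bullet> (A *\<^sub>v v) = (A *\<^sub>v u) \<bullet> v"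
  using quadratic_form_transpose[OF assms(1,3,4)] assms(2) by simp

section \<open>Trace inequalities for powers of products\<close>

definition mat_trace :: "real mat \<Rightarrow> real" where
  "mat_trace A = (\<Sum>i<dim_row A. A $$ (i, i))"

lemma mat_trace_mult:
  assumes "A \<in> carrier_mat n m" "B \<in> carrier_mat m n"
  shows "mat_trace (A * B) = (\<Sum>i<n. \<Sum>j<m. A $$ (i, j) * B $$ (j, i))"
  using assms by (auto simp: mat_trace_def scalar_prod_def lessThan_atLeast0 intro!: sum.cong)

lemma mat_trace_comm:
  assumes "A \<in> carrier_mat n m" "B \<in> carrier_mat m n"
  shows "mat_trace (A * B) = mat_trace (B * A)"
  using assms by (subst (1 2) mat_trace_mult) (auto simp: mult.commute intro: sum.swap)

lemma mat_trace_minus: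
  "A \<in> carrier_mat n n \<Longrightarrow> B \<in> carrier_mat n n \<Longrightarrow> mat_trace (A - B) = mat_trace A - mat_trace B"
  by (simp add: mat_trace_def sum_subtractf)

text \<open>
  This is the Cauchy--Schwarz inequality for the Frobenius inner product, in the form given by
  2 x y \<le> x^2 + y^2 in each entry.
\<close>

lemma mat_trace_mult_le:
  assumes "A \<in> carrier_mat n m" "B \<in> carrier_mat m n"
  shows "2 * mat_trace (A * B) \<le> mat_trace (A * A\<^sup>T) + mat_trace (B\<^sup>T * B)"
proof -
  have "2 * (\<Sum>i<n. \<Sum>j<m. A $$ (i, j) * B $$ (j, i))
      \<le> (\<Sum>i<n. \<Sum>j<m. A $$ (i, j) * A $$ (i, j) + B $$ (j, i) * B $$ (j, i))"
    unfolding sum_distrib_left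
  proof (intro sum_mono)
    fix i j
    show "2 * (A $$ (i, j) * B $$ (j, i)) \<le> A $$ (i, j) * A $$ (i, j) + B $$ (j, i) * B $$ (j, i)"
      using sum_squares_bound[of "A $$ (i, j)" "B $$ (j, i)"] by (simp add: power2_eq_square)
  qed
  then show ?thesis
    using assms by (simp add: mat_trace_mult[of _ n m] sum.distrib)
qed

lemma mult_carrier_square_mat [simp]:
  "A \<in> carrier_mat n n \<Longrightarrow> B \<in> carrier_mat n n \<Longrightarrow> A * B \<in> carrier_mat n n"
  by (rule mult_carrier_mat)

lemma pow_mat_add:
  assumes "(A :: 'a :: semiring_1 mat) \<in> carrier_mat n n"
  shows "A ^\<^sub>m (i + j) = A ^\<^sub>m i * A ^\<^sub>m j"
  using assms
  by (induction j) (auto simp: assoc_mult_mat[of _ n n _ n _ n])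

lemma pow_mat_mult:
  assumes "(A :: 'a :: semiring_1 mat) \<in> carrier_mat n n"
  shows "A ^\<^sub>m (i * j) = (A ^\<^sub>m i) ^\<^sub>m j"
proof (induction j)
  case (Suc j)
  have "A ^\<^sub>m (i * Suc j) = A ^\<^sub>m (i * j + i)" by (simp add: add.commute)
  then show ?case using Suc assms by (simp only: pow_mat_add[OF assms] pow_mat.simps)
qed (use assms in auto)

lemma pow_mat_1 [simp]: "(A :: 'a :: semiring_1 mat) \<in> carrier_mat n n \<Longrightarrow> A ^\<^sub>m Suc 0 = A"
  by auto

lemma pow_mat_2: "(A :: 'a :: semiring_1 mat) \<in> carrier_mat n n \<Longrightarrow> A ^\<^sub>m 2 = A * A"
  by (auto simp: numeral_2_eq_2)

lemma pow_mat_Suc_left: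
  assumes "(A :: 'a :: semiring_1 mat) \<in> carrier_mat n n"
  shows "A ^\<^sub>m Suc i = A * A ^\<^sub>m i"
  using pow_mat_add[OF assms, of 1 i] assms by simp

lemma transpose_pow_mat:
  assumes "(A :: 'a :: comm_semiring_1 mat) \<in> carrier_mat n n"
  shows "transpose_mat (A ^\<^sub>m i) = A\<^sup>T ^\<^sub>m i"
proof (induction i)
  case (Suc i)
  have "transpose_mat (A ^\<^sub>m Suc i) = A\<^sup>T * A\<^sup>T ^\<^sub>m i"
    using Suc assms by (simp add: transpose_mult[of _ n n _ n])
  then show ?case using pow_mat_Suc_left[of "A\<^sup>T" n i] assms by simp
qed (use assms in simp)

text \<open>
  Moving the first factor of an alternating product to the end is what makes the trace of
  (A B)^i symmetric in A and B.
\<close>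

lemma pow_mat_shift:
  assumes "(A :: 'a :: semiring_1 mat) \<in> carrier_mat n n" "B \<in> carrier_mat n n"
  shows "(A * B) ^\<^sub>m Suc i = A * (B * A) ^\<^sub>m i * B"
proof (induction i)
  case 0
  then show ?case using assms by simp
next
  case (Suc i)
  have "(A * B) ^\<^sub>m Suc (Suc i) = A * (B * A) ^\<^sub>m i * B * (A * B)"
    using Suc by simp
  also have "\<dots> = A * ((B * A) ^\<^sub>m i * (B * A)) * B"
    using assms by (simp add: assoc_mult_mat[of _ n n _ n _ n])
  finally show ?case by simp
qed

lemma mat_trace_pow_comm:
  assumes "A \<in> carrier_mat n n" "B \<in> carrier_mat n n"
  shows "mat_trace ((A * B) ^\<^sub>m i) = mat_trace ((B * A) ^\<^sub>m i)"
proof (cases i)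
  case 0
  then show ?thesis using assms by simp
next
  case (Suc j)
  have "mat_trace ((A * B) ^\<^sub>m i) = mat_trace (A * ((B * A) ^\<^sub>m j * B))"
    using assms by (simp add: Suc pow_mat_shift[OF assms] assoc_mult_mat[of _ n n _ n _ n] del: pow_mat.simps)
  also have "\<dots> = mat_trace ((B * A) ^\<^sub>m j * B * A)"
    using assms by (intro mat_trace_comm[of _ n n]) auto
  also have "\<dots> = mat_trace ((B * A) ^\<^sub>m i)"
    using assms by (simp add: Suc assoc_mult_mat[of _ n n _ n _ n])
  finally show ?thesis .
qed

text \<open>
  The two inequalities are proved together because each step of one uses the other. The first bounds
  the trace of a power of an arbitrary X: squaring X gives X X X^T X^T, which is cyclically the product
  of the symmetric matrices X X^T and X^T X, so that the second inequality at the same exponent applies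
  and Cauchy--Schwarz merges the two factors. The second follows from the first for X = P Q, because
  X X^T is cyclically Q^2 P^2, and the exponent has been halved.
\<close>

lemma mat_trace_pow_two_power_le_both:
  shows "\<And>X. X \<in> carrier_mat n n \<Longrightarrow>
           mat_trace (X ^\<^sub>m (2 ^ Suc i)) \<le> mat_trace ((X * X\<^sup>T) ^\<^sub>m (2 ^ i))"
    and "\<And>P Q. \<lbrakk>P \<in> carrier_mat n n; Q \<in> carrier_mat n n; P\<^sup>T = P; Q\<^sup>T = Q\<rbrakk>
           \<Longrightarrow> mat_trace ((P * Q) ^\<^sub>m (2 ^ i)) \<le> mat_trace (P ^\<^sub>m (2 ^ i) * Q ^\<^sub>m (2 ^ i))"
proof (induction i)
  case 0
  {
    case 1
    then show ?case
      using mat_trace_mult_le[of X n n X] mat_trace_comm[of X n n "X\<^sup>T"]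
        pow_mat_1[of "X * X\<^sup>T" n]
      by (simp add: pow_mat_2 del: pow_mat.simps)
  next
    case 2
    then show ?case by simp
  }
next
  case (Suc i)
  have dbl: "A ^\<^sub>m (2 ^ Suc l) = (A * A) ^\<^sub>m (2 ^ l)" if "A \<in> carrier_mat n n" for A :: "real mat" and l
    using pow_mat_mult[OF that, of 2 "2 ^ l"] that by (simp add: pow_mat_2)
  {
    case (1 X)
    let ?T = "X\<^sup>T"
    note X = 1
    have T: "?T \<in> carrier_mat n n" using X by simp
    let ?P = "X * ?T" and ?Q = "?T * X"
    have P: "?P \<in> carrier_mat n n" "?P\<^sup>T = ?P" and Q: "?Q \<in> carrier_mat n n" "?Q\<^sup>T = ?Q"
      using X by (auto simp: transpose_mult[of _ n n _ n])
    have "mat_trace (X ^\<^sub>m (2 ^ Suc (Suc i))) \<le> mat_trace ((X * X * transpose_mat (X * X)) ^\<^sub>m (2 ^ i))"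
      unfolding dbl[OF X, of "Suc i"] by (rule Suc.IH(1)) (use X in simp)
    also have "X * X * transpose_mat (X * X) = X * (X * ?T * ?T)"
      using X by (simp add: transpose_mult[of _ n n _ n] assoc_mult_mat[of _ n n _ n _ n])
    also have "mat_trace (\<dots> ^\<^sub>m (2 ^ i)) = mat_trace ((X * ?T * ?T * X) ^\<^sub>m (2 ^ i))"
      using X by (intro mat_trace_pow_comm[of _ n]) auto
    also have "X * ?T * ?T * X = ?P * ?Q"
      using X by (simp add: assoc_mult_mat[of _ n n _ n _ n])
    also have "mat_trace (\<dots> ^\<^sub>m (2 ^ i)) \<le> mat_trace (?P ^\<^sub>m (2 ^ i) * ?Q ^\<^sub>m (2 ^ i))"
      using Suc.IH(2) P Q by blast
    also have "\<dots> \<le> mat_trace (?P ^\<^sub>m (2 ^ Suc i))"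
    proof -
      have sq: "A ^\<^sub>m (2 ^ i) * A ^\<^sub>m (2 ^ i) = A ^\<^sub>m (2 ^ Suc i)" if "A \<in> carrier_mat n n" for A :: "real mat"
        using pow_mat_add[OF that, of "2 ^ i" "2 ^ i"] by (simp add: mult_2)
      have "2 * mat_trace (?P ^\<^sub>m (2 ^ i) * ?Q ^\<^sub>m (2 ^ i))
          \<le> mat_trace (?P ^\<^sub>m (2 ^ Suc i)) + mat_trace (?Q ^\<^sub>m (2 ^ Suc i))"
        using mat_trace_mult_le[of "?P ^\<^sub>m (2 ^ i)" n n "?Q ^\<^sub>m (2 ^ i)"] P Q
        by (simp add: transpose_pow_mat[of _ n] sq del: power_Suc)
      moreover have "mat_trace (?Q ^\<^sub>m (2 ^ Suc i)) = mat_trace (?P ^\<^sub>m (2 ^ Suc i))"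
        by (rule mat_trace_pow_comm[OF T X])
      ultimately show ?thesis by simp
    qed
    finally show ?case .
  next
    case (2 P Q)
    note PQ = 2
    have "mat_trace ((P * Q) ^\<^sub>m (2 ^ Suc i)) \<le> mat_trace ((P * Q * transpose_mat (P * Q)) ^\<^sub>m (2 ^ i))"
      using Suc.IH(1)[of "P * Q"] PQ by simp
    also have "P * Q * transpose_mat (P * Q) = P * (Q * Q * P)"
      using PQ by (simp add: transpose_mult[of _ n n _ n] assoc_mult_mat[of _ n n _ n _ n])
    also have "mat_trace (\<dots> ^\<^sub>m (2 ^ i)) = mat_trace ((Q * Q * P * P) ^\<^sub>m (2 ^ i))"
      using PQ by (intro mat_trace_pow_comm[of _ n]) auto
    also have "Q * Q * P * P = (Q * Q) * (P * P)"
      using PQ by (simp add: assoc_mult_mat[of _ n n _ n _ n])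
    also have "mat_trace (\<dots> ^\<^sub>m (2 ^ i)) \<le> mat_trace ((Q * Q) ^\<^sub>m (2 ^ i) * (P * P) ^\<^sub>m (2 ^ i))"
      using PQ by (intro Suc.IH(2)) (auto simp: transpose_mult[of _ n n _ n])
    also have "\<dots> = mat_trace (P ^\<^sub>m (2 ^ Suc i) * Q ^\<^sub>m (2 ^ Suc i))"
      unfolding dbl[OF PQ(1)] dbl[OF PQ(2)] using PQ by (intro mat_trace_comm[of _ n n]) auto
    finally show ?case .
  }
qed

lemmas mat_trace_mult_pow_le = mat_trace_pow_two_power_le_both(2)

section \<open>Operator norm bounds\<close>

lemma mult_mat_vec_square_carrier [simp]:
  "A \<in> carrier_mat d d \<Longrightarrow> v \<in> carrier_vec d \<Longrightarrow> A *\<^sub>v v \<in> carrier_vec d"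
  by (rule mult_mat_vec_carrier)

lemma square_mat_distrib:
  fixes A B C :: "real mat"
  assumes "A \<in> carrier_mat d d" "B \<in> carrier_mat d d" "C \<in> carrier_mat d d"
  shows "(A + B) * C = A * C + B * C" "C * (A + B) = C * A + C * B"
    "(A - B) * C = A * C - B * C" "C * (A - B) = C * A - C * B"
  using assms
  by (auto intro: add_mult_distrib_mat mult_add_distrib_mat minus_mult_distrib_mat mult_minus_distrib_mat)

lemma square_mat_smult_mult:
  fixes A B :: "real mat"
  assumes "A \<in> carrier_mat d d" "B \<in> carrier_mat d d"
  shows "(k \<cdot>\<^sub>m A) * B = k \<cdot>\<^sub>m (A * B)" "A * (k \<cdot>\<^sub>m B) = k \<cdot>\<^sub>m (A * B)"
  using assms by (auto intro: mult_smult_assoc_mat mult_smult_distrib)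

lemma smult_mat_mult_vec:
  assumes "A \<in> carrier_mat nr nc" "v \<in> carrier_vec nc"
  shows "(k \<cdot>\<^sub>m A) *\<^sub>v v = (k :: real) \<cdot>\<^sub>v (A *\<^sub>v v)"
proof (intro eq_vecI)
  fix i assume i: "i < dim_vec (k \<cdot>\<^sub>v (A *\<^sub>v v))"
  have "(k \<cdot>\<^sub>v row A i) \<bullet> v = k * (row A i \<bullet> v)"
    using assms by (intro smult_scalar_prod_distrib[of _ nc]) auto
  then show "((k \<cdot>\<^sub>m A) *\<^sub>v v) $ i = (k \<cdot>\<^sub>v (A *\<^sub>v v)) $ i"
    using i assms by simp
qed (use assms in auto)

text \<open>
  A bound on the operator norm as a predicate. Bounds compose without computing the norm itself, and
  every square matrix has one.
\<close>

definition op_bound :: "nat \<Rightarrow> real mat \<Rightarrow> real \<Rightarrow> bool" where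
  "op_bound d A c \<longleftrightarrow> A \<in> carrier_mat d d \<and> 0 \<le> c \<and>
     (\<forall>v\<in>carrier_vec d. l2_norm_vec (A *\<^sub>v v) \<le> c * l2_norm_vec v)"

lemma op_boundD:
  assumes "op_bound d A c"
  shows "A \<in> carrier_mat d d" "0 \<le> c"
    "v \<in> carrier_vec d \<Longrightarrow> l2_norm_vec (A *\<^sub>v v) \<le> c * l2_norm_vec v"
  using assms by (auto simp: op_bound_def)

lemma op_bound_mono: "op_bound d A c \<Longrightarrow> c \<le> c' \<Longrightarrow> op_bound d A c'"
  unfolding op_bound_def
  by (meson l2_norm_vec_nonneg mult_right_mono order_trans)

lemma l2_norm_mult_mat_vec_le:
  assumes "A \<in> carrier_mat nr nc" "v \<in> carrier_vec nc"
  shows "l2_norm_vec (A *\<^sub>v v) \<le> sqrt (\<Sum>i<nr. row A i \<bullet> row A i) * l2_norm_vec v"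
proof -
  have "(A *\<^sub>v v) \<bullet> (A *\<^sub>v v) = (\<Sum>i<nr. (row A i \<bullet> v)\<^sup>2)"
    using assms by (simp add: scalar_prod_def[of "A *\<^sub>v v"] power2_eq_square lessThan_atLeast0)
  also have "\<dots> \<le> (\<Sum>i<nr. (row A i \<bullet> row A i) * (v \<bullet> v))"
  proof (rule sum_mono)
    fix i assume "i \<in> {..<nr}"
    have "\<bar>row A i \<bullet> v\<bar>\<^sup>2 \<le> (l2_norm_vec (row A i) * l2_norm_vec v)\<^sup>2"
      using assms by (intro power_mono abs_scalar_prod_le[of _ nc]) auto
    then show "(row A i \<bullet> v)\<^sup>2 \<le> (row A i \<bullet> row A i) * (v \<bullet> v)"
      by (simp add: power_mult_distrib l2_norm_vec_square)
  qed
  also have "\<dots> = (\<Sum>i<nr. row A i \<bullet> row A i) * (v \<bullet> v)"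
    by (simp add: sum_distrib_right)
  finally show ?thesis
    unfolding l2_norm_vec_def real_sqrt_mult[symmetric] by (rule real_sqrt_le_mono)
qed

lemma op_bound_quadratic_form:
  assumes A: "op_bound d A c" and v: "v \<in> carrier_vec d"
  shows "\<bar>v \<bullet> (A *\<^sub>v v)\<bar> \<le> c * (v \<bullet> v)"
proof -
  have "\<bar>v \<bullet> (A *\<^sub>v v)\<bar> \<le> l2_norm_vec v * l2_norm_vec (A *\<^sub>v v)"
    using v op_boundD(1)[OF A] by (intro abs_scalar_prod_le) auto
  also have "\<dots> \<le> l2_norm_vec v * (c * l2_norm_vec v)"
    using op_boundD(3)[OF A v] by (intro mult_left_mono) auto
  also have "\<dots> = c * (v \<bullet> v)" using l2_norm_vec_square[of v] by (simp add: power2_eq_square mult_ac)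
  finally show ?thesis .
qed

lemma op_bound_exists: "A \<in> carrier_mat d d \<Longrightarrow> \<exists>c. op_bound d A c"
  unfolding op_bound_def
  by (intro exI[of _ "sqrt (\<Sum>i<d. row A i \<bullet> row A i)"])
     (auto simp: sum_nonneg scalar_prod_self_nonneg l2_norm_mult_mat_vec_le)

lemma op_bound_one: "op_bound d (1\<^sub>m d) 1"
  by (auto simp: op_bound_def)

lemma op_bound_zero: "op_bound d (0\<^sub>m d d) 0"
proof -
  have "0\<^sub>m d d *\<^sub>v v = 0\<^sub>v d" if "v \<in> carrier_vec d" for v :: "real vec"
    using that by (intro eq_vecI) auto
  then show ?thesis
    by (auto simp: op_bound_def l2_norm_vec_zero_iff[of "0\<^sub>v d" d, simplified])
qed

lemma op_bound_add:
  assumes "op_bound d A a" "op_bound d B b"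
  shows "op_bound d (A + B) (a + b)"
  unfolding op_bound_def
proof (intro conjI ballI)
  fix v :: "real vec" assume v: "v \<in> carrier_vec d"
  note [simp] = op_boundD(1)[OF assms(1)] op_boundD(1)[OF assms(2)]
  have "l2_norm_vec ((A + B) *\<^sub>v v) = l2_norm_vec (A *\<^sub>v v + B *\<^sub>v v)"
    using v by (simp add: add_mult_distrib_mat_vec[of _ d d])
  also have "\<dots> \<le> l2_norm_vec (A *\<^sub>v v) + l2_norm_vec (B *\<^sub>v v)"
    using v by (intro l2_norm_vec_triangle[of _ d]) auto
  also have "\<dots> \<le> (a + b) * l2_norm_vec v"
    using op_boundD(3)[OF assms(1) v] op_boundD(3)[OF assms(2) v] by (simp add: distrib_right)
  finally show "l2_norm_vec ((A + B) *\<^sub>v v) \<le> (a + b) * l2_norm_vec v" .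
qed (use assms in \<open>auto simp: op_bound_def\<close>)

lemma op_bound_smult:
  assumes "op_bound d A a"
  shows "op_bound d (k \<cdot>\<^sub>m A) (\<bar>k\<bar> * a)"
  unfolding op_bound_def
proof (intro conjI ballI)
  fix v :: "real vec" assume v: "v \<in> carrier_vec d"
  note A [simp] = op_boundD(1)[OF assms]
  have "(k \<cdot>\<^sub>m A) *\<^sub>v v = k \<cdot>\<^sub>v (A *\<^sub>v v)"
    using v A by (simp add: smult_mat_mult_vec[of _ d d])
  then show "l2_norm_vec ((k \<cdot>\<^sub>m A) *\<^sub>v v) \<le> \<bar>k\<bar> * a * l2_norm_vec v"
    using op_boundD(3)[OF assms v] by (simp add: l2_norm_vec_smult mult.assoc mult_left_mono)
qed (use assms in \<open>auto simp: op_bound_def\<close>)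

lemma op_bound_mult:
  assumes "op_bound d A a" "op_bound d B b"
  shows "op_bound d (A * B) (a * b)"
  unfolding op_bound_def
proof (intro conjI ballI)
  fix v :: "real vec" assume v: "v \<in> carrier_vec d"
  note [simp] = op_boundD(1)[OF assms(1)] op_boundD(1)[OF assms(2)]
  have "l2_norm_vec ((A * B) *\<^sub>v v) = l2_norm_vec (A *\<^sub>v (B *\<^sub>v v))"
    using v by (simp add: assoc_mult_mat_vec[of _ d d _ d])
  also have "\<dots> \<le> a * l2_norm_vec (B *\<^sub>v v)"
    using v by (intro op_boundD(3)[OF assms(1)]) auto
  also have "\<dots> \<le> a * b * l2_norm_vec v"
    using op_boundD(3)[OF assms(2) v] op_boundD(2)[OF assms(1)] by (simp add: mult.assoc mult_left_mono)
  finally show "l2_norm_vec ((A * B) *\<^sub>v v) \<le> a * b * l2_norm_vec v" .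
qed (use assms in \<open>auto simp: op_bound_def\<close>)

lemma op_bound_pow: "op_bound d A a \<Longrightarrow> op_bound d (A ^\<^sub>m i) (a ^ i)"
proof (induction i)
  case 0
  then have "dim_row A = d" by (auto simp: op_bound_def)
  then show ?case using op_bound_one by simp
next
  case (Suc i)
  then show ?case using op_bound_mult[of d "A ^\<^sub>m i" "a ^ i" A a] by (simp add: mult.commute)
qed

lemma abs_mat_trace_le:
  assumes "op_bound d A a"
  shows "\<bar>mat_trace A\<bar> \<le> real d * a"
proof -
  have A: "A \<in> carrier_mat d d" using op_boundD[OF assms] by simp
  have "\<bar>A $$ (i, i)\<bar> \<le> a" if i: "i < d" for i
  proof -
    have "A $$ (i, i) = unit_vec d i \<bullet> (A *\<^sub>v unit_vec d i)"
      using i A by (simp add: scalar_prod_left_unit[of _ d])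
    then show ?thesis
      using abs_scalar_prod_le[of "unit_vec d i" d "A *\<^sub>v unit_vec d i"] A
        op_boundD(3)[OF assms, of "unit_vec d i"] i
      by (simp add: l2_norm_unit_vec)
  qed
  then have "(\<Sum>i<d. \<bar>A $$ (i, i)\<bar>) \<le> real d * a"
    using sum_bounded_above[of "{..<d}" "\<lambda>i. \<bar>A $$ (i, i)\<bar>" a] by simp
  then show ?thesis
    using A order_trans[OF sum_abs[of "\<lambda>i. A $$ (i, i)" "{..<d}"]] by (simp add: mat_trace_def)
qed

text \<open>
  Telescoping A^i - B^i into i differences A - B, each multiplied by i - 1 factors of norm at most c.
  The hypothesis 1 \<le> c lets c^i replace c^(i - 1).
\<close>

lemma op_bound_diff_pow:
  assumes A: "op_bound d A c" and B: "op_bound d B c" and D: "op_bound d (A - B) e" and c: "1 \<le> c"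
  shows "op_bound d (A ^\<^sub>m i - B ^\<^sub>m i) (real i * c ^ i * e)"
proof (induction i)
  case 0
  have "A ^\<^sub>m 0 - B ^\<^sub>m 0 = 0\<^sub>m d d"
    using op_boundD(1)[OF A] op_boundD(1)[OF B] by auto
  then show ?case by (simp add: op_bound_zero)
next
  case (Suc i)
  note [simp] = op_boundD(1)[OF A] op_boundD(1)[OF B]
  have tele: "(X - Y) + (Y - Z) = X - Z"
    if "X \<in> carrier_mat d d" "Y \<in> carrier_mat d d" "Z \<in> carrier_mat d d" for X Y Z :: "real mat"
    using that by (intro eq_matI) auto
  have "(A ^\<^sub>m i - B ^\<^sub>m i) * A + B ^\<^sub>m i * (A - B)
      = (A ^\<^sub>m i * A - B ^\<^sub>m i * A) + (B ^\<^sub>m i * A - B ^\<^sub>m i * B)"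
    by (simp add: square_mat_distrib[of _ d])
  also have "\<dots> = A ^\<^sub>m Suc i - B ^\<^sub>m Suc i"
    unfolding pow_mat.simps by (rule tele) auto
  finally have split: "A ^\<^sub>m Suc i - B ^\<^sub>m Suc i = (A ^\<^sub>m i - B ^\<^sub>m i) * A + B ^\<^sub>m i * (A - B)" ..
  have "op_bound d (A ^\<^sub>m Suc i - B ^\<^sub>m Suc i) (real i * c ^ i * e * c + c ^ i * e)"
    unfolding split by (intro op_bound_add op_bound_mult Suc A D op_bound_pow B)
  moreover have "c ^ i * e \<le> c ^ i * c * e"
    using c op_boundD(2)[OF D] by (intro mult_right_mono) auto
  ultimately show ?case
    by (elim op_bound_mono) (simp add: algebra_simps)
qed

section \<open>The trace exponential\<close>

text \<open>
  The power (1 + H / N)^N with N = 2^j. Exponents that are powers of two make every such power, except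
  for j = 0, the square of a symmetric matrix when H is symmetric, and they match the exponents for
  which the trace inequality for products holds.
\<close>

definition exp_approx :: "nat \<Rightarrow> real mat \<Rightarrow> nat \<Rightarrow> real mat" where
  "exp_approx d H j = (1\<^sub>m d + (1 / 2 ^ j) \<cdot>\<^sub>m H) ^\<^sub>m (2 ^ j)"

text \<open>
  For symmetric H this is the trace of the matrix exponential of H, the sum of the exponentials of its
  eigenvalues.
\<close>

definition trace_exp :: "nat \<Rightarrow> real mat \<Rightarrow> real" where
  "trace_exp d H = lim (\<lambda>j. mat_trace (exp_approx d H j))"

lemma exp_approx_carrier [simp]: "H \<in> carrier_mat d d \<Longrightarrow> exp_approx d H j \<in> carrier_mat d d"
  by (simp add: exp_approx_def)

lemma smult_smult_mat: "a \<cdot>\<^sub>m (b \<cdot>\<^sub>m A) = (a * b :: real) \<cdot>\<^sub>m A"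
  by (intro eq_matI) auto

lemma op_bound_step:
  assumes "op_bound d H h" "0 \<le> y"
  shows "op_bound d (1\<^sub>m d + y \<cdot>\<^sub>m H) (exp (y * h))"
proof -
  have "op_bound d (1\<^sub>m d + y \<cdot>\<^sub>m H) (1 + \<bar>y\<bar> * h)"
    by (intro op_bound_add op_bound_one op_bound_smult assms)
  then show ?thesis
    using assms(2) exp_ge_add_one_self[of "y * h"] by (elim op_bound_mono) simp
qed

text \<open>
  If two matrices have norm at most e^(x / N) and differ by at most y / N^2, the traces of their N-th
  powers differ by O(1 / N). Both the convergence of the approximations and the error in the
  Golden--Thompson inequality are instances.
\<close>

lemma trace_pow_diff_le:
  assumes "op_bound d A (exp (x / 2 ^ j))" "op_bound d B (exp (x / 2 ^ j))"
    and "op_bound d (A - B) (y / (2 ^ j * 2 ^ j))" "0 \<le> x"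
  shows "\<bar>mat_trace (A ^\<^sub>m (2 ^ j)) - mat_trace (B ^\<^sub>m (2 ^ j))\<bar> \<le> real d * exp x * y / 2 ^ j"
proof -
  have "A ^\<^sub>m (2 ^ j) \<in> carrier_mat d d" "B ^\<^sub>m (2 ^ j) \<in> carrier_mat d d"
    using assms op_boundD(1) by (meson pow_carrier_mat)+
  then have "mat_trace (A ^\<^sub>m (2 ^ j)) - mat_trace (B ^\<^sub>m (2 ^ j)) = mat_trace (A ^\<^sub>m (2 ^ j) - B ^\<^sub>m (2 ^ j))"
    by (simp add: mat_trace_minus)
  moreover have "op_bound d (A ^\<^sub>m (2 ^ j) - B ^\<^sub>m (2 ^ j))
      (real (2 ^ j) * exp (x / 2 ^ j) ^ (2 ^ j) * (y / (2 ^ j * 2 ^ j)))"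
    using assms by (intro op_bound_diff_pow) auto
  moreover have "exp (x / 2 ^ j) ^ (2 ^ j) = exp x"
    by (simp flip: exp_of_nat_mult)
  ultimately show ?thesis
    using abs_mat_trace_le[of d "A ^\<^sub>m (2 ^ j) - B ^\<^sub>m (2 ^ j)"] by (fastforce simp: field_simps)
qed

text \<open>
  Passing from N to 2 N replaces 1 + H / N by (1 + H / (2 N))^2, which adds H^2 / (4 N^2). The resulting
  differences are summable in j, so the approximations converge.
\<close>

lemma trace_exp_approx_step:
  assumes H: "op_bound d H h"
  shows "\<bar>mat_trace (exp_approx d H (Suc j)) - mat_trace (exp_approx d H j)\<bar>
           \<le> real d * exp h * (h\<^sup>2 / 4) / 2 ^ j"
proof -
  let ?N = "2 ^ j :: real"
  define A where "A = 1\<^sub>m d + (1 / 2 ^ Suc j) \<cdot>\<^sub>m H"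
  define B where "B = 1\<^sub>m d + (1 / ?N) \<cdot>\<^sub>m H"
  have Hc [simp]: "H \<in> carrier_mat d d" using op_boundD(1)[OF H] .
  have Ac [simp]: "A \<in> carrier_mat d d" by (simp add: A_def)
  have h: "0 \<le> h" using op_boundD(2)[OF H] .
  have "A * A = 1\<^sub>m d + (1 / 2 ^ Suc j) \<cdot>\<^sub>m H + ((1 / 2 ^ Suc j) \<cdot>\<^sub>m H + ((1 / 2 ^ Suc j) * (1 / 2 ^ Suc j)) \<cdot>\<^sub>m (H * H))"
    unfolding A_def
    by (simp add: square_mat_distrib[of _ d] square_mat_smult_mult[of _ d] smult_smult_mat
        left_mult_one_mat[of _ d d] right_mult_one_mat[of _ d d] add_smult_distrib_left_mat[of _ d d])
  also have "\<dots> - B = (1 / (4 * ?N * ?N)) \<cdot>\<^sub>m (H * H)"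
    unfolding B_def
    by (intro eq_matI) (auto simp: op_boundD(1)[OF H] field_simps simp del: index_mult_mat(1))
  finally have diff: "A * A - B = (1 / (4 * ?N * ?N)) \<cdot>\<^sub>m (H * H)" .
  have "op_bound d (A * A - B) (\<bar>1 / (4 * ?N * ?N)\<bar> * (h * h))"
    unfolding diff by (intro op_bound_smult op_bound_mult H)
  then have D: "op_bound d (A * A - B) (h\<^sup>2 / 4 / (?N * ?N))"
    by (simp add: power2_eq_square mult.assoc)
  have "op_bound d (A * A) (exp (1 / 2 ^ Suc j * h) * exp (1 / 2 ^ Suc j * h))"
    unfolding A_def by (intro op_bound_mult op_bound_step H) auto
  then have A2: "op_bound d (A * A) (exp (h / ?N))"
    by (simp flip: exp_add add: field_simps)
  have B2: "op_bound d B (exp (h / ?N))"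
    using op_bound_step[OF H, of "1 / ?N"] by (simp add: B_def)
  have "exp_approx d H (Suc j) = (A * A) ^\<^sub>m (2 ^ j)"
    using pow_mat_mult[OF Ac, of 2 "2 ^ j"] by (simp add: exp_approx_def A_def pow_mat_2[of _ d])
  moreover have "exp_approx d H j = B ^\<^sub>m (2 ^ j)"
    by (simp add: exp_approx_def B_def)
  ultimately show ?thesis
    using trace_pow_diff_le[OF A2 B2 D h] by simp
qed

lemma trace_exp_LIMSEQ:
  assumes "H \<in> carrier_mat d d"
  shows "(\<lambda>j. mat_trace (exp_approx d H j)) \<longlonglongrightarrow> trace_exp d H"
proof -
  obtain h where h: "op_bound d H h" using op_bound_exists[OF assms] ..
  let ?a = "\<lambda>j. mat_trace (exp_approx d H j)"
  have "summable (\<lambda>j. real d * exp h * (h\<^sup>2 / 4) * (1 / 2) ^ j)"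
    by (intro summable_mult summable_geometric) simp
  then have "summable (\<lambda>j. ?a (Suc j) - ?a j)"
    by (rule summable_comparison_test')
       (use trace_exp_approx_step[OF h] in \<open>simp add: power_divide\<close>)
  then have "convergent (\<lambda>j. ?a j)"
    unfolding summable_iff_convergent sum_lessThan_telescope[of ?a]
    using convergent_add_const_right_iff[of ?a "- ?a 0"] by simp
  then show ?thesis
    by (simp add: trace_exp_def convergent_LIMSEQ_iff)
qed

lemma trace_exp_zero: "trace_exp d (0\<^sub>m d d) = real d"
proof -
  have "(1\<^sub>m d :: real mat) ^\<^sub>m i = 1\<^sub>m d" for i
    by (induction i) auto
  then have "mat_trace (exp_approx d (0\<^sub>m d d) j) = real d" for j
    by (simp add: exp_approx_def mat_trace_def)
  then show ?thesis
    using LIMSEQ_unique[OF trace_exp_LIMSEQ[of "0\<^sub>m d d" d]] by simp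
qed

section \<open>Golden--Thompson in expectation\<close>

lemma transpose_smult_mat: "transpose_mat (k \<cdot>\<^sub>m A) = k \<cdot>\<^sub>m A\<^sup>T"
  by (intro eq_matI) auto

lemma transpose_one_plus_smult:
  "H \<in> carrier_mat d d \<Longrightarrow> H\<^sup>T = H \<Longrightarrow>
     transpose_mat (1\<^sub>m d + (y :: real) \<cdot>\<^sub>m H) = 1\<^sub>m d + y \<cdot>\<^sub>m H"
  by (simp add: transpose_add[of _ d d] transpose_smult_mat)

lemma exp_approx_eq_square:
  assumes "H \<in> carrier_mat d d" "H\<^sup>T = H" "0 < j"
  obtains B where "B \<in> carrier_mat d d" "B\<^sup>T = B" "exp_approx d H j = B * B"
proof -
  let ?A = "1\<^sub>m d + (1 / 2 ^ j) \<cdot>\<^sub>m H"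
  have A: "?A \<in> carrier_mat d d" using assms by simp
  have "2 ^ j = (2 ^ (j - 1) + 2 ^ (j - 1) :: nat)"
    using assms(3) by (cases j) auto
  then have "exp_approx d H j = ?A ^\<^sub>m (2 ^ (j - 1)) * ?A ^\<^sub>m (2 ^ (j - 1))"
    by (simp add: exp_approx_def pow_mat_add[OF A] del: one_add_one)
  moreover have "transpose_mat (?A ^\<^sub>m (2 ^ (j - 1))) = ?A ^\<^sub>m (2 ^ (j - 1))"
    using assms by (simp only: transpose_pow_mat[OF A] transpose_one_plus_smult)
  ultimately show thesis
    using that[of "?A ^\<^sub>m (2 ^ (j - 1))"] A by simp
qed

text \<open>
  The product (1 + H / N) (1 + Z / N) differs from 1 + (H + Z) / N only by H Z / N^2. The trace of its
  N-th power is separated into the powers of the two factors by the trace inequality for products.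
\<close>

lemma golden_thompson_approx:
  assumes H: "op_bound d H h" "H\<^sup>T = H" and Z: "op_bound d Z b" "Z\<^sup>T = Z"
  shows "mat_trace (exp_approx d (H + Z) j)
           \<le> mat_trace (exp_approx d H j * exp_approx d Z j) + real d * exp (h + b) * (h * b) / 2 ^ j"
proof -
  let ?y = "1 / 2 ^ j :: real"
  define P where "P = 1\<^sub>m d + ?y \<cdot>\<^sub>m H"
  define Q where "Q = 1\<^sub>m d + ?y \<cdot>\<^sub>m Z"
  define E where "E = 1\<^sub>m d + ?y \<cdot>\<^sub>m (H + Z)"
  note [simp] = op_boundD(1)[OF H(1)] op_boundD(1)[OF Z(1)]
  have hb: "0 \<le> h" "0 \<le> b" using H Z op_boundD(2) by auto
  have PQ: "P \<in> carrier_mat d d" "Q \<in> carrier_mat d d" "P\<^sup>T = P" "Q\<^sup>T = Q"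
    using H Z by (simp_all add: P_def Q_def transpose_one_plus_smult)
  have "E - P * Q = (- (?y * ?y)) \<cdot>\<^sub>m (H * Z)"
  proof -
    have "P * Q = (1\<^sub>m d + ?y \<cdot>\<^sub>m H) + (?y \<cdot>\<^sub>m Z + (?y * ?y) \<cdot>\<^sub>m (H * Z))"
      unfolding P_def Q_def
      by (simp add: square_mat_distrib[of _ d] square_mat_smult_mult[of _ d] smult_smult_mat
        left_mult_one_mat[of _ d d] right_mult_one_mat[of _ d d] add_smult_distrib_left_mat[of _ d d])
    moreover have "E - \<dots> = (- (?y * ?y)) \<cdot>\<^sub>m (H * Z)"
      unfolding E_def using op_boundD(1)[OF H(1)] op_boundD(1)[OF Z(1)]
      by (intro eq_matI)
         (auto simp: algebra_simps carrier_matD[of _ d d] simp del: index_mult_mat(1))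
    ultimately show ?thesis by simp
  qed
  then have "op_bound d (E - P * Q) (\<bar>- (?y * ?y)\<bar> * (h * b))"
    by (simp only:) (intro op_bound_smult op_bound_mult H Z)
  then have D: "op_bound d (E - P * Q) (h * b / (2 ^ j * 2 ^ j))"
    by simp
  have Eb: "op_bound d E (exp ((h + b) / 2 ^ j))"
    unfolding E_def using op_bound_step[OF op_bound_add[OF H(1) Z(1)], of ?y] by simp
  have "op_bound d (P * Q) (exp (?y * h) * exp (?y * b))"
    unfolding P_def Q_def by (intro op_bound_mult op_bound_step H Z) auto
  then have PQb: "op_bound d (P * Q) (exp ((h + b) / 2 ^ j))"
    by (simp flip: exp_add add: add_divide_distrib)
  have "mat_trace (E ^\<^sub>m (2 ^ j)) \<le> mat_trace ((P * Q) ^\<^sub>m (2 ^ j)) + real d * exp (h + b) * (h * b) / 2 ^ j"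
    using trace_pow_diff_le[OF Eb PQb D] hb by simp
  also have "mat_trace ((P * Q) ^\<^sub>m (2 ^ j)) \<le> mat_trace (P ^\<^sub>m (2 ^ j) * Q ^\<^sub>m (2 ^ j))"
    using PQ by (intro mat_trace_mult_pow_le)
  finally show ?thesis
    by (simp add: exp_approx_def E_def P_def Q_def)
qed

text \<open>
  Expanding the power, all terms of order two and higher have the form Z K Z, and the norm of K is at
  most the value of the corresponding scalar remainder at b. The remainder is carried as a vector r
  with (1 + y Z)^i v = v + i y Z v + Z r. Because Z is symmetric, its contribution to the quadratic
  form is the inner product of Z v and r.
\<close>

lemma quadratic_form_pow_le:
  assumes Z: "op_bound d Z b" "Z\<^sup>T = Z" and b: "0 < b" and y: "0 \<le> y" and v: "v \<in> carrier_vec d"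
  shows "quad_form ((1\<^sub>m d + y \<cdot>\<^sub>m Z) ^\<^sub>m i) v
      \<le> v \<bullet> v + real i * y * quad_form Z v
         + ((1 + y * b) ^ i - 1 - real i * y * b) / b\<^sup>2 * (l2_norm_vec (Z *\<^sub>v v))\<^sup>2"
proof -
  note Zc [simp] = op_boundD(1)[OF Z(1)]
  let ?A = "1\<^sub>m d + y \<cdot>\<^sub>m Z"
  let ?k = "\<lambda>i. ((1 + y * b) ^ i - 1 - real i * y * b) / b\<^sup>2"
  have "\<exists>r\<in>carrier_vec d. ?A ^\<^sub>m i *\<^sub>v v = v + (real i * y) \<cdot>\<^sub>v (Z *\<^sub>v v) + Z *\<^sub>v r
           \<and> l2_norm_vec r \<le> ?k i * l2_norm_vec (Z *\<^sub>v v)"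
  proof (induction i)
    case 0
    have "Z *\<^sub>v 0\<^sub>v d = 0\<^sub>v d" using Zc by (intro eq_vecI) (auto simp: carrier_matD[of Z d d])
    moreover have "0 \<cdot>\<^sub>v (Z *\<^sub>v v) = 0\<^sub>v d" using Zc by (intro eq_vecI) (auto simp: carrier_matD[of Z d d])
    ultimately show ?case using v carrier_matD[OF Zc]
      by (intro bexI[of _ "0\<^sub>v d"]) (auto simp: l2_norm_vec_def)
  next
    case (Suc i)
    then obtain r where r: "r \<in> carrier_vec d"
      and eq: "?A ^\<^sub>m i *\<^sub>v v = v + (real i * y) \<cdot>\<^sub>v (Z *\<^sub>v v) + Z *\<^sub>v r"
      and le: "l2_norm_vec r \<le> ?k i * l2_norm_vec (Z *\<^sub>v v)" by blast
    \<comment> \<open>Applying 1 + y Z to v + i y Z v + Z r gives v + (i + 1) y Z v + Z r'.\<close>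
    define r' where "r' = r + y \<cdot>\<^sub>v (Z *\<^sub>v r) + (real i * y\<^sup>2) \<cdot>\<^sub>v (Z *\<^sub>v v)"
    have r': "r' \<in> carrier_vec d" using r v by (simp add: r'_def)
    have Zr': "Z *\<^sub>v r' = Z *\<^sub>v r + y \<cdot>\<^sub>v (Z *\<^sub>v (Z *\<^sub>v r)) + (real i * y\<^sup>2) \<cdot>\<^sub>v (Z *\<^sub>v (Z *\<^sub>v v))"
      unfolding r'_def using r v
      by (simp add: mult_add_distrib_mat_vec[of _ d d] mult_mat_vec[of _ d d] assoc_add_vec[of _ d])
    define u where "u = ?A ^\<^sub>m i *\<^sub>v v"
    have u: "u \<in> carrier_vec d" using v by (simp add: u_def)
    have "?A ^\<^sub>m Suc i *\<^sub>v v = ?A *\<^sub>v u"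
      using v by (subst pow_mat_Suc_left[of _ d]) (auto simp: u_def assoc_mult_mat_vec[of _ d d _ d])
    also have "\<dots> = u + y \<cdot>\<^sub>v (Z *\<^sub>v u)"
      using u by (simp add: add_mult_distrib_mat_vec[of _ d d] smult_mat_mult_vec[of _ d d])
    also have "Z *\<^sub>v u = Z *\<^sub>v v + (real i * y) \<cdot>\<^sub>v (Z *\<^sub>v (Z *\<^sub>v v)) + Z *\<^sub>v (Z *\<^sub>v r)"
      unfolding u_def eq using r v
      by (simp add: mult_add_distrib_mat_vec[of _ d d] mult_mat_vec[of _ d d] assoc_add_vec[of _ d])
    also have "u + y \<cdot>\<^sub>v \<dots> = v + (real (Suc i) * y) \<cdot>\<^sub>v (Z *\<^sub>v v) + Z *\<^sub>v r'"
      unfolding u_def eq Zr' using r v op_boundD(1)[OF Z(1)]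
      by (intro eq_vecI) (auto simp: algebra_simps power2_eq_square simp del: index_mult_mat_vec)
    finally have 1: "?A ^\<^sub>m Suc i *\<^sub>v v = v + (real (Suc i) * y) \<cdot>\<^sub>v (Z *\<^sub>v v) + Z *\<^sub>v r'" .
    have "l2_norm_vec r' \<le> l2_norm_vec (r + y \<cdot>\<^sub>v (Z *\<^sub>v r)) + l2_norm_vec ((real i * y\<^sup>2) \<cdot>\<^sub>v (Z *\<^sub>v v))"
      unfolding r'_def using r v by (intro l2_norm_vec_triangle[of _ d]) auto
    also have "\<dots> \<le> l2_norm_vec r + y * l2_norm_vec (Z *\<^sub>v r) + real i * y\<^sup>2 * l2_norm_vec (Z *\<^sub>v v)"
      using l2_norm_vec_triangle[of r d "y \<cdot>\<^sub>v (Z *\<^sub>v r)"] r y by (simp add: l2_norm_vec_smult)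
    also have "\<dots> \<le> l2_norm_vec r + y * (b * l2_norm_vec r) + real i * y\<^sup>2 * l2_norm_vec (Z *\<^sub>v v)"
      using op_boundD(3)[OF Z(1) r] y by (intro add_mono mult_left_mono) auto
    also have "\<dots> = (1 + y * b) * l2_norm_vec r + real i * y\<^sup>2 * l2_norm_vec (Z *\<^sub>v v)"
      by (simp add: algebra_simps)
    also have "\<dots> \<le> (1 + y * b) * (?k i * l2_norm_vec (Z *\<^sub>v v)) + real i * y\<^sup>2 * l2_norm_vec (Z *\<^sub>v v)"
      using le y b by (intro add_mono mult_left_mono) auto
    also have "\<dots> = ?k (Suc i) * l2_norm_vec (Z *\<^sub>v v)"
      using b by (simp add: field_simps power2_eq_square)
    finally show ?case using 1 r' by blast
  qed
  then obtain r where r: "r \<in> carrier_vec d"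
    and eq: "?A ^\<^sub>m i *\<^sub>v v = v + (real i * y) \<cdot>\<^sub>v (Z *\<^sub>v v) + Z *\<^sub>v r"
    and le: "l2_norm_vec r \<le> ?k i * l2_norm_vec (Z *\<^sub>v v)" by blast
  have "quad_form (?A ^\<^sub>m i) v = v \<bullet> v + real i * y * quad_form Z v + v \<bullet> (Z *\<^sub>v r)"
    unfolding eq using r v
    by (simp add: scalar_prod_add_distrib[of _ d] scalar_prod_smult_distrib[of _ d])
  moreover have "v \<bullet> (Z *\<^sub>v r) \<le> ?k i * (l2_norm_vec (Z *\<^sub>v v))\<^sup>2"
  proof -
    have "v \<bullet> (Z *\<^sub>v r) = (Z *\<^sub>v v) \<bullet> r"
      using v r Z by (intro symmetric_mat_move[of _ d]) auto
    also have "\<dots> \<le> l2_norm_vec (Z *\<^sub>v v) * l2_norm_vec r"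
      using abs_scalar_prod_le[of "Z *\<^sub>v v" d r] r v by simp
    also have "\<dots> \<le> l2_norm_vec (Z *\<^sub>v v) * (?k i * l2_norm_vec (Z *\<^sub>v v))"
      using le by (intro mult_left_mono) auto
    finally show ?thesis by (simp add: power2_eq_square mult_ac)
  qed
  ultimately show ?thesis by simp
qed

lemma one_plus_div_pow_le_exp:
  assumes "0 \<le> (b :: real)"
  shows "(1 + 1 / 2 ^ j * b) ^ (2 ^ j) \<le> exp b"
proof -
  have "(1 + 1 / 2 ^ j * b) ^ (2 ^ j) \<le> exp (1 / 2 ^ j * b) ^ (2 ^ j)"
    using assms by (intro power_mono exp_ge_add_one_self) auto
  also have "\<dots> = exp b" by (simp flip: exp_of_nat_mult)
  finally show ?thesis .
qed

lemma exp_two_thirds_le: "exp (2 / 3 :: real) \<le> 2"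
proof -
  have "exp (2 :: real) = exp 1 ^ 2" by (simp flip: exp_of_nat_mult)
  also have "\<dots> \<le> (272 / 100) ^ 2" using e_less_272 by (intro power_mono) auto
  also have "\<dots> \<le> 8" by (simp add: power2_eq_square)
  finally have "exp (2 / 3 :: real) ^ 3 \<le> 2 ^ 3" by (simp flip: exp_of_nat_mult)
  then show ?thesis by (subst (asm) power_mono_iff) auto
qed

text \<open>
  The scalar inequality behind this is e^x \<le> 1 + x + 3/4 x^2 for |x| \<le> 2/3, which holds because
  e^(2/3) \<le> 2.
\<close>

lemma exp_approx_quadratic_form_le:
  assumes Z: "op_bound d Z (2 / 3)" "Z\<^sup>T = Z" and v: "v \<in> carrier_vec d"
  shows "quad_form (exp_approx d Z j) v
      \<le> v \<bullet> v + quad_form Z v + 3 / 4 * (l2_norm_vec (Z *\<^sub>v v))\<^sup>2"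
proof -
  let ?b = "2 / 3 :: real"
  have "((1 + 1 / 2 ^ j * ?b) ^ (2 ^ j) - 1 - real (2 ^ j) * (1 / 2 ^ j) * ?b) / ?b\<^sup>2 \<le> 3 / 4"
    using one_plus_div_pow_le_exp[of ?b j] exp_two_thirds_le by (simp add: power2_eq_square)
  then have "((1 + 1 / 2 ^ j * ?b) ^ (2 ^ j) - 1 - real (2 ^ j) * (1 / 2 ^ j) * ?b) / ?b\<^sup>2
        * (l2_norm_vec (Z *\<^sub>v v))\<^sup>2 \<le> 3 / 4 * (l2_norm_vec (Z *\<^sub>v v))\<^sup>2"
    by (rule mult_right_mono) simp
  moreover have "real (2 ^ j) * (1 / 2 ^ j) = 1" by simp
  moreover have "quad_form (exp_approx d Z j) v \<le> v \<bullet> v + real (2 ^ j) * (1 / 2 ^ j) * quad_form Z v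
      + ((1 + 1 / 2 ^ j * ?b) ^ (2 ^ j) - 1 - real (2 ^ j) * (1 / 2 ^ j) * ?b) / ?b\<^sup>2
        * (l2_norm_vec (Z *\<^sub>v v))\<^sup>2"
    unfolding exp_approx_def using v by (intro quadratic_form_pow_le[OF Z]) auto
  ultimately show ?thesis by (simp only: mult_1)
qed

lemma mat_trace_square_mult:
  assumes B: "B \<in> carrier_mat d d" "B\<^sup>T = B" and T: "T \<in> carrier_mat d d"
  shows "mat_trace (B * B * T) = (\<Sum>i<d. col B i \<bullet> (T *\<^sub>v col B i))"
proof -
  have "mat_trace (B * B * T) = mat_trace (B * (B * T))"
    using B T by (simp add: assoc_mult_mat[of _ d d _ d _ d])
  also have "\<dots> = mat_trace ((B * T) * B)"
    using B T by (intro mat_trace_comm[of _ d d]) auto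
  also have "(B * T) * B = B * (T * B)"
    using B T by (simp add: assoc_mult_mat[of _ d d _ d _ d])
  also have "mat_trace (B * (T * B)) = (\<Sum>i<d. row B i \<bullet> col (T * B) i)"
    using B T by (simp add: mat_trace_def)
  also have "\<dots> = (\<Sum>i<d. col B i \<bullet> (T *\<^sub>v col B i))"
  proof (intro sum.cong refl)
    fix i assume i: "i \<in> {..<d}"
    have "row B i = col B i" using B i row_transpose[of i B] by simp
    moreover have "col (T * B) i = T *\<^sub>v col B i" using i B T by (intro eq_vecI) auto
    ultimately show "row B i \<bullet> col (T * B) i = col B i \<bullet> (T *\<^sub>v col B i)" by simp
  qed
  finally show ?thesis .
qed

text \<open>
  The hypothesis cancel says that the second order upper bound for the expectation of e^Z is at most the
  identity. By Golden--Thompson the expected trace of the approximation to e^(H + Z) is at most the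
  trace of e^H against that expectation, up to an error which vanishes in the limit. Writing the
  approximation to e^H as B^2 with B symmetric turns this trace into a sum of quadratic forms at the
  columns of B, where the bound applies.
\<close>

lemma expectation_trace_exp_add_le:
  fixes q :: "'a \<Rightarrow> real" and Z :: "'a \<Rightarrow> real mat"
  assumes fin: "finite I" and q: "\<And>l. l \<in> I \<Longrightarrow> 0 \<le> q l" "sum q I = 1"
    and Z: "\<And>l. l \<in> I \<Longrightarrow> op_bound d (Z l) (2 / 3)" "\<And>l. l \<in> I \<Longrightarrow> transpose_mat (Z l) = Z l"
    and cancel: "\<And>v. v \<in> carrier_vec d \<Longrightarrow>
      (\<Sum>l\<in>I. q l * (quad_form (Z l) v + 3 / 4 * (l2_norm_vec (Z l *\<^sub>v v))\<^sup>2)) \<le> 0"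
    and H: "H \<in> carrier_mat d d" "H\<^sup>T = H"
  shows "(\<Sum>l\<in>I. q l * trace_exp d (H + Z l)) \<le> trace_exp d H"
proof -
  obtain h where h: "op_bound d H h" using op_bound_exists[OF H(1)] ..
  define err where "err j = real d * exp (h + 2 / 3) * (h * (2 / 3)) / 2 ^ j" for j :: nat
  have Zc: "Z l \<in> carrier_mat d d" if "l \<in> I" for l using Z(1)[OF that] op_boundD(1) by blast
  have step: "(\<Sum>l\<in>I. q l * mat_trace (exp_approx d (H + Z l) j)) \<le> mat_trace (exp_approx d H j) + err j"
    if j: "0 < j" for j
  proof -
    obtain B where B: "B \<in> carrier_mat d d" "B\<^sup>T = B" and sq: "exp_approx d H j = B * B"
      using exp_approx_eq_square[OF H j] .
    have "(\<Sum>l\<in>I. q l * mat_trace (exp_approx d (H + Z l) j))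
        \<le> (\<Sum>l\<in>I. q l * (mat_trace (B * B * exp_approx d (Z l) j) + err j))"
      using golden_thompson_approx[OF h H(2) Z(1) Z(2), where j = j] q(1)
      by (intro sum_mono mult_left_mono) (auto simp: err_def sq)
    also have "\<dots> = (\<Sum>l\<in>I. q l * (\<Sum>i<d. col B i \<bullet> (exp_approx d (Z l) j *\<^sub>v col B i))) + err j"
      using q(2) B Zc
      by (simp add: distrib_left sum.distrib mat_trace_square_mult flip: sum_distrib_right)
    also have "\<dots> \<le> (\<Sum>l\<in>I. q l * (\<Sum>i<d. col B i \<bullet> col B i
          + (col B i \<bullet> (Z l *\<^sub>v col B i) + 3 / 4 * (l2_norm_vec (Z l *\<^sub>v col B i))\<^sup>2))) + err j"
      using q(1) B exp_approx_quadratic_form_le[OF Z(1) Z(2), where j = j]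
      by (intro add_right_mono sum_mono mult_left_mono) (auto simp: add.assoc)
    also have "\<dots> = (\<Sum>i<d. (\<Sum>l\<in>I. q l * (col B i \<bullet> col B i
          + (col B i \<bullet> (Z l *\<^sub>v col B i) + 3 / 4 * (l2_norm_vec (Z l *\<^sub>v col B i))\<^sup>2)))) + err j"
      by (simp only: sum_distrib_left sum.swap[of _ "{..<d}"])
    also have "\<dots> \<le> (\<Sum>i<d. col B i \<bullet> col B i) + err j"
    proof (intro add_right_mono sum_mono)
      fix i assume "i \<in> {..<d}"
      then have "col B i \<in> carrier_vec d" using B by simp
      from cancel[OF this]
      show "(\<Sum>l\<in>I. q l * (col B i \<bullet> col B i
          + (col B i \<bullet> (Z l *\<^sub>v col B i) + 3 / 4 * (l2_norm_vec (Z l *\<^sub>v col B i))\<^sup>2))) \<le> col B i \<bullet> col B i"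
        using q(2) by (simp add: distrib_left[of "q _" "_ \<bullet> _" "_ + _"] sum.distrib flip: sum_distrib_right)
    qed
    also have "(\<Sum>i<d. col B i \<bullet> col B i) = mat_trace (exp_approx d H j)"
      using mat_trace_square_mult[OF B, of "1\<^sub>m d"] B by (simp add: sq)
    finally show ?thesis .
  qed
  have "err \<longlonglongrightarrow> 0"
    unfolding err_def by (rule LIMSEQ_divide_realpow_zero) simp
  then have "(\<lambda>j. mat_trace (exp_approx d H j) + err j) \<longlonglongrightarrow> trace_exp d H + 0"
    by (intro tendsto_add trace_exp_LIMSEQ H)
  moreover have "(\<lambda>j. \<Sum>l\<in>I. q l * mat_trace (exp_approx d (H + Z l) j)) \<longlonglongrightarrow> (\<Sum>l\<in>I. q l * trace_exp d (H + Z l))"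
    using H Zc by (intro tendsto_sum tendsto_mult tendsto_const trace_exp_LIMSEQ) auto
  ultimately show ?thesis
    using step by (intro LIMSEQ_le[where X = "\<lambda>j. \<Sum>l\<in>I. q l * mat_trace (exp_approx d (H + Z l) j)"])
      (auto intro!: exI[of _ 1])
qed

text \<open>
  Jensen's inequality for the power 2^j, obtained from j applications of Cauchy--Schwarz.
\<close>

lemma quadratic_form_power_le:
  fixes A :: "real mat"
  assumes "v \<in> carrier_vec d" "v \<bullet> v = 1"
  shows "A \<in> carrier_mat d d \<Longrightarrow> A\<^sup>T = A \<Longrightarrow>
    (quad_form A v) ^ (2 ^ j) \<le> quad_form (A ^\<^sub>m (2 ^ j)) v"
proof (induction j arbitrary: A)
  case 0
  then show ?case by (simp add: pow_mat_1[of _ d] del: pow_mat.simps)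
next
  case (Suc j)
  note [simp] = Suc.prems assms(1)
  have "quad_form A v \<le> \<bar>v \<bullet> (A *\<^sub>v v)\<bar>" by simp
  have "\<bar>v \<bullet> (A *\<^sub>v v)\<bar>\<^sup>2 \<le> (l2_norm_vec v * l2_norm_vec (A *\<^sub>v v))\<^sup>2"
    by (intro power_mono abs_scalar_prod_le[of _ d]) auto
  also have "\<dots> = quad_form (A * A) v"
    using symmetric_mat_move[of A d v "A *\<^sub>v v"] assms(2)
    by (simp add: power_mult_distrib l2_norm_vec_square assoc_mult_mat_vec[of _ d d _ d])
  finally have "(quad_form A v)\<^sup>2 ^ (2 ^ j) \<le> quad_form (A * A) v ^ (2 ^ j)"
    by (intro power_mono) auto
  also have "\<dots> \<le> quad_form ((A * A) ^\<^sub>m (2 ^ j)) v"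
    by (intro Suc.IH) (auto simp: transpose_mult[of _ d d _ d])
  also have "(A * A) ^\<^sub>m (2 ^ j) = A ^\<^sub>m (2 ^ Suc j)"
    using pow_mat_mult[of A d 2 "2 ^ j"] by (simp add: pow_mat_2[of _ d])
  finally show ?case by (simp flip: power_mult)
qed

lemma exp_quadratic_form_le_trace_exp:
  assumes v: "v \<in> carrier_vec d" "v \<bullet> v = 1" and H: "H \<in> carrier_mat d d" "H\<^sup>T = H"
  shows "exp (quad_form H v) \<le> trace_exp d H"
proof (rule LIMSEQ_le)
  let ?x = "quad_form H v"
  have "filterlim (\<lambda>j. 2 ^ j :: nat) at_top sequentially"
    by (intro filterlim_subseq strict_monoI) auto
  from filterlim_compose[OF tendsto_exp_limit_sequentially this, of ?x]
  show "(\<lambda>j. (1 + ?x / 2 ^ j) ^ (2 ^ j)) \<longlonglongrightarrow> exp ?x" by simp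
  show "(\<lambda>j. mat_trace (exp_approx d H j)) \<longlonglongrightarrow> trace_exp d H"
    by (intro trace_exp_LIMSEQ H)
  have "(1 + ?x / 2 ^ j) ^ (2 ^ j) \<le> mat_trace (exp_approx d H j)" if j: "0 < j" for j
  proof -
    let ?A = "1\<^sub>m d + (1 / 2 ^ j) \<cdot>\<^sub>m H"
    obtain B where B: "B \<in> carrier_mat d d" "B\<^sup>T = B" and sq: "exp_approx d H j = B * B"
      using exp_approx_eq_square[OF H j] .
    have "quad_form ?A v = 1 + ?x / 2 ^ j"
      using v H by (simp add: add_mult_distrib_mat_vec[of _ d d] smult_mat_mult_vec[of _ d d]
          scalar_prod_add_distrib[of _ d] scalar_prod_smult_distrib[of _ d])
    then have "(1 + ?x / 2 ^ j) ^ (2 ^ j) \<le> quad_form (B * B) v"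
      using quadratic_form_power_le[OF v, of ?A j] H
      by (simp add: transpose_one_plus_smult exp_approx_def flip: sq)
    also have "\<dots> = (l2_norm_vec (B *\<^sub>v v))\<^sup>2"
      using B v symmetric_mat_move[of B d v "B *\<^sub>v v"]
      by (simp add: assoc_mult_mat_vec[of _ d d _ d] l2_norm_vec_square)
    also have "\<dots> \<le> (sqrt (\<Sum>i<d. row B i \<bullet> row B i) * l2_norm_vec v)\<^sup>2"
      using B v by (intro power_mono l2_norm_mult_mat_vec_le) auto
    also have "\<dots> = (\<Sum>i<d. row B i \<bullet> row B i)"
      using v by (simp add: power_mult_distrib l2_norm_vec_square sum_nonneg scalar_prod_self_nonneg)
    also have "\<dots> = mat_trace (B * B)"
      using B row_transpose[of _ B] by (simp add: mat_trace_def)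
    finally show ?thesis by (simp add: sq)
  qed
  then show "\<exists>N. \<forall>j\<ge>N. (1 + ?x / 2 ^ j) ^ (2 ^ j) \<le> mat_trace (exp_approx d H j)"
    by (intro exI[of _ 1]) auto
qed

section \<open>Independent sums\<close>

lemma sum_mat_carrier [simp]: "sum_mat nr nc F T \<in> carrier_mat nr nc"
  by (simp add: sum_mat_def)

lemma sum_mat_cong: "(\<And>t. t \<in> T \<Longrightarrow> F t = G t) \<Longrightarrow> sum_mat nr nc F T = sum_mat nr nc G T"
  by (simp add: sum_mat_def)

lemma sum_mat_insert:
  assumes "finite T" "x \<notin> T" "F x \<in> carrier_mat nr nc"
  shows "sum_mat nr nc F (insert x T) = F x + sum_mat nr nc F T"
  using assms by (intro eq_matI) (auto simp: sum_mat_def)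

lemma sum_mat_symmetric:
  assumes "\<And>t. t \<in> T \<Longrightarrow> F t \<in> carrier_mat d d" "\<And>t. t \<in> T \<Longrightarrow> transpose_mat (F t) = F t"
  shows "transpose_mat (sum_mat d d F T) = sum_mat d d F T"
proof (rule eq_matI)
  fix i j assume ij: "i < dim_row (sum_mat d d F T)" "j < dim_col (sum_mat d d F T)"
  have "F t $$ (j, i) = F t $$ (i, j)" if "t \<in> T" for t
    using assms[OF that] ij index_transpose_mat(1)[of i "F t" j] by (simp add: sum_mat_def)
  then show "transpose_mat (sum_mat d d F T) $$ (i, j) = sum_mat d d F T $$ (i, j)"
    using ij by (simp add: sum_mat_def)
qed (auto simp: sum_mat_def)

lemma bilinear_form_sum_mat:
  assumes "\<And>t. t \<in> T \<Longrightarrow> F t \<in> carrier_mat nr nc" "u \<in> carrier_vec nr" "v \<in> carrier_vec nc"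
  shows "u \<bullet> (sum_mat nr nc F T *\<^sub>v v) = (\<Sum>t\<in>T. u \<bullet> (F t *\<^sub>v v))"
proof -
  have "u \<bullet> (sum_mat nr nc F T *\<^sub>v v)
      = (\<Sum>i\<in>{0..<nr}. u $ i * (\<Sum>j\<in>{0..<nc}. (\<Sum>t\<in>T. F t $$ (i, j)) * v $ j))"
    using assms by (simp add: scalar_prod_def sum_mat_def)
  also have "\<dots> = (\<Sum>i\<in>{0..<nr}. \<Sum>j\<in>{0..<nc}. \<Sum>t\<in>T. u $ i * (F t $$ (i, j) * v $ j))"
    by (simp add: sum_distrib_left sum_distrib_right)
  also have "\<dots> = (\<Sum>t\<in>T. \<Sum>i\<in>{0..<nr}. \<Sum>j\<in>{0..<nc}. u $ i * (F t $$ (i, j) * v $ j))"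
    by (simp only: sum.swap[of _ T])
  also have "\<dots> = (\<Sum>t\<in>T. u \<bullet> (F t *\<^sub>v v))"
  proof (intro sum.cong refl)
    fix t assume "t \<in> T"
    from assms(1)[OF this] show "(\<Sum>i\<in>{0..<nr}. \<Sum>j\<in>{0..<nc}. u $ i * (F t $$ (i, j) * v $ j)) = u \<bullet> (F t *\<^sub>v v)"
      using assms by (simp add: scalar_prod_def sum_distrib_left)
  qed
  finally show ?thesis .
qed

lemma finite_set_Pi_pmf:
  "finite I \<Longrightarrow> (\<And>i. i \<in> I \<Longrightarrow> finite (set_pmf (q i))) \<Longrightarrow> finite (set_pmf (Pi_pmf I dflt q))"
  by (subst set_Pi_pmf) auto

lemma expectation_mono_finite:
  assumes "finite (set_pmf q)" "\<And>x. x \<in> set_pmf q \<Longrightarrow> f x \<le> (g x :: real)"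
  shows "measure_pmf.expectation q f \<le> measure_pmf.expectation q g"
  using assms by (intro integral_mono_AE integrable_measure_pmf_finite) (auto simp: AE_measure_pmf_iff)

text \<open>
  Adding the independent random matrix D to any symmetric matrix does not increase the expected trace
  of the exponential. The property is stated for all H so that it survives sums of independent terms.
\<close>

definition trace_exp_contraction :: "nat \<Rightarrow> 'a pmf \<Rightarrow> ('a \<Rightarrow> real mat) \<Rightarrow> bool" where
  "trace_exp_contraction d q D \<longleftrightarrow>
     finite (set_pmf q) \<and>
     (\<forall>l\<in>set_pmf q. D l \<in> carrier_mat d d \<and> transpose_mat (D l) = D l) \<and>
     (\<forall>H\<in>carrier_mat d d. H\<^sup>T = H \<longrightarrow>
        measure_pmf.expectation q (\<lambda>l. trace_exp d (H + D l)) \<le> trace_exp d H)"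

text \<open>
  Conditioning on one coordinate at a time, the remaining ones act on H shifted by the outcome of that
  coordinate, which is again symmetric.
\<close>

lemma trace_exp_contraction_Pi_pmf:
  assumes "finite I" "\<And>i. i \<in> I \<Longrightarrow> trace_exp_contraction d (q i) (D i)"
  shows "trace_exp_contraction d (Pi_pmf I dflt q) (\<lambda>om. sum_mat d d (\<lambda>i. D i (om i)) I)"
  using assms
proof (induction I rule: finite_induct)
  case empty
  have "sum_mat d d F {} = 0\<^sub>m d d" for F :: "nat \<Rightarrow> real mat"
    by (intro eq_matI) (auto simp: sum_mat_def)
  then show ?case by (auto simp: trace_exp_contraction_def)
next
  case (insert x I)
  let ?S = "\<lambda>om. sum_mat d d (\<lambda>i. D i (om i)) I"
  have x: "trace_exp_contraction d (q x) (D x)" using insert.prems by simp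
  have IH: "trace_exp_contraction d (Pi_pmf I dflt q) ?S" using insert by simp
  have fin: "finite (set_pmf (q i))" if "i \<in> insert x I" for i
    using insert.prems[OF that] by (simp add: trace_exp_contraction_def)
  have D: "D i l \<in> carrier_mat d d" "transpose_mat (D i l) = D i l"
    if "i \<in> insert x I" "l \<in> set_pmf (q i)" for i l
    using insert.prems[OF that(1)] that(2) by (auto simp: trace_exp_contraction_def)
  have mem: "om i \<in> set_pmf (q i)" if "om \<in> set_pmf (Pi_pmf (insert x I) dflt q)" "i \<in> insert x I" for om i
    using that insert.hyps by (subst (asm) set_Pi_pmf) (auto simp: PiE_dflt_def)
  show ?case
    unfolding trace_exp_contraction_def
  proof (intro conjI ballI impI)
    show "finite (set_pmf (Pi_pmf (insert x I) dflt q))"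
      using insert.hyps fin by (intro finite_set_Pi_pmf) auto
  next
    fix om assume om: "om \<in> set_pmf (Pi_pmf (insert x I) dflt q)"
    show "sum_mat d d (\<lambda>i. D i (om i)) (insert x I) \<in> carrier_mat d d" by simp
    show "transpose_mat (sum_mat d d (\<lambda>i. D i (om i)) (insert x I)) = sum_mat d d (\<lambda>i. D i (om i)) (insert x I)"
      using D mem[OF om] by (intro sum_mat_symmetric) auto
  next
    fix H :: "real mat" assume H: "H \<in> carrier_mat d d" "H\<^sup>T = H"
    let ?E = "measure_pmf.expectation"
    let ?h = "\<lambda>om. trace_exp d (H + sum_mat d d (\<lambda>i. D i (om i)) (insert x I))"
    have peel: "?h (om(x := y)) = trace_exp d ((H + D x y) + ?S om)" if "y \<in> set_pmf (q x)" for om y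
    proof -
      have "sum_mat d d (\<lambda>i. D i ((om(x := y)) i)) (insert x I) = D x y + ?S om"
        using insert.hyps D(1)[OF _ that]
        by (subst sum_mat_insert) (auto intro!: arg_cong2[where f = "(+)"] sum_mat_cong)
      then show ?thesis
        using H D(1)[OF _ that] by (simp add: assoc_add_mat[of _ d d])
    qed
    have "?E (Pi_pmf (insert x I) dflt q) ?h
        = (\<Sum>y\<in>set_pmf (q x). pmf (q x) y * ?E (map_pmf (\<lambda>f. f(x := y)) (Pi_pmf I dflt q)) ?h)"
      unfolding Pi_pmf_insert'[OF insert.hyps] map_pmf_def[symmetric]
      using fin insert.hyps by (subst pmf_expectation_bind[of "set_pmf (q x)"]) (auto intro!: finite_set_Pi_pmf)
    also have "\<dots> = (\<Sum>y\<in>set_pmf (q x). pmf (q x) y * ?E (Pi_pmf I dflt q) (\<lambda>om. trace_exp d ((H + D x y) + ?S om)))"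
      by (intro sum.cong refl) (simp add: peel del: fun_upd_apply)
    also have "\<dots> \<le> (\<Sum>y\<in>set_pmf (q x). pmf (q x) y * trace_exp d (H + D x y))"
    proof (intro sum_mono mult_left_mono)
      fix y assume y: "y \<in> set_pmf (q x)"
      have "H + D x y \<in> carrier_mat d d" "transpose_mat (H + D x y) = H + D x y"
        using H D[OF _ y] by (auto simp: transpose_add[of _ d d])
      then show "?E (Pi_pmf I dflt q) (\<lambda>om. trace_exp d ((H + D x y) + ?S om)) \<le> trace_exp d (H + D x y)"
        using IH by (simp add: trace_exp_contraction_def)
    qed simp
    also have "\<dots> = ?E (q x) (\<lambda>y. trace_exp d (H + D x y))"
      using fin by (subst integral_measure_pmf_real[of "set_pmf (q x)"]) (auto simp: mult.commute)
    also have "\<dots> \<le> trace_exp d H"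
      using x H by (simp add: trace_exp_contraction_def)
    finally show "?E (Pi_pmf (insert x I) dflt q) ?h \<le> trace_exp d H" .
  qed
qed

lemma trace_exp_nonneg:
  assumes H: "H \<in> carrier_mat d d" "H\<^sup>T = H"
  shows "0 \<le> trace_exp d H"
proof (rule LIMSEQ_le_const[OF trace_exp_LIMSEQ[OF H(1)]])
  have "0 \<le> mat_trace (exp_approx d H j)" if j: "0 < j" for j
  proof -
    obtain B where B: "B \<in> carrier_mat d d" "B\<^sup>T = B" and sq: "exp_approx d H j = B * B"
      using exp_approx_eq_square[OF H j] .
    show ?thesis
      using mat_trace_square_mult[OF B, of "1\<^sub>m d"] B
      by (simp add: sq sum_nonneg scalar_prod_self_nonneg)
  qed
  then show "\<exists>N. \<forall>j\<ge>N. 0 \<le> mat_trace (exp_approx d H j)" by (intro exI[of _ 1]) auto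
qed

text \<open>
  Markov's inequality for the trace of the exponential, started at H = 0 where this trace is the
  dimension.
\<close>

lemma trace_exp_contraction_tail:
  assumes "trace_exp_contraction d Q D"
  shows "measure_pmf.prob Q {om. \<exists>v\<in>carrier_vec d. v \<bullet> v = 1 \<and> a \<le> quad_form (D om) v} \<le> real d * exp (- a)"
proof -
  let ?B = "{om. \<exists>v\<in>carrier_vec d. v \<bullet> v = 1 \<and> a \<le> quad_form (D om) v}"
  have fin: "finite (set_pmf Q)" and
    D: "\<And>om. om \<in> set_pmf Q \<Longrightarrow> D om \<in> carrier_mat d d \<and> transpose_mat (D om) = D om"
    and c: "measure_pmf.expectation Q (\<lambda>om. trace_exp d (0\<^sub>m d d + D om)) \<le> trace_exp d (0\<^sub>m d d)"
    using assms by (auto simp: trace_exp_contraction_def)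
  have "exp a * measure_pmf.prob Q ?B = measure_pmf.expectation Q (\<lambda>om. exp a * indicator ?B om)"
    by simp
  also have "\<dots> \<le> measure_pmf.expectation Q (\<lambda>om. trace_exp d (0\<^sub>m d d + D om))"
  proof (intro expectation_mono_finite fin)
    fix om assume om: "om \<in> set_pmf Q"
    show "exp a * indicator ?B om \<le> trace_exp d (0\<^sub>m d d + D om)"
    proof (cases "om \<in> ?B")
      case True
      then obtain v where v: "v \<in> carrier_vec d" "v \<bullet> v = 1" "a \<le> quad_form (D om) v" by auto
      have "exp a \<le> exp (quad_form (D om) v)" using v(3) by simp
      also have "\<dots> \<le> trace_exp d (D om)"
        using D[OF om] v by (intro exp_quadratic_form_le_trace_exp) auto
      finally show ?thesis using True D[OF om] by simp
    qed (use D[OF om] trace_exp_nonneg in auto)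
  qed
  also have "\<dots> \<le> real d" using c by (simp add: trace_exp_zero)
  finally show ?thesis by (simp add: exp_minus field_simps)
qed

text \<open>
  For symmetric Z the quadratic form determines the norm: polarization bounds the inner product of u and
  Z v, and u is taken parallel to Z v with the length of v.
\<close>

lemma op_bound_of_quadratic_form:
  assumes Z: "Z \<in> carrier_mat d d" "Z\<^sup>T = Z" and b: "0 \<le> b"
    and q: "\<And>v. v \<in> carrier_vec d \<Longrightarrow> \<bar>v \<bullet> (Z *\<^sub>v v)\<bar> \<le> b * (v \<bullet> v)"
  shows "op_bound d Z b"
  unfolding op_bound_def
proof (intro conjI ballI)
  fix v :: "real vec" assume v: "v \<in> carrier_vec d"
  let ?w = "Z *\<^sub>v v"
  let ?x = "l2_norm_vec v" and ?y = "l2_norm_vec ?w"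
  have w: "?w \<in> carrier_vec d" using Z v by simp
  \<comment> \<open>Rescaling u to the length of v balances the two terms in the polarization identity.\<close>
  define u where "u = (?x / ?y) \<cdot>\<^sub>v ?w"
  show "?y \<le> b * ?x"
  proof (cases "?y = 0")
    case True
    then show ?thesis using b by simp
  next
    case False
    have u: "u \<in> carrier_vec d" using w by (simp add: u_def)
    have ww: "?w \<bullet> ?w = ?y * ?y"
      using l2_norm_vec_square[of ?w] by (simp add: power2_eq_square)
    have uu: "u \<bullet> u = ?x\<^sup>2"
      using False w by (simp add: u_def ww power2_eq_square)
    have uw: "u \<bullet> ?w = ?x * ?y"
      using False w by (simp add: u_def ww)
    have sym: "v \<bullet> (Z *\<^sub>v u) = u \<bullet> ?w"
      using symmetric_mat_move[OF Z v u] comm_scalar_prod[OF w u] by simp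
    have plus: "(u + v) \<bullet> (Z *\<^sub>v (u + v)) = quad_form Z u + 2 * (u \<bullet> ?w) + v \<bullet> ?w"
      using Z u v sym by (simp add: mult_add_distrib_mat_vec[of _ d d] add_scalar_prod_distrib[of _ d]
          scalar_prod_add_distrib[of _ d])
    have minus: "(u - v) \<bullet> (Z *\<^sub>v (u - v)) = quad_form Z u - 2 * (u \<bullet> ?w) + v \<bullet> ?w"
      using Z u v sym by (simp add: mult_minus_distrib_mat_vec[of _ d d] minus_scalar_prod_distrib[of _ d]
          scalar_prod_minus_distrib[of _ d])
    have "4 * (u \<bullet> ?w) \<le> b * ((u + v) \<bullet> (u + v)) + b * ((u - v) \<bullet> (u - v))"
      using q[of "u + v"] q[of "u - v"] u v plus minus by simp
    also have "\<dots> = 4 * b * ?x\<^sup>2"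
      using u v uu comm_scalar_prod[OF u v] l2_norm_vec_square[of v]
      by (simp add: add_scalar_prod_distrib[of _ d] scalar_prod_add_distrib[of _ d]
          minus_scalar_prod_distrib[of _ d] scalar_prod_minus_distrib[of _ d] algebra_simps)
    finally have "?x * ?y \<le> ?x * (b * ?x)" by (simp add: uw power2_eq_square algebra_simps)
    moreover have "0 < ?x"
    proof -
      have "?x \<noteq> 0"
      proof
        assume "?x = 0"
        then have "v = 0\<^sub>v d" using v l2_norm_vec_zero_iff by blast
        then have "?w = 0\<^sub>v d" using Z by (intro eq_vecI) (auto simp: carrier_matD[of Z d d])
        then show False using False l2_norm_vec_zero_iff[of ?w d] by simp
      qed
      then show ?thesis using l2_norm_vec_nonneg[of v] by linarith
    qed
    ultimately show ?thesis by simp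
  qed
qed (use Z b in auto)

text \<open>
  This is X^2 \<le> X for 0 \<le> X \<le> 1, read off from the form of X at v - X v.
\<close>

lemma psd_square_le:
  assumes X: "X \<in> carrier_mat d d" "X\<^sup>T = X"
    and psd: "\<And>v. v \<in> carrier_vec d \<Longrightarrow> 0 \<le> quad_form X v"
    and le: "\<And>v. v \<in> carrier_vec d \<Longrightarrow> quad_form X v \<le> v \<bullet> (v :: real vec)"
    and v: "v \<in> carrier_vec d"
  shows "(l2_norm_vec (X *\<^sub>v v))\<^sup>2 \<le> quad_form X v"
proof -
  let ?w = "X *\<^sub>v v"
  have w: "?w \<in> carrier_vec d" using X v by simp
  have "v \<bullet> (X *\<^sub>v ?w) = ?w \<bullet> ?w" using symmetric_mat_move[OF X v w] .
  then have "(v - ?w) \<bullet> (X *\<^sub>v (v - ?w)) = v \<bullet> ?w - 2 * (?w \<bullet> ?w) + quad_form X ?w"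
    using X v w by (simp add: mult_minus_distrib_mat_vec[of _ d d] minus_scalar_prod_distrib[of _ d]
        scalar_prod_minus_distrib[of _ d])
  then show ?thesis
    using psd[of "v - ?w"] le[OF w] v w by (simp add: l2_norm_vec_square)
qed

text \<open>
  With the coefficient g = theta - 3/4 theta^2 of the mean, the first and second order terms of e^Z cancel
  in expectation: that of Z is -3/4 theta^2 M, and that of Z^2 is at most theta^2 M, because the terms
  containing M twice contribute g^2 - 2 g theta \<le> 0 times M^2. The norm of Z is at most theta, since
  the form of Z lies between -theta and g.
\<close>

lemma trace_exp_contraction_centered_psd:
  fixes X :: "'a \<Rightarrow> real mat" and \<theta> :: real
  assumes fin: "finite (set_pmf q)"
    and X: "\<And>l. l \<in> set_pmf q \<Longrightarrow> X l \<in> carrier_mat d d" "\<And>l. l \<in> set_pmf q \<Longrightarrow> transpose_mat (X l) = X l"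
    and psd: "\<And>l v. l \<in> set_pmf q \<Longrightarrow> v \<in> carrier_vec d \<Longrightarrow> 0 \<le> quad_form (X l) v"
    and le: "\<And>l v. l \<in> set_pmf q \<Longrightarrow> v \<in> carrier_vec d \<Longrightarrow> quad_form (X l) v \<le> v \<bullet> v"
    and M: "M \<in> carrier_mat d d" "M\<^sup>T = M"
    and mean: "\<And>u v. u \<in> carrier_vec d \<Longrightarrow> v \<in> carrier_vec d \<Longrightarrow>
       measure_pmf.expectation q (\<lambda>l. u \<bullet> (X l *\<^sub>v v)) = u \<bullet> (M *\<^sub>v v)"
    and \<theta>: "0 \<le> \<theta>" "\<theta> \<le> 2 / 3"
  shows "trace_exp_contraction d q (\<lambda>l. (\<theta> - 3 / 4 * \<theta>\<^sup>2) \<cdot>\<^sub>m M - \<theta> \<cdot>\<^sub>m X l)"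
proof -
  define g where "g = \<theta> - 3 / 4 * \<theta>\<^sup>2"
  define Z where "Z l = g \<cdot>\<^sub>m M - \<theta> \<cdot>\<^sub>m X l" for l
  have "\<theta> * \<theta> \<le> \<theta> * (2 / 3)" using \<theta> by (intro mult_left_mono)
  then have g: "0 \<le> g" "g \<le> \<theta>" using \<theta> by (auto simp: g_def power2_eq_square)
  have sum_expect: "measure_pmf.expectation q f = (\<Sum>l\<in>set_pmf q. pmf q l * f l)" for f :: "'a \<Rightarrow> real"
    using fin by (subst integral_measure_pmf_real[of "set_pmf q"]) (auto simp: mult.commute)
  have total: "(\<Sum>l\<in>set_pmf q. pmf q l) = 1"
    using fin by (intro sum_pmf_eq_1) auto
  have Zv: "Z l *\<^sub>v v = g \<cdot>\<^sub>v (M *\<^sub>v v) - \<theta> \<cdot>\<^sub>v (X l *\<^sub>v v)"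
    if "l \<in> set_pmf q" "v \<in> carrier_vec d" for l v
    using that M X by (simp add: Z_def minus_mult_distrib_mat_vec[of _ d d] smult_mat_mult_vec[of _ d d])
  have Zc: "Z l \<in> carrier_mat d d" "transpose_mat (Z l) = Z l" if "l \<in> set_pmf q" for l
    using that M X by (auto simp: Z_def transpose_minus[of _ d d] transpose_smult_mat minus_carrier_mat)
  have Mv: "0 \<le> quad_form M v" "quad_form M v \<le> v \<bullet> v" if v: "v \<in> carrier_vec d" for v
  proof -
    show "0 \<le> quad_form M v"
      unfolding mean[OF v v, symmetric] sum_expect using psd[OF _ v] by (intro sum_nonneg) auto
    have "quad_form M v \<le> (\<Sum>l\<in>set_pmf q. pmf q l * (v \<bullet> v))"
      unfolding mean[OF v v, symmetric] sum_expect using le[OF _ v] by (intro sum_mono mult_left_mono) auto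
    then show "quad_form M v \<le> v \<bullet> v" by (simp add: total flip: sum_distrib_right)
  qed
  have vZv: "quad_form (Z l) v = g * quad_form M v - \<theta> * quad_form (X l) v"
    if "l \<in> set_pmf q" "v \<in> carrier_vec d" for l v
    using that M X by (simp add: Zv scalar_prod_minus_distrib[of _ d] scalar_prod_smult_distrib[of _ d])
  have bound: "op_bound d (Z l) (2 / 3)" if l: "l \<in> set_pmf q" for l
  proof (rule op_bound_mono)
    show "op_bound d (Z l) \<theta>"
    proof (rule op_bound_of_quadratic_form[OF Zc[OF l] \<theta>(1)])
      fix v :: "real vec" assume v: "v \<in> carrier_vec d"
      have "0 \<le> g * quad_form M v" "0 \<le> \<theta> * quad_form (X l) v"
        using g \<theta> Mv[OF v] psd[OF l v] by auto
      moreover have "g * quad_form M v \<le> \<theta> * (v \<bullet> v)" "\<theta> * quad_form (X l) v \<le> \<theta> * (v \<bullet> v)"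
        using g \<theta> Mv[OF v] le[OF l v] by (auto intro: mult_mono mult_left_mono)
      ultimately show "\<bar>v \<bullet> (Z l *\<^sub>v v)\<bar> \<le> \<theta> * (v \<bullet> v)"
        unfolding vZv[OF l v] by linarith
    qed
  qed (rule \<theta>(2))
  have cancel: "(\<Sum>l\<in>set_pmf q. pmf q l * (quad_form (Z l) v + 3 / 4 * (l2_norm_vec (Z l *\<^sub>v v))\<^sup>2)) \<le> 0"
    if v: "v \<in> carrier_vec d" for v
  proof -
    let ?m = "M *\<^sub>v v"
    have m: "?m \<in> carrier_vec d" using M v by simp
    have sq: "(l2_norm_vec (Z l *\<^sub>v v))\<^sup>2
        \<le> g\<^sup>2 * (?m \<bullet> ?m) - 2 * g * \<theta> * (?m \<bullet> (X l *\<^sub>v v)) + \<theta>\<^sup>2 * quad_form (X l) v"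
      if l: "l \<in> set_pmf q" for l
    proof -
      let ?x = "X l *\<^sub>v v"
      have x: "?x \<in> carrier_vec d" using X[OF l] v by simp
      have "(l2_norm_vec (Z l *\<^sub>v v))\<^sup>2
          = g\<^sup>2 * (?m \<bullet> ?m) - 2 * g * \<theta> * (?m \<bullet> ?x) + \<theta>\<^sup>2 * (?x \<bullet> ?x)"
        using m x comm_scalar_prod[OF m x] unfolding l2_norm_vec_square Zv[OF l v]
        by (simp add: minus_scalar_prod_distrib[of _ d] scalar_prod_minus_distrib[of _ d]
            smult_scalar_prod_distrib[of _ d] scalar_prod_smult_distrib[of _ d] power2_eq_square algebra_simps)
      moreover have "?x \<bullet> ?x \<le> v \<bullet> ?x"
        using psd_square_le[OF X(1,2)[OF l] psd[OF l] le[OF l] v] by (simp add: l2_norm_vec_square)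
      ultimately show ?thesis by (simp add: mult_left_mono)
    qed
    have "(\<Sum>l\<in>set_pmf q. pmf q l * (quad_form (Z l) v + 3 / 4 * (l2_norm_vec (Z l *\<^sub>v v))\<^sup>2))
        \<le> (\<Sum>l\<in>set_pmf q. pmf q l * (g * (v \<bullet> ?m) + 3 / 4 * g\<^sup>2 * (?m \<bullet> ?m)
             + (3 / 4 * \<theta>\<^sup>2 - \<theta>) * quad_form (X l) v - (3 / 2 * g * \<theta>) * (?m \<bullet> (X l *\<^sub>v v))))"
    proof (intro sum_mono mult_left_mono)
      fix l assume l: "l \<in> set_pmf q"
      show "quad_form (Z l) v + 3 / 4 * (l2_norm_vec (Z l *\<^sub>v v))\<^sup>2
          \<le> g * (v \<bullet> ?m) + 3 / 4 * g\<^sup>2 * (?m \<bullet> ?m)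
             + (3 / 4 * \<theta>\<^sup>2 - \<theta>) * quad_form (X l) v - (3 / 2 * g * \<theta>) * (?m \<bullet> (X l *\<^sub>v v))"
        using sq[OF l] unfolding vZv[OF l v] by (simp add: algebra_simps)
    qed simp
    also have "\<dots> = (\<Sum>l\<in>set_pmf q. pmf q l) * (g * (v \<bullet> ?m) + 3 / 4 * g\<^sup>2 * (?m \<bullet> ?m))
        + (3 / 4 * \<theta>\<^sup>2 - \<theta>) * (\<Sum>l\<in>set_pmf q. pmf q l * quad_form (X l) v)
        - (3 / 2 * g * \<theta>) * (\<Sum>l\<in>set_pmf q. pmf q l * (?m \<bullet> (X l *\<^sub>v v)))"
      unfolding sum_distrib_left sum_distrib_right sum.distrib[symmetric] sum_subtractf[symmetric]
      by (intro sum.cong refl) (simp add: algebra_simps)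
    also have "\<dots> = g * (v \<bullet> ?m) + 3 / 4 * g\<^sup>2 * (?m \<bullet> ?m)
        + (3 / 4 * \<theta>\<^sup>2 - \<theta>) * (v \<bullet> ?m) - (3 / 2 * g * \<theta>) * (?m \<bullet> ?m)"
      unfolding sum_expect[symmetric] mean[OF v v] mean[OF m v] total by simp
    also have "\<dots> = 3 / 4 * (g * g - 2 * (g * \<theta>)) * (?m \<bullet> ?m)"
      by (simp add: g_def power2_eq_square algebra_simps)
    also have "\<dots> \<le> 0"
    proof (rule mult_nonpos_nonneg[OF _ scalar_prod_self_nonneg])
      have "g * g \<le> g * \<theta>" "0 \<le> g * \<theta>" using g \<theta> by (auto intro: mult_left_mono)
      then have "g * g - 2 * (g * \<theta>) \<le> 0" by linarith
      then show "3 / 4 * (g * g - 2 * (g * \<theta>)) \<le> 0" by (intro mult_nonneg_nonpos) auto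
    qed
    finally show ?thesis .
  qed
  have "measure_pmf.expectation q (\<lambda>l. trace_exp d (H + Z l)) \<le> trace_exp d H"
    if "H \<in> carrier_mat d d" "H\<^sup>T = H" for H
    unfolding sum_expect using fin total Zc bound cancel that
    by (intro expectation_trace_exp_add_le) auto
  then show ?thesis
    using fin Zc by (auto simp: trace_exp_contraction_def Z_def g_def)
qed

section \<open>Extreme eigenvalues of symmetric matrices\<close>

lemma spectrum_iff:
  assumes "A \<in> carrier_mat d d"
  shows "c \<in> spectrum A \<longleftrightarrow> (\<exists>v\<in>carrier_vec d. v \<noteq> 0\<^sub>v d \<and> A *\<^sub>v v = c \<cdot>\<^sub>v v)"
  using assms by (auto simp: spectrum_def eigenvalue_def eigenvector_def)

text \<open>
  The infimum c of the Rayleigh quotient is an eigenvalue. Otherwise B = Y - c would be invertible, hence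
  bounded below, and since the norm of B v is controlled by the form of the positive semidefinite B,
  that form would be bounded away from zero on unit vectors, so that c could be increased.
\<close>

lemma exists_least_eigenvalue:
  fixes Y :: "real mat"
  assumes Y: "Y \<in> carrier_mat d d" "Y\<^sup>T = Y" and d: "0 < d"
  obtains c where "c \<in> spectrum Y" "\<And>v. v \<in> carrier_vec d \<Longrightarrow> c * (v \<bullet> v) \<le> quad_form Y v"
proof -
  obtain b where b: "op_bound d Y b" using op_bound_exists[OF Y(1)] ..
  define S where "S = {quad_form Y v | v. v \<in> carrier_vec d \<and> v \<bullet> v = 1}"
  have ne: "S \<noteq> {}"
    using d unfolding S_def by (auto intro!: exI[of _ "unit_vec d 0"])
  have bdd: "bdd_below S"
  proof (rule bdd_belowI)
    fix x assume "x \<in> S"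
    then obtain v where "v \<in> carrier_vec d" "v \<bullet> v = 1" "x = quad_form Y v" by (auto simp: S_def)
    then show "- b \<le> x" using op_bound_quadratic_form[OF b, of v] by simp
  qed
  define c where "c = Inf S"
  have least: "c * (v \<bullet> v) \<le> quad_form Y v" if v: "v \<in> carrier_vec d" for v
  proof (cases "v = 0\<^sub>v d")
    case True
    then show ?thesis using Y by (simp add: scalar_prod_left_zero[of _ d])
  next
    case False
    then have pos: "0 < l2_norm_vec v"
      using l2_norm_vec_zero_iff[OF v] l2_norm_vec_nonneg[of v] by linarith
    let ?a = "1 / l2_norm_vec v"
    have sq: "v \<bullet> v = l2_norm_vec v * l2_norm_vec v"
      using l2_norm_vec_square[of v] by (simp add: power2_eq_square)
    have "(?a \<cdot>\<^sub>v v) \<bullet> (?a \<cdot>\<^sub>v v) = ?a * (?a * (v \<bullet> v))" using v by simp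
    also have "\<dots> = 1" unfolding sq using pos by simp
    finally have unit: "(?a \<cdot>\<^sub>v v) \<bullet> (?a \<cdot>\<^sub>v v) = 1" .
    have "(?a \<cdot>\<^sub>v v) \<bullet> (Y *\<^sub>v (?a \<cdot>\<^sub>v v)) \<in> S"
      unfolding S_def by (intro CollectI exI[of _ "?a \<cdot>\<^sub>v v"] conjI refl unit) (use v in simp)
    then have "c \<le> (?a \<cdot>\<^sub>v v) \<bullet> (Y *\<^sub>v (?a \<cdot>\<^sub>v v))"
      unfolding c_def using bdd by (rule cInf_lower)
    also have "\<dots> = ?a * ?a * quad_form Y v"
      using v Y by (simp add: mult_mat_vec[of _ d d])
    finally show ?thesis using pos by (simp add: sq field_simps)
  qed
  define B where "B = Y - c \<cdot>\<^sub>m 1\<^sub>m d"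
  have B: "B \<in> carrier_mat d d" "B\<^sup>T = B"
    using Y by (auto simp: B_def transpose_minus[of _ d d] transpose_smult_mat minus_carrier_mat)
  have Bv: "B *\<^sub>v v = Y *\<^sub>v v - c \<cdot>\<^sub>v v" if "v \<in> carrier_vec d" for v
    using that Y by (simp add: B_def minus_mult_distrib_mat_vec[of _ d d] smult_mat_mult_vec[of _ d d])
  have vBv: "quad_form B v = quad_form Y v - c * (v \<bullet> v)" if "v \<in> carrier_vec d" for v
    using that Y by (simp add: Bv scalar_prod_minus_distrib[of _ d])
  have "det B = 0"
  proof (rule ccontr)
    assume "det B \<noteq> 0"
    from det_non_zero_imp_unit[OF B(1) this, of "()"]
    obtain B' where B': "B' \<in> carrier_mat d d" "B' * B = 1\<^sub>m d"
      by (auto simp: Units_def ring_mat_def)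
    obtain k where k: "op_bound d B' k" using op_bound_exists[OF B'(1)] ..
    obtain \<beta>' where \<beta>': "op_bound d B \<beta>'" using op_bound_exists[OF B(1)] ..
    \<comment> \<open>The summand 1 makes the scaling factor positive even if \<beta>' = 0.\<close>
    define \<beta> where "\<beta> = \<beta>' + 1"
    have \<beta>: "0 < \<beta>" "op_bound d B \<beta>"
      using op_boundD(2)[OF \<beta>'] op_bound_mono[OF \<beta>'] by (auto simp: \<beta>_def)
    have psd: "0 \<le> quad_form ((1 / \<beta>) \<cdot>\<^sub>m B) v" "quad_form ((1 / \<beta>) \<cdot>\<^sub>m B) v \<le> v \<bullet> v"
      and scale: "((1 / \<beta>) \<cdot>\<^sub>m B) *\<^sub>v v = (1 / \<beta>) \<cdot>\<^sub>v (B *\<^sub>v v)"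
      if v: "v \<in> carrier_vec d" for v
    proof -
      show eq: "((1 / \<beta>) \<cdot>\<^sub>m B) *\<^sub>v v = (1 / \<beta>) \<cdot>\<^sub>v (B *\<^sub>v v)"
        using v B by (simp add: smult_mat_mult_vec[of _ d d])
      have "\<bar>v \<bullet> (B *\<^sub>v v)\<bar> \<le> \<beta> * (v \<bullet> v)" by (rule op_bound_quadratic_form[OF \<beta>(2) v])
      then show "quad_form ((1 / \<beta>) \<cdot>\<^sub>m B) v \<le> v \<bullet> v"
        unfolding eq using \<beta>(1) v B by (simp add: field_simps)
      show "0 \<le> quad_form ((1 / \<beta>) \<cdot>\<^sub>m B) v"
        unfolding eq using least[OF v] \<beta>(1) v B by (simp add: vBv)
    qed
    have gap: "1 \<le> k\<^sup>2 * \<beta> * (quad_form Y v - c)" if v: "v \<in> carrier_vec d" "v \<bullet> v = 1" for v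
    proof -
      have "v = B' *\<^sub>v (B *\<^sub>v v)"
        using v B B' assoc_mult_mat_vec[of B' d d B d v] by simp
      then have "l2_norm_vec v \<le> k * l2_norm_vec (B *\<^sub>v v)"
        using op_boundD(3)[OF k, of "B *\<^sub>v v"] v B by simp
      then have "(l2_norm_vec v)\<^sup>2 \<le> (k * l2_norm_vec (B *\<^sub>v v))\<^sup>2" by (rule power_mono) simp
      moreover have "(l2_norm_vec ((1 / \<beta>) \<cdot>\<^sub>v (B *\<^sub>v v)))\<^sup>2 \<le> v \<bullet> ((1 / \<beta>) \<cdot>\<^sub>v (B *\<^sub>v v))"
        using psd_square_le[of "(1 / \<beta>) \<cdot>\<^sub>m B" d v] psd scale v B by (simp add: transpose_smult_mat)
      then have "(l2_norm_vec (B *\<^sub>v v))\<^sup>2 / \<beta>\<^sup>2 \<le> quad_form B v / \<beta>"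
        using v B \<beta>(1) by (simp add: l2_norm_vec_smult power_mult_distrib power_divide)
      then have "(l2_norm_vec (B *\<^sub>v v))\<^sup>2 \<le> \<beta> * quad_form B v"
        using \<beta>(1) by (simp add: power2_eq_square field_simps)
      then have "k\<^sup>2 * (l2_norm_vec (B *\<^sub>v v))\<^sup>2 \<le> k\<^sup>2 * (\<beta> * quad_form B v)"
        by (rule mult_left_mono) simp
      ultimately show ?thesis
        using v by (simp add: l2_norm_vec_square power_mult_distrib vBv mult.assoc)
    qed
    have "0 < k\<^sup>2 * \<beta>"
    proof -
      obtain v :: "real vec" where "v \<in> carrier_vec d" "v \<bullet> v = 1" using ne by (auto simp: S_def)
      from gap[OF this] have "k \<noteq> 0" by auto
      then show ?thesis using \<beta>(1) by simp
    qed
    moreover have "c + 1 / (k\<^sup>2 * \<beta>) \<le> Inf S"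
    proof (rule cInf_greatest[OF ne])
      fix x assume "x \<in> S"
      then obtain v where "v \<in> carrier_vec d" "v \<bullet> v = 1" "x = quad_form Y v" by (auto simp: S_def)
      then have "1 \<le> k\<^sup>2 * \<beta> * (x - c)" using gap by simp
      then have "1 / (k\<^sup>2 * \<beta>) \<le> x - c"
        using \<open>0 < k\<^sup>2 * \<beta>\<close> by (subst pos_divide_le_eq) (auto simp: mult.commute)
      then show "c + 1 / (k\<^sup>2 * \<beta>) \<le> x" by simp
    qed
    ultimately show False unfolding c_def[symmetric] by simp
  qed
  then obtain v where v: "v \<in> carrier_vec d" "v \<noteq> 0\<^sub>v d" "B *\<^sub>v v = 0\<^sub>v d"
    using det_0_iff_vec_prod_zero_field[OF B(1)] by auto
  have "Y *\<^sub>v v = c \<cdot>\<^sub>v v"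
  proof (rule eq_vecI)
    fix i assume i: "i < dim_vec (c \<cdot>\<^sub>v v)"
    have "(Y *\<^sub>v v - c \<cdot>\<^sub>v v) $ i = 0" using v i by (simp flip: Bv)
    then show "(Y *\<^sub>v v) $ i = (c \<cdot>\<^sub>v v) $ i" using v i Y by simp
  qed (use Y v in auto)
  then have "c \<in> spectrum Y" using v Y spectrum_iff by blast
  then show thesis using that least by blast
qed

lemma lambda_min_symmetric:
  assumes Y: "Y \<in> carrier_mat d d" "Y\<^sup>T = Y" and d: "0 < d"
  shows "lambda_min Y \<in> spectrum Y" "v \<in> carrier_vec d \<Longrightarrow> lambda_min Y * (v \<bullet> v) \<le> quad_form Y v"
proof -
  obtain c where c: "c \<in> spectrum Y" and le: "\<And>v. v \<in> carrier_vec d \<Longrightarrow> c * (v \<bullet> v) \<le> quad_form Y v"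
    using exists_least_eigenvalue[OF assms] by blast
  note fin = card_finite_spectrum(1)[OF Y(1)]
  show "lambda_min Y \<in> spectrum Y" unfolding lambda_min_def using fin c by (intro Min_in) auto
  assume v: "v \<in> carrier_vec d"
  have "lambda_min Y * (v \<bullet> v) \<le> c * (v \<bullet> v)"
    unfolding lambda_min_def using fin c scalar_prod_self_nonneg by (intro mult_right_mono Min_le)
  also note le[OF v]
  finally show "lambda_min Y * (v \<bullet> v) \<le> quad_form Y v" .
qed

lemma eigenvalue_quadratic_form:
  assumes "Y \<in> carrier_mat d d" "(c :: real) \<in> spectrum Y"
  obtains v where "v \<in> carrier_vec d" "0 < v \<bullet> v" "quad_form Y v = c * (v \<bullet> v)"
proof -
  obtain v where v: "v \<in> carrier_vec d" "v \<noteq> 0\<^sub>v d" "Y *\<^sub>v v = c \<cdot>\<^sub>v v"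
    using assms spectrum_iff by blast
  have "0 < l2_norm_vec v" using l2_norm_vec_zero_iff[OF v(1)] v(2) l2_norm_vec_nonneg[of v] by linarith
  then have "0 < v \<bullet> v" by (simp add: l2_norm_vec_def)
  then show thesis using that v by simp
qed

lemma lambda_min_pos:
  assumes Y: "Y \<in> carrier_mat d d" "Y\<^sup>T = Y" and d: "0 < d"
    and pos: "\<And>v. v \<in> carrier_vec d \<Longrightarrow> v \<noteq> 0\<^sub>v d \<Longrightarrow> 0 < quad_form Y v"
  shows "0 < lambda_min Y"
proof -
  obtain v where v: "v \<in> carrier_vec d" "0 < v \<bullet> v" "quad_form Y v = lambda_min Y * (v \<bullet> v)"
    using eigenvalue_quadratic_form[OF Y(1) lambda_min_symmetric(1)[OF Y d]] .
  then have "v \<noteq> 0\<^sub>v d" by auto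
  then show ?thesis using pos[OF v(1)] v by (simp add: zero_less_mult_iff)
qed

lemma lambda_max_nonneg:
  assumes Y: "Y \<in> carrier_mat d d" "Y\<^sup>T = Y" and d: "0 < d"
    and psd: "\<And>v. v \<in> carrier_vec d \<Longrightarrow> 0 \<le> quad_form Y v"
  shows "0 \<le> lambda_max Y"
proof -
  have "lambda_max Y \<in> spectrum Y"
    unfolding lambda_max_def using card_finite_spectrum(1)[OF Y(1)] lambda_min_symmetric(1)[OF assms(1-3)]
    by (intro Max_in) auto
  from eigenvalue_quadratic_form[OF Y(1) this]
  obtain v where v: "v \<in> carrier_vec d" "0 < v \<bullet> v" "quad_form Y v = lambda_max Y * (v \<bullet> v)" .
  then show ?thesis using psd[OF v(1)] by (simp add: zero_le_mult_iff)
qed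

section \<open>A Chernoff bound for the least eigenvalue\<close>

text \<open>
  A vector violating the lower bound makes the form of D exceed c delta^2 / (3 rho) after normalization,
  which is the value of the exponent at the choice theta = 2 delta / 3: the coefficient
  theta - 3/4 theta^2 is then 2 delta / 3 - delta^2 / 3. The functions mu and xi stand for the
  deterministic mean and for the observed form.
\<close>

lemma chernoff_lower_tail:
  fixes \<xi> :: "'a \<Rightarrow> real vec \<Rightarrow> real" and \<mu> :: "real vec \<Rightarrow> real"
  assumes D: "trace_exp_contraction d Q D"
    and form: "\<And>om v. om \<in> set_pmf Q \<Longrightarrow> v \<in> carrier_vec d \<Longrightarrow>
      quad_form (D om) v = ((2 * \<delta> / 3 - 3 / 4 * (2 * \<delta> / 3)\<^sup>2) * \<mu> v - 2 * \<delta> / 3 * \<xi> om v) / \<rho>"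
    and \<mu>: "\<And>v. v \<in> carrier_vec d \<Longrightarrow> c * (v \<bullet> v) \<le> \<mu> v"
    and \<xi>: "\<And>om v a. om \<in> set_pmf Q \<Longrightarrow> v \<in> carrier_vec d \<Longrightarrow> \<xi> om (a \<cdot>\<^sub>v v) = a\<^sup>2 * \<xi> om v"
    and \<delta>: "0 < \<delta>" "\<delta> < 1" and \<rho>: "0 < \<rho>"
  shows "1 - real d * exp (- (c * \<delta>\<^sup>2 / (3 * \<rho>)))
      \<le> measure_pmf.prob Q {om. \<forall>v\<in>carrier_vec d. (1 - \<delta>) * c * (v \<bullet> v) \<le> \<xi> om v}"
proof -
  let ?G = "{om. \<forall>v\<in>carrier_vec d. (1 - \<delta>) * c * (v \<bullet> v) \<le> \<xi> om v}"
  let ?a = "c * \<delta>\<^sup>2 / (3 * \<rho>)"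
  let ?B = "{om. \<exists>v\<in>carrier_vec d. v \<bullet> v = 1 \<and> ?a \<le> quad_form (D om) v}"
  have g: "2 * \<delta> / 3 - 3 / 4 * (2 * \<delta> / 3)\<^sup>2 = 2 * \<delta> / 3 - \<delta>\<^sup>2 / 3"
    by (simp add: power2_eq_square)
  have "\<delta> * \<delta> \<le> \<delta> * 1" using \<delta> by (intro mult_left_mono) auto
  then have g0: "0 \<le> 2 * \<delta> / 3 - \<delta>\<^sup>2 / 3" using \<delta> by (simp add: power2_eq_square)
  have bad: "om \<in> ?B" if om: "om \<in> set_pmf Q" "om \<notin> ?G" for om
  proof -
    obtain v where v: "v \<in> carrier_vec d" and lt: "\<xi> om v < (1 - \<delta>) * c * (v \<bullet> v)"
      using om by auto
    have ne: "v \<bullet> v \<noteq> 0"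
    proof
      assume "v \<bullet> v = 0"
      then have v0: "v = 0\<^sub>v d" using l2_norm_vec_zero_iff[OF v] by (simp add: l2_norm_vec_def)
      then have "0 \<cdot>\<^sub>v v = v" by (intro eq_vecI) auto
      then have "\<xi> om v = 0" using \<xi>[OF om(1) v, of 0] by simp
      then show False using lt \<open>v \<bullet> v = 0\<close> by simp
    qed
    let ?n = "l2_norm_vec v"
    have sq: "v \<bullet> v = ?n * ?n" using l2_norm_vec_square[of v] by (simp add: power2_eq_square)
    have "?n \<noteq> 0" using ne by (auto simp: sq)
    then have n: "0 < ?n" using l2_norm_vec_nonneg[of v] by linarith
    define u where "u = (1 / ?n) \<cdot>\<^sub>v v"
    have u: "u \<in> carrier_vec d" "u \<bullet> u = 1" using v n by (simp_all add: u_def sq)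
    have "\<xi> om u = \<xi> om v / (v \<bullet> v)"
      unfolding u_def using \<xi>[OF om(1) v] by (simp add: power_divide power2_eq_square sq)
    also have "\<dots> < (1 - \<delta>) * c" using lt n by (simp add: sq field_simps)
    finally have xu: "\<xi> om u \<le> (1 - \<delta>) * c" by simp
    have "c * \<delta>\<^sup>2 / 3 = (2 * \<delta> / 3 - \<delta>\<^sup>2 / 3) * c - 2 * \<delta> / 3 * ((1 - \<delta>) * c)"
      by (simp add: field_simps power2_eq_square)
    also have "\<dots> \<le> (2 * \<delta> / 3 - \<delta>\<^sup>2 / 3) * \<mu> u - 2 * \<delta> / 3 * \<xi> om u"
      using \<mu>[OF u(1)] u(2) xu g0 \<delta> by (intro diff_mono mult_left_mono) auto
    finally have "c * \<delta>\<^sup>2 / 3 / \<rho> \<le> quad_form (D om) u"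
      unfolding form[OF om(1) u(1)] g using \<rho> by (intro divide_right_mono) auto
    then show ?thesis using u by (intro CollectI bexI[of _ u]) auto
  qed
  have "measure_pmf.prob Q (- ?G) \<le> measure_pmf.prob Q ?B"
  proof (rule measure_pmf.finite_measure_mono_AE)
    show "AE x in measure_pmf Q. x \<in> - ?G \<longrightarrow> x \<in> ?B"
      using bad by (simp add: AE_measure_pmf_iff)
  qed simp
  also have "\<dots> \<le> real d * exp (- ?a)"
    by (rule trace_exp_contraction_tail[OF D])
  finally show ?thesis
    using measure_pmf.prob_compl[of ?G Q] by (simp add: Compl_eq_Diff_UNIV)
qed

text \<open>
  A random positive semidefinite matrix X of law q with mean M and largest eigenvalue at most rho. The
  mean is expressed through bilinear forms, which are what the later estimates use.
\<close>

definition psd_family :: "nat \<Rightarrow> 'a pmf \<Rightarrow> ('a \<Rightarrow> real mat) \<Rightarrow> real mat \<Rightarrow> real \<Rightarrow> bool" where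
  "psd_family d q X M \<rho> \<longleftrightarrow>
     finite (set_pmf q) \<and> M \<in> carrier_mat d d \<and> M\<^sup>T = M \<and>
     (\<forall>l\<in>set_pmf q. X l \<in> carrier_mat d d \<and> transpose_mat (X l) = X l \<and>
        (\<forall>v\<in>carrier_vec d. 0 \<le> quad_form (X l) v \<and> quad_form (X l) v \<le> \<rho> * (v \<bullet> v))) \<and>
     (\<forall>u\<in>carrier_vec d. \<forall>v\<in>carrier_vec d.
        measure_pmf.expectation q (\<lambda>l. u \<bullet> (X l *\<^sub>v v)) = u \<bullet> (M *\<^sub>v v))"

lemma psd_family_contraction:
  assumes fam: "psd_family d q X M \<rho>" and \<rho>: "0 < \<rho>" and \<theta>: "0 \<le> \<theta>" "\<theta> \<le> 2 / 3"
  shows "trace_exp_contraction d q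
    (\<lambda>l. (\<theta> - 3 / 4 * \<theta>\<^sup>2) \<cdot>\<^sub>m ((1 / \<rho>) \<cdot>\<^sub>m M) - \<theta> \<cdot>\<^sub>m ((1 / \<rho>) \<cdot>\<^sub>m X l))"
proof (rule trace_exp_contraction_centered_psd)
  have form: "u \<bullet> (((1 / \<rho>) \<cdot>\<^sub>m A) *\<^sub>v v) = (u \<bullet> (A *\<^sub>v v)) / \<rho>"
    if "A \<in> carrier_mat d d" "u \<in> carrier_vec d" "v \<in> carrier_vec d" for A u v
    using that by (simp add: smult_mat_mult_vec[of _ d d])
  show "finite (set_pmf q)" "(1 / \<rho>) \<cdot>\<^sub>m M \<in> carrier_mat d d"
    "transpose_mat ((1 / \<rho>) \<cdot>\<^sub>m M) = (1 / \<rho>) \<cdot>\<^sub>m M"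
    using fam by (auto simp: psd_family_def transpose_smult_mat)
  fix l assume l: "l \<in> set_pmf q"
  show "(1 / \<rho>) \<cdot>\<^sub>m X l \<in> carrier_mat d d" "transpose_mat ((1 / \<rho>) \<cdot>\<^sub>m X l) = (1 / \<rho>) \<cdot>\<^sub>m X l"
    using fam l by (auto simp: psd_family_def transpose_smult_mat)
  fix v :: "real vec" assume v: "v \<in> carrier_vec d"
  show "0 \<le> quad_form ((1 / \<rho>) \<cdot>\<^sub>m X l) v" "quad_form ((1 / \<rho>) \<cdot>\<^sub>m X l) v \<le> v \<bullet> v"
    using fam l v \<rho> by (auto simp: psd_family_def form field_simps)
next
  fix u v :: "real vec" assume uv: "u \<in> carrier_vec d" "v \<in> carrier_vec d"
  have "measure_pmf.expectation q (\<lambda>l. u \<bullet> (((1 / \<rho>) \<cdot>\<^sub>m X l) *\<^sub>v v))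
      = measure_pmf.expectation q (\<lambda>l. (u \<bullet> (X l *\<^sub>v v)) / \<rho>)"
    using fam uv by (intro integral_cong_AE)
      (auto simp: AE_measure_pmf_iff psd_family_def smult_mat_mult_vec[of _ d d] divide_inverse)
  then show "measure_pmf.expectation q (\<lambda>l. u \<bullet> (((1 / \<rho>) \<cdot>\<^sub>m X l) *\<^sub>v v)) = u \<bullet> (((1 / \<rho>) \<cdot>\<^sub>m M) *\<^sub>v v)"
    using fam uv by (simp add: psd_family_def smult_mat_mult_vec[of _ d d])
qed (use \<theta> in auto)

lemma centered_quadratic_form:
  assumes "M \<in> carrier_mat d d" "X \<in> carrier_mat d d" "v \<in> carrier_vec d"
  shows "quad_form (g \<cdot>\<^sub>m ((1 / \<rho>) \<cdot>\<^sub>m M) - \<theta> \<cdot>\<^sub>m ((1 / \<rho>) \<cdot>\<^sub>m X)) v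
    = (g * quad_form M v - \<theta> * quad_form X v) / (\<rho> :: real)"
  using assms by (simp add: minus_mult_distrib_mat_vec[of _ d d] smult_mat_mult_vec[of _ d d]
      scalar_prod_minus_distrib[of _ d] diff_divide_distrib)

lemma quadratic_form_scale:
  assumes "A \<in> carrier_mat d d" "v \<in> carrier_vec d"
  shows "(a \<cdot>\<^sub>v v) \<bullet> (A *\<^sub>v (a \<cdot>\<^sub>v v)) = (a :: real)\<^sup>2 * quad_form A v"
  using assms by (simp add: mult_mat_vec[of _ d d] power2_eq_square)

lemma chernoff_iid:
  assumes fam: "psd_family d q X M \<rho>" and \<rho>: "0 < \<rho>" and \<delta>: "0 < \<delta>" "\<delta> < 1"
    and \<mu>: "\<And>v. v \<in> carrier_vec d \<Longrightarrow> c * (v \<bullet> v) \<le> real m * quad_form M v"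
  shows "1 - real d * exp (- (c * \<delta>\<^sup>2 / (3 * \<rho>)))
      \<le> measure_pmf.prob (Pi_pmf {..<m} dflt (\<lambda>_. q))
          {om. \<forall>v\<in>carrier_vec d. (1 - \<delta>) * c * (v \<bullet> v) \<le> (\<Sum>j<m. quad_form (X (om j)) v)}"
proof -
  let ?g = "2 * \<delta> / 3 - 3 / 4 * (2 * \<delta> / 3)\<^sup>2"
  define Z where "Z l = ?g \<cdot>\<^sub>m ((1 / \<rho>) \<cdot>\<^sub>m M) - (2 * \<delta> / 3) \<cdot>\<^sub>m ((1 / \<rho>) \<cdot>\<^sub>m X l)" for l
  have Z: "trace_exp_contraction d q Z"
    unfolding Z_def using \<delta> by (intro psd_family_contraction[OF fam \<rho>]) auto
  have MX: "M \<in> carrier_mat d d" "\<And>l. l \<in> set_pmf q \<Longrightarrow> X l \<in> carrier_mat d d"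
    using fam by (auto simp: psd_family_def)
  have mem: "om j \<in> set_pmf q" if "om \<in> set_pmf (Pi_pmf {..<m} dflt (\<lambda>_. q))" "j < m" for om j
    using that by (subst (asm) set_Pi_pmf) (auto simp: PiE_dflt_def)
  show ?thesis
  proof (rule chernoff_lower_tail[where D = "\<lambda>om. sum_mat d d (\<lambda>j. Z (om j)) {..<m}"
        and \<mu> = "\<lambda>v. real m * quad_form M v"])
    show "trace_exp_contraction d (Pi_pmf {..<m} dflt (\<lambda>_. q)) (\<lambda>om. sum_mat d d (\<lambda>j. Z (om j)) {..<m})"
      using Z by (intro trace_exp_contraction_Pi_pmf) auto
    fix om and v :: "real vec" assume om: "om \<in> set_pmf (Pi_pmf {..<m} dflt (\<lambda>_. q))" and v: "v \<in> carrier_vec d"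
    have "quad_form (sum_mat d d (\<lambda>j. Z (om j)) {..<m}) v = (\<Sum>j<m. quad_form (Z (om j)) v)"
      using v MX mem[OF om] by (intro bilinear_form_sum_mat) (auto simp: Z_def minus_carrier_mat)
    also have "\<dots> = (\<Sum>j<m. (?g * quad_form M v - 2 * \<delta> / 3 * (quad_form (X (om j)) v)) / \<rho>)"
      unfolding Z_def using v MX mem[OF om] by (intro sum.cong refl centered_quadratic_form) auto
    finally show "quad_form (sum_mat d d (\<lambda>j. Z (om j)) {..<m}) v
        = (?g * (real m * quad_form M v) - 2 * \<delta> / 3 * (\<Sum>j<m. quad_form (X (om j)) v)) / \<rho>"
      by (simp add: sum_subtractf sum_distrib_left flip: sum_divide_distrib)
    show "(\<Sum>j<m. (a \<cdot>\<^sub>v v) \<bullet> (X (om j) *\<^sub>v (a \<cdot>\<^sub>v v))) = a\<^sup>2 * (\<Sum>j<m. quad_form (X (om j)) v)" for a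
      unfolding sum_distrib_left using v MX mem[OF om] by (intro sum.cong refl quadratic_form_scale) auto
  qed (use \<mu> \<delta> \<rho> in auto)
qed

lemma chernoff_independent_batches:
  fixes X :: "nat \<Rightarrow> 'a \<Rightarrow> real mat" and m :: "nat \<Rightarrow> nat"
  assumes fam: "\<And>t. t < s \<Longrightarrow> psd_family d (q t) (X t) (M t) \<rho>" and \<rho>: "0 < \<rho>" and \<delta>: "0 < \<delta>" "\<delta> < 1"
    and \<mu>: "\<And>v. v \<in> carrier_vec d \<Longrightarrow> c * (v \<bullet> v) \<le> (\<Sum>t<s. real (m t) * quad_form (M t) v)"
  shows "1 - real d * exp (- (c * \<delta>\<^sup>2 / (3 * \<rho>)))
      \<le> measure_pmf.prob (Pi_pmf {..<s} dflt' (\<lambda>t. Pi_pmf {..<m t} dflt (\<lambda>_. q t)))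
          {om. \<forall>v\<in>carrier_vec d. (1 - \<delta>) * c * (v \<bullet> v) \<le> (\<Sum>t<s. \<Sum>j<m t. quad_form (X t (om t j)) v)}"
proof -
  let ?g = "2 * \<delta> / 3 - 3 / 4 * (2 * \<delta> / 3)\<^sup>2"
  let ?Q = "Pi_pmf {..<s} dflt' (\<lambda>t. Pi_pmf {..<m t} dflt (\<lambda>_. q t))"
  define Z where "Z t l = ?g \<cdot>\<^sub>m ((1 / \<rho>) \<cdot>\<^sub>m M t) - (2 * \<delta> / 3) \<cdot>\<^sub>m ((1 / \<rho>) \<cdot>\<^sub>m X t l)" for t l
  let ?D = "\<lambda>om. sum_mat d d (\<lambda>t. sum_mat d d (\<lambda>j. Z t (om t j)) {..<m t}) {..<s}"
  have Z: "trace_exp_contraction d (q t) (Z t)" if "t < s" for t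
    unfolding Z_def using \<delta> by (intro psd_family_contraction[OF fam[OF that] \<rho>]) auto
  have MX: "M t \<in> carrier_mat d d" "\<And>l. l \<in> set_pmf (q t) \<Longrightarrow> X t l \<in> carrier_mat d d" if "t < s" for t
    using fam[OF that] by (auto simp: psd_family_def)
  have mem: "om t j \<in> set_pmf (q t)" if om: "om \<in> set_pmf ?Q" and tj: "t < s" "j < m t" for om t j
  proof -
    have "om t \<in> set_pmf (Pi_pmf {..<m t} dflt (\<lambda>_. q t))"
      using om tj by (subst (asm) set_Pi_pmf) (auto simp: PiE_dflt_def)
    then show ?thesis using tj by (subst (asm) set_Pi_pmf) (auto simp: PiE_dflt_def)
  qed
  show ?thesis
  proof (rule chernoff_lower_tail[where D = ?D and \<mu> = "\<lambda>v. \<Sum>t<s. real (m t) * quad_form (M t) v"])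
    show "trace_exp_contraction d ?Q ?D"
      using Z by (intro trace_exp_contraction_Pi_pmf[where D = "\<lambda>t l. sum_mat d d (\<lambda>j. Z t (l j)) {..<m t}"]
          trace_exp_contraction_Pi_pmf[where D = "\<lambda>j. Z _"]) auto
    fix om and v :: "real vec" assume om: "om \<in> set_pmf ?Q" and v: "v \<in> carrier_vec d"
    have "quad_form (?D om) v = (\<Sum>t<s. quad_form (sum_mat d d (\<lambda>j. Z t (om t j)) {..<m t}) v)"
      using v by (intro bilinear_form_sum_mat) auto
    also have "\<dots> = (\<Sum>t<s. \<Sum>j<m t. quad_form (Z t (om t j)) v)"
      using v MX mem[OF om] by (intro sum.cong refl bilinear_form_sum_mat) (auto simp: Z_def minus_carrier_mat)
    also have "\<dots> = (\<Sum>t<s. \<Sum>j<m t. (?g * quad_form (M t) v - 2 * \<delta> / 3 * (quad_form (X t (om t j)) v)) / \<rho>)"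
      unfolding Z_def using v MX mem[OF om] by (intro sum.cong refl centered_quadratic_form) auto
    finally show "quad_form (?D om) v = (?g * (\<Sum>t<s. real (m t) * quad_form (M t) v)
        - 2 * \<delta> / 3 * (\<Sum>t<s. \<Sum>j<m t. quad_form (X t (om t j)) v)) / \<rho>"
      by (simp add: sum_subtractf sum_distrib_left mult.left_commute flip: sum_divide_distrib)
    show "(\<Sum>t<s. \<Sum>j<m t. (a \<cdot>\<^sub>v v) \<bullet> (X t (om t j) *\<^sub>v (a \<cdot>\<^sub>v v)))
        = a\<^sup>2 * (\<Sum>t<s. \<Sum>j<m t. quad_form (X t (om t j)) v)" for a
      unfolding sum_distrib_left using v MX mem[OF om] by (intro sum.cong refl quadratic_form_scale) auto
  qed (use \<mu> \<delta> \<rho> in auto)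
qed

section \<open>The time-propagation blocks\<close>

lemma mat_diag_pow: "mat_diag n f ^\<^sub>m i = mat_diag n (\<lambda>j. (f j :: real) ^ i)"
  by (induction i) (auto simp: mat_diag_dim[THEN carrier_matD(1)] mult.commute)

lemma Lam_bar_eq: "Lam_bar r lam t = mat_diag r (\<lambda>i. \<Sum>j<t. lam i ^ j)"
  unfolding Lam_bar_def Lam_def mat_diag_pow
  by (intro eq_matI) (auto simp: sum_mat_def mat_diag_def)

lemma Lam_row_carrier [simp]: "Lam_row r lam t \<in> carrier_mat r (2 * r)"
proof -
  have "Lam_row r lam t \<in> carrier_mat (r + 0) (r + r)"
    unfolding Lam_row_def Lam_bar_eq Lam_def mat_diag_pow by (intro four_block_carrier_mat) auto
  then show ?thesis by (simp add: mult_2)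
qed

lemma Lam_row_index:
  assumes "i < r" "j < 2 * r"
  shows "Lam_row r lam t $$ (i, j) =
    (if j < r then if i = j then lam i ^ t else 0 else if i = j - r then \<Sum>l<t. lam i ^ l else 0)"
proof -
  have d: "dim_row (mat_diag r f) = r" "dim_col (mat_diag r f) = r" for f :: "nat \<Rightarrow> real"
    by (simp_all add: mat_diag_def)
  show ?thesis
    using assms unfolding Lam_row_def Lam_bar_eq Lam_def mat_diag_pow
    by (auto simp: d index_mat_four_block) (auto simp: mat_diag_def)
qed

text \<open>
  The column block of the model is the transpose of its row block, so that the summands of the Gramian
  and of the coherence are Gram matrices.
\<close>

lemma Lam_col_eq: "Lam_col r lam t = transpose_mat (Lam_row r lam t)"
proof -
  have d: "dim_row (mat_diag r f) = r" "dim_col (mat_diag r f) = r" for f :: "nat \<Rightarrow> real"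
    by (simp_all add: mat_diag_def)
  have Lr: "dim_row (Lam_row r lam t) = r" "dim_col (Lam_row r lam t) = 2 * r"
    by (rule carrier_matD[OF Lam_row_carrier])+
  show ?thesis
  proof (rule eq_matI)
    fix i j assume "i < dim_row (transpose_mat (Lam_row r lam t))" "j < dim_col (transpose_mat (Lam_row r lam t))"
    then have ij: "i < 2 * r" "j < r" by (simp_all add: Lr)
    then have "Lam_col r lam t $$ (i, j) = (if i < r then if j = i then lam j ^ t else 0
        else if j = i - r then \<Sum>l<t. lam j ^ l else 0)"
      unfolding Lam_col_def Lam_bar_eq Lam_def mat_diag_pow append_rows_def
      by (auto simp: d index_mat_four_block) (auto simp: mat_diag_def)
    then show "Lam_col r lam t $$ (i, j) = transpose_mat (Lam_row r lam t) $$ (i, j)"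
      using ij by (simp add: Lam_row_index Lr)
  qed (simp_all add: Lr Lam_col_def Lam_bar_eq Lam_def mat_diag_pow append_rows_def d)
qed

lemma Lam_row_mult_vec:
  assumes "i < r" "v \<in> carrier_vec (2 * r)"
  shows "(Lam_row r lam t *\<^sub>v v) $ i = lam i ^ t * v $ i + (\<Sum>l<t. lam i ^ l) * v $ (r + i)"
proof -
  have Lr: "dim_row (Lam_row r lam t) = r" "dim_col (Lam_row r lam t) = 2 * r"
    by (rule carrier_matD[OF Lam_row_carrier])+
  have "(Lam_row r lam t *\<^sub>v v) $ i = (\<Sum>j\<in>{0..<2 * r}. Lam_row r lam t $$ (i, j) * v $ j)"
    using assms by (simp add: scalar_prod_def Lr)
  also have "{0..<2 * r} = {0..<r} \<union> {r..<r + r}" by auto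
  also have "(\<Sum>j\<in>\<dots>. Lam_row r lam t $$ (i, j) * v $ j)
      = (\<Sum>j\<in>{0..<r}. Lam_row r lam t $$ (i, j) * v $ j) + (\<Sum>j\<in>{r..<r + r}. Lam_row r lam t $$ (i, j) * v $ j)"
    by (intro sum.union_disjoint) auto
  also have "(\<Sum>j\<in>{0..<r}. Lam_row r lam t $$ (i, j) * v $ j) = (\<Sum>j\<in>{0..<r}. if j = i then lam i ^ t * v $ i else 0)"
    using assms by (intro sum.cong) (auto simp: Lam_row_index)
  also have "(\<Sum>j\<in>{r..<r + r}. Lam_row r lam t $$ (i, j) * v $ j)
      = (\<Sum>j\<in>{r..<r + r}. if j = r + i then (\<Sum>l<t. lam i ^ l) * v $ (r + i) else 0)"
    using assms by (intro sum.cong) (auto simp: Lam_row_index)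
  finally show ?thesis using assms by simp
qed

section \<open>Gram matrices and spectral norms\<close>

lemma gram_bilinear_form:
  assumes "R \<in> carrier_mat n d" "u \<in> carrier_vec d" "v \<in> carrier_vec d"
  shows "u \<bullet> (R\<^sup>T * R *\<^sub>v v) = (R *\<^sub>v u) \<bullet> (R *\<^sub>v (v :: real vec))"
proof -
  have "u \<bullet> (R\<^sup>T * R *\<^sub>v v) = u \<bullet> (R\<^sup>T *\<^sub>v (R *\<^sub>v v))"
    using assms by (simp add: assoc_mult_mat_vec[of _ d n _ d])
  also have "\<dots> = (transpose_mat (R\<^sup>T) *\<^sub>v u) \<bullet> (R *\<^sub>v v)"
    using assms by (intro quadratic_form_transpose[of _ d n]) auto
  finally show ?thesis by simp
qed

lemma gram_symmetric:
  assumes "R \<in> carrier_mat n d"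
  shows "R\<^sup>T * R \<in> carrier_mat d d" "transpose_mat (R\<^sup>T * R) = R\<^sup>T * (R :: real mat)"
  using assms by (auto simp: transpose_mult[of _ d n _ d])

lemma gram_bilinear_form_rows:
  assumes "R \<in> carrier_mat n d" "u \<in> carrier_vec d" "v \<in> carrier_vec d"
  shows "(R *\<^sub>v u) \<bullet> (R *\<^sub>v v) = (\<Sum>l<n. (row R l \<bullet> u) * (row R l \<bullet> (v :: real vec)))"
  using assms by (simp add: scalar_prod_def[of "R *\<^sub>v u"] lessThan_atLeast0)

lemma isometry_scalar_prod:
  assumes "V \<in> carrier_mat n d" "V\<^sup>T * V = 1\<^sub>m d" "u \<in> carrier_vec d" "v \<in> carrier_vec d"
  shows "(V *\<^sub>v u) \<bullet> (V *\<^sub>v v) = u \<bullet> (v :: real vec)"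
  using gram_bilinear_form[OF assms(1,3,4)] assms by simp

lemma quadratic_form_le_spectral_norm:
  assumes A: "A \<in> carrier_mat d d" and v: "v \<in> carrier_vec d"
  shows "quad_form A v \<le> spectral_norm A * (v \<bullet> v)"
proof (cases "l2_norm_vec v = 0")
  case True
  then have "v = 0\<^sub>v d" using v l2_norm_vec_zero_iff by blast
  then show ?thesis using A by (simp add: scalar_prod_left_zero[of _ d])
next
  case False
  then have pos: "0 < l2_norm_vec v" using l2_norm_vec_nonneg[of v] by linarith
  let ?S = "{l2_norm_vec (A *\<^sub>v v) | v. v \<in> carrier_vec (dim_col A) \<and> l2_norm_vec v \<le> 1}"
  obtain b where b: "op_bound d A b" using op_bound_exists[OF A] ..
  have bdd: "bdd_above ?S"
  proof (rule bdd_aboveI)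
    fix x assume "x \<in> ?S"
    then obtain w where w: "w \<in> carrier_vec d" "l2_norm_vec w \<le> 1" "x = l2_norm_vec (A *\<^sub>v w)"
      using A by auto
    then have "x \<le> b * l2_norm_vec w" using op_boundD(3)[OF b] by simp
    also have "\<dots> \<le> b * 1" using w op_boundD(2)[OF b] by (intro mult_left_mono) auto
    finally show "x \<le> b" by simp
  qed
  let ?a = "1 / l2_norm_vec v"
  have "l2_norm_vec (A *\<^sub>v (?a \<cdot>\<^sub>v v)) \<le> spectral_norm A"
    unfolding spectral_norm_def
    by (intro cSup_upper bdd CollectI exI[of _ "?a \<cdot>\<^sub>v v"] conjI refl)
       (use v A pos in \<open>auto simp: l2_norm_vec_smult\<close>)
  then have le: "l2_norm_vec (A *\<^sub>v v) \<le> spectral_norm A * l2_norm_vec v"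
    using v A pos by (simp add: mult_mat_vec[of _ d d] l2_norm_vec_smult field_simps)
  have "quad_form A v \<le> l2_norm_vec v * l2_norm_vec (A *\<^sub>v v)"
    using abs_scalar_prod_le[of v d "A *\<^sub>v v"] v A by simp
  also have "\<dots> \<le> l2_norm_vec v * (spectral_norm A * l2_norm_vec v)"
    using le by (intro mult_left_mono) auto
  also have "\<dots> = spectral_norm A * (v \<bullet> v)"
    using l2_norm_vec_square[of v] by (simp add: power2_eq_square mult_ac)
  finally show ?thesis .
qed

section \<open>The observability Gramian\<close>

lemma Y_mat_symmetric:
  "Y_mat lam r s \<in> carrier_mat (2 * r) (2 * r)" "transpose_mat (Y_mat lam r s) = Y_mat lam r s"
  unfolding Y_mat_def Lam_col_eq
  by (auto intro!: sum_mat_symmetric gram_symmetric[OF Lam_row_carrier])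

lemma Y_mat_bilinear_form:
  assumes "u \<in> carrier_vec (2 * r)" "v \<in> carrier_vec (2 * r)"
  shows "u \<bullet> (Y_mat lam r s *\<^sub>v v) = (\<Sum>t<s. (Lam_row r lam t *\<^sub>v u) \<bullet> (Lam_row r lam t *\<^sub>v v))"
  unfolding Y_mat_def Lam_col_eq using assms
  by (subst bilinear_form_sum_mat)
     (auto intro!: gram_symmetric[OF Lam_row_carrier] sum.cong gram_bilinear_form[OF Lam_row_carrier])

text \<open>
  The first two time steps determine the pair of initial state and source: t = 0 observes the state and
  t = 1 the state propagated once plus the source. This is where s \<ge> 2 enters, and it makes the
  constant c positive.
\<close>

lemma Y_mat_positive_definite:
  assumes s: "2 \<le> s" and v: "v \<in> carrier_vec (2 * r)" "v \<noteq> 0\<^sub>v (2 * r)"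
  shows "0 < quad_form (Y_mat lam r s) v"
proof (rule ccontr)
  let ?q = "\<lambda>t. (Lam_row r lam t *\<^sub>v v) \<bullet> (Lam_row r lam t *\<^sub>v v)"
  assume "\<not> 0 < quad_form (Y_mat lam r s) v"
  then have "(\<Sum>t<s. ?q t) \<le> 0" by (simp add: Y_mat_bilinear_form[OF v(1) v(1)])
  then have "(\<Sum>t<s. ?q t) = 0" by (intro antisym sum_nonneg scalar_prod_self_nonneg)
  then have q: "?q t = 0" if "t < s" for t
    using that by (subst (asm) sum_nonneg_eq_0_iff) (auto simp: scalar_prod_self_nonneg)
  have zero: "(Lam_row r lam t *\<^sub>v v) $ i = 0" if "t < s" "i < r" for t i
  proof -
    have c: "Lam_row r lam t *\<^sub>v v \<in> carrier_vec r" using v by (intro mult_mat_vec_carrier) auto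
    have "Lam_row r lam t *\<^sub>v v = 0\<^sub>v r"
      using q[OF that(1)] l2_norm_vec_zero_iff[OF c] by (simp add: l2_norm_vec_def)
    then show ?thesis using that by simp
  qed
  have first: "v $ i = 0" if "i < r" for i
    using zero[of 0 i] Lam_row_mult_vec[OF that v(1), of lam 0] s that by simp
  have second: "v $ (r + i) = 0" if "i < r" for i
    using zero[of 1 i] Lam_row_mult_vec[OF that v(1), of lam 1] s that first by simp
  have "v = 0\<^sub>v (2 * r)"
  proof (rule eq_vecI)
    fix i assume "i < dim_vec (0\<^sub>v (2 * r) :: real vec)"
    then have i: "i < 2 * r" by simp
    then show "v $ i = 0\<^sub>v (2 * r) $ i"
      using first[of i] second[of "i - r"] by (cases "i < r") auto
  qed (use v in auto)
  then show False using v by simp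
qed

lemma c_const_pos: "2 \<le> s \<Longrightarrow> 0 < r \<Longrightarrow> 0 < c_const lam r s"
  unfolding c_const_def by (intro lambda_min_pos[OF Y_mat_symmetric] Y_mat_positive_definite) auto

lemma c_const_le:
  "0 < r \<Longrightarrow> v \<in> carrier_vec (2 * r) \<Longrightarrow> c_const lam r s * (v \<bullet> v) \<le> quad_form (Y_mat lam r s) v"
  unfolding c_const_def by (intro lambda_min_symmetric(2)[OF Y_mat_symmetric]) auto

lemma C_const_nonneg: "0 < r \<Longrightarrow> 0 \<le> C_const lam r s"
  unfolding C_const_def
  by (intro lambda_max_nonneg[OF Y_mat_symmetric])
     (auto simp: Y_mat_bilinear_form intro!: sum_nonneg scalar_prod_self_nonneg)

section \<open>Importance sampling\<close>

text \<open>
  Dividing each outcome by its probability makes the mean independent of the sampling distribution. For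
  m = 0 the factors 1 / m vanish and the family is constantly zero.
\<close>

lemma psd_family_importance_sampling:
  fixes G :: "real mat" and S :: "nat \<Rightarrow> real mat"
  assumes p: "set_pmf p = {..<n}"
    and S: "\<And>l. l < n \<Longrightarrow> S l \<in> carrier_mat d d" "\<And>l. l < n \<Longrightarrow> transpose_mat (S l) = S l"
    and psd: "\<And>l v. l < n \<Longrightarrow> v \<in> carrier_vec d \<Longrightarrow> 0 \<le> quad_form (S l) v"
    and bound: "\<And>l v. l < n \<Longrightarrow> v \<in> carrier_vec d \<Longrightarrow> 1 / pmf p l * quad_form (S l) v \<le> \<nu> * (v \<bullet> v)"
    and G: "G \<in> carrier_mat d d" "G\<^sup>T = G"
    and total: "\<And>u v. u \<in> carrier_vec d \<Longrightarrow> v \<in> carrier_vec d \<Longrightarrow> (\<Sum>l<n. u \<bullet> (S l *\<^sub>v v)) = u \<bullet> (G *\<^sub>v v)"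
    and \<rho>: "\<nu> / real m \<le> \<rho>"
  shows "psd_family d p (\<lambda>l. (1 / (real m * pmf p l)) \<cdot>\<^sub>m S l) ((1 / real m) \<cdot>\<^sub>m G) \<rho>"
proof -
  have form: "u \<bullet> (((1 / (real m * pmf p l)) \<cdot>\<^sub>m S l) *\<^sub>v v) = (u \<bullet> (S l *\<^sub>v v)) / (real m * pmf p l)"
    if "l < n" "u \<in> carrier_vec d" "v \<in> carrier_vec d" for u v l
    using that S by (simp add: smult_mat_mult_vec[of _ d d])
  have "measure_pmf.expectation p (\<lambda>l. u \<bullet> (((1 / (real m * pmf p l)) \<cdot>\<^sub>m S l) *\<^sub>v v))
      = u \<bullet> (((1 / real m) \<cdot>\<^sub>m G) *\<^sub>v v)" if uv: "u \<in> carrier_vec d" "v \<in> carrier_vec d" for u v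
  proof -
    have "measure_pmf.expectation p (\<lambda>l. u \<bullet> (((1 / (real m * pmf p l)) \<cdot>\<^sub>m S l) *\<^sub>v v))
        = (\<Sum>l<n. u \<bullet> (((1 / (real m * pmf p l)) \<cdot>\<^sub>m S l) *\<^sub>v v) * pmf p l)"
      using p by (intro integral_measure_pmf_real) auto
    also have "\<dots> = (\<Sum>l<n. (u \<bullet> (S l *\<^sub>v v)) / real m)"
    proof (intro sum.cong refl)
      fix l assume "l \<in> {..<n}"
      moreover from this have "l \<in> set_pmf p" by (simp add: p)
      then have "pmf p l \<noteq> 0" by (simp add: set_pmf_iff)
      ultimately show "u \<bullet> (((1 / (real m * pmf p l)) \<cdot>\<^sub>m S l) *\<^sub>v v) * pmf p l = (u \<bullet> (S l *\<^sub>v v)) / real m"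
        using form uv by simp
    qed
    also have "\<dots> = (u \<bullet> (G *\<^sub>v v)) / real m"
      by (simp add: total[OF uv, symmetric] sum_divide_distrib)
    finally show ?thesis using uv G by (simp add: smult_mat_mult_vec[of _ d d])
  qed
  moreover have "0 \<le> quad_form ((1 / (real m * pmf p l)) \<cdot>\<^sub>m S l) v"
    "quad_form ((1 / (real m * pmf p l)) \<cdot>\<^sub>m S l) v \<le> \<rho> * (v \<bullet> v)"
    if l: "l < n" and v: "v \<in> carrier_vec d" for l v
  proof -
    show "0 \<le> quad_form ((1 / (real m * pmf p l)) \<cdot>\<^sub>m S l) v"
      unfolding form[OF l v v] using psd[OF l v] by (intro divide_nonneg_nonneg) auto
    have "quad_form ((1 / (real m * pmf p l)) \<cdot>\<^sub>m S l) v = (1 / pmf p l * quad_form (S l) v) / real m"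
      unfolding form[OF l v v] by simp
    also have "\<dots> \<le> \<nu> * (v \<bullet> v) / real m"
      using bound[OF l v] by (rule divide_right_mono) simp
    also have "\<dots> = \<nu> / real m * (v \<bullet> v)" by simp
    also have "\<dots> \<le> \<rho> * (v \<bullet> v)"
      using \<rho> scalar_prod_self_nonneg by (rule mult_right_mono)
    finally show "quad_form ((1 / (real m * pmf p l)) \<cdot>\<^sub>m S l) v \<le> \<rho> * (v \<bullet> v)" .
  qed
  ultimately show ?thesis
    unfolding psd_family_def using p S G by (auto simp: transpose_smult_mat)
qed

definition outer_square :: "nat \<Rightarrow> real vec \<Rightarrow> real mat" where
  "outer_square d x = mat d d (\<lambda>(i, j). x $ i * x $ j)"

lemma outer_square_symmetric:
  "outer_square d x \<in> carrier_mat d d" "transpose_mat (outer_square d x) = outer_square d x"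
  by (auto simp: outer_square_def mult.commute intro!: eq_matI)

lemma outer_square_bilinear_form:
  assumes "x \<in> carrier_vec d" "u \<in> carrier_vec d" "v \<in> carrier_vec d"
  shows "u \<bullet> (outer_square d x *\<^sub>v v) = (x \<bullet> u) * (x \<bullet> v)"
proof -
  have "outer_square d x *\<^sub>v v = (x \<bullet> v) \<cdot>\<^sub>v x"
    using assms by (intro eq_vecI)
      (auto simp: outer_square_def scalar_prod_def sum_distrib_left sum_distrib_right mult_ac intro!: sum.cong)
  then show ?thesis using assms comm_scalar_prod[of u d x] by simp
qed

text \<open>
  Row l maps the coordinates of an augmented vector to the signal value at node l and time t.
\<close>

definition sensing_mat :: "real mat \<Rightarrow> (nat \<Rightarrow> real) \<Rightarrow> nat \<Rightarrow> nat \<Rightarrow> real mat" where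
  "sensing_mat U lam k t = first_cols U k * Lam_row k lam t"

lemma first_cols_carrier [simp]: "U \<in> carrier_mat n n \<Longrightarrow> first_cols U k \<in> carrier_mat n k"
  by (auto simp: first_cols_def)

lemma first_cols_isometry:
  assumes "U \<in> carrier_mat n n" "U\<^sup>T * U = 1\<^sub>m n" "k \<le> n"
  shows "transpose_mat (first_cols U k) * first_cols U k = 1\<^sub>m k"
proof (rule eq_matI)
  fix i j assume "i < dim_row (1\<^sub>m k :: real mat)" "j < dim_col (1\<^sub>m k :: real mat)"
  then have ij: "i < k" "j < k" by auto
  have col: "col (first_cols U k) l = col U l" if "l < k" for l
    using that assms by (intro eq_vecI) (auto simp: first_cols_def)
  have "(transpose_mat (first_cols U k) * first_cols U k) $$ (i, j) = col U i \<bullet> col U j"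
    using ij by (simp add: col carrier_matD[OF first_cols_carrier[OF assms(1)]])
  also have "\<dots> = (U\<^sup>T * U) $$ (i, j)" using ij assms(1,3) by simp
  finally show "(transpose_mat (first_cols U k) * first_cols U k) $$ (i, j) = 1\<^sub>m k $$ (i, j)"
    using ij assms by simp
qed (use assms in \<open>auto simp: first_cols_def\<close>)

lemma sensing_mat_carrier [simp]:
  "U \<in> carrier_mat n n \<Longrightarrow> sensing_mat U lam k t \<in> carrier_mat n (2 * k)"
  unfolding sensing_mat_def by (intro mult_carrier_mat[of _ n k]) auto

lemma sensing_mat_isometry:
  assumes U: "U \<in> carrier_mat n n" "U\<^sup>T * U = 1\<^sub>m n" "k \<le> n"
    and uv: "u \<in> carrier_vec (2 * k)" "v \<in> carrier_vec (2 * k)"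
  shows "(sensing_mat U lam k t *\<^sub>v u) \<bullet> (sensing_mat U lam k t *\<^sub>v v)
    = (Lam_row k lam t *\<^sub>v u) \<bullet> (Lam_row k lam t *\<^sub>v v)"
proof -
  have "sensing_mat U lam k t *\<^sub>v w = first_cols U k *\<^sub>v (Lam_row k lam t *\<^sub>v w)"
    if "w \<in> carrier_vec (2 * k)" for w
    unfolding sensing_mat_def using that U
    by (intro assoc_mult_mat_vec[of _ n k _ "2 * k"]) auto
  then show ?thesis
    using uv isometry_scalar_prod[OF first_cols_carrier[OF U(1)] first_cols_isometry[OF U],
        of "Lam_row k lam t *\<^sub>v u" "Lam_row k lam t *\<^sub>v v"]
      mult_mat_vec_carrier[OF Lam_row_carrier]
    by simp
qed

lemma coherence2_ge:
  assumes U: "U \<in> carrier_mat n n" and l: "l < n"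
  shows "1 / pmf (p t) l * (row (sensing_mat U lam k t) l \<bullet> row (sensing_mat U lam k t) l)
    \<le> coherence2 U lam k p t"
proof -
  let ?R = "sensing_mat U lam k t"
  have R: "?R \<in> carrier_mat n (2 * k)" using U by simp
  have rowR: "?R\<^sup>T *\<^sub>v unit_vec n j = row ?R j" if "j < n" for j
    using that R by (intro eq_vecI) auto
  have "coherence2 U lam k p t = (MAX j\<in>{..<n}. 1 / pmf (p t) j * (row ?R j \<bullet> row ?R j))"
    unfolding coherence2_def Let_def sensing_mat_def[symmetric] l2_norm_vec_square
    using U by (intro arg_cong[where f = Max] image_cong) (auto simp: rowR)
  then show ?thesis using l by simp
qed

lemma coherence1_ge:
  assumes U: "U \<in> carrier_mat n n" and l: "l < n"
  shows "1 / pmf p l * spectral_norm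
      (sum_mat (2 * k) (2 * k) (\<lambda>t. outer_square (2 * k) (row (sensing_mat U lam k t) l)) {..<s})
    \<le> coherence1 U lam k s p"
proof -
  let ?d = "2 * k" and ?\<delta> = "\<lambda>l. mat_of_cols n [unit_vec n l] :: real mat"
  have Uk: "first_cols U k \<in> carrier_mat n k" using U by simp
  have outer: "Lam_col k lam t * transpose_mat (first_cols U k) * ?\<delta> j * transpose_mat (?\<delta> j)
        * first_cols U k * Lam_row k lam t = outer_square ?d (row (sensing_mat U lam k t) j)"
    if j: "j < n" for t j
  proof -
    let ?R = "sensing_mat U lam k t"
    have R: "?R \<in> carrier_mat n ?d" using U by simp
    have d: "?\<delta> j \<in> carrier_mat n 1" using mat_of_cols_carrier(1)[of n "[unit_vec n j]"] by simp
    have L: "Lam_row k lam t \<in> carrier_mat k ?d" by simp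
    have "Lam_col k lam t * transpose_mat (first_cols U k) * ?\<delta> j * transpose_mat (?\<delta> j)
        * first_cols U k * Lam_row k lam t
      = (?R\<^sup>T * ?\<delta> j) * (transpose_mat (?\<delta> j) * ?R)"
    proof -
      have "?R\<^sup>T = Lam_col k lam t * transpose_mat (first_cols U k)"
        unfolding sensing_mat_def Lam_col_eq using Uk L by (rule transpose_mult)
      moreover have "X * transpose_mat (?\<delta> j) * first_cols U k * Lam_row k lam t = X * (transpose_mat (?\<delta> j) * ?R)"
        if X: "X \<in> carrier_mat ?d 1" for X
      proof -
        have dt: "transpose_mat (?\<delta> j) \<in> carrier_mat 1 n" using d by simp
        have "X * transpose_mat (?\<delta> j) * first_cols U k * Lam_row k lam t
            = X * transpose_mat (?\<delta> j) * ?R"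
          unfolding sensing_mat_def by (rule assoc_mult_mat[OF mult_carrier_mat[OF X dt] Uk L])
        also have "\<dots> = X * (transpose_mat (?\<delta> j) * ?R)"
          by (rule assoc_mult_mat[OF X dt R])
        finally show ?thesis .
      qed
      moreover have "?R\<^sup>T * ?\<delta> j \<in> carrier_mat ?d 1"
        using R d by (intro mult_carrier_mat[of _ _ n]) auto
      ultimately show ?thesis by simp
    qed
    also have "\<dots> = outer_square ?d (row ?R j)"
    proof (rule eq_matI)
      fix a b assume "a < dim_row (outer_square ?d (row ?R j))" "b < dim_col (outer_square ?d (row ?R j))"
      then have ab: "a < ?d" "b < ?d" by (auto simp: outer_square_def)
      have c0: "col (?\<delta> j) 0 = unit_vec n j"
        by (intro eq_vecI) (auto simp: mat_of_cols_index)
      have r0: "row (transpose_mat (?\<delta> j)) 0 = unit_vec n j" using c0 by simp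
      have "(?R\<^sup>T * ?\<delta> j) $$ (a, 0) = ?R $$ (j, a)"
        using R ab j d by (simp add: c0)
      moreover have "(transpose_mat (?\<delta> j) * ?R) $$ (0, b) = ?R $$ (j, b)"
        using R ab j d by (simp add: c0)
      ultimately show "((?R\<^sup>T * ?\<delta> j) * (transpose_mat (?\<delta> j) * ?R)) $$ (a, b)
          = outer_square ?d (row ?R j) $$ (a, b)"
        using R ab j d by (simp add: outer_square_def scalar_prod_def)
    qed (use R in \<open>auto simp: outer_square_def\<close>)
    finally show ?thesis .
  qed
  have "coherence1 U lam k s p = (MAX j\<in>{..<n}. 1 / pmf p j * spectral_norm
      (sum_mat ?d ?d (\<lambda>t. outer_square ?d (row (sensing_mat U lam k t) j)) {..<s}))"
    unfolding coherence1_def Let_def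
    using U by (intro arg_cong[where f = Max] image_cong) (auto simp: outer)
  then show ?thesis using l by simp
qed

section \<open>Block diagonal matrices\<close>

text \<open>
  Blocks of varying lengths stacked on top of each other, which is the shape of the vectors on which
  diagonal block matrices act blockwise.
\<close>

fun vec_concat :: "nat \<Rightarrow> (nat \<Rightarrow> real vec) \<Rightarrow> real vec" where
  "vec_concat 0 f = vec 0 (\<lambda>_. 0)"
| "vec_concat (Suc s) f = vec_concat s f @\<^sub>v f s"

lemma vec_concat_carrier:
  "(\<And>t. t < s \<Longrightarrow> f t \<in> carrier_vec (d t)) \<Longrightarrow> vec_concat s f \<in> carrier_vec (\<Sum>t<s. d t)"
  by (induction s) auto

lemma vec_concat_scalar_prod:
  "(\<And>t. t < s \<Longrightarrow> f t \<in> carrier_vec (d t)) \<Longrightarrow> vec_concat s f \<bullet> vec_concat s f = (\<Sum>t<s. f t \<bullet> f t)"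
proof (induction s)
  case 0
  then show ?case by (simp add: scalar_prod_def)
next
  case (Suc s)
  have "vec_concat s f \<in> carrier_vec (\<Sum>t<s. d t)" by (rule vec_concat_carrier) (use Suc.prems in auto)
  then show ?case
    using Suc scalar_prod_append[of "vec_concat s f" _ "f s" "d s" "vec_concat s f" "f s"] by simp
qed

lemma vec_concat_uniform:
  "(\<And>t. t < s \<Longrightarrow> f t \<in> carrier_vec n) \<Longrightarrow> vec (s * n) (\<lambda>i. f (i div n) $ (i mod n)) = vec_concat s f"
proof (induction s)
  case 0
  then show ?case by (intro eq_vecI) auto
next
  case (Suc s)
  have IH: "vec_concat s f = vec (s * n) (\<lambda>i. f (i div n) $ (i mod n))" using Suc by simp
  have fs: "dim_vec (f s) = n" using Suc.prems[of s] by auto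
  show ?case
  proof (rule eq_vecI)
    fix i assume "i < dim_vec (vec_concat (Suc s) f)"
    then have i: "i < s * n + n" by (simp add: IH fs)
    show "vec (Suc s * n) (\<lambda>i. f (i div n) $ (i mod n)) $ i = vec_concat (Suc s) f $ i"
    proof (cases "i < s * n")
      case True
      then show ?thesis using i by (simp add: IH fs add.commute)
    next
      case False
      then have "i div n = s" using i by (intro div_nat_eqI) (auto simp: mult.commute)
      moreover from this have "i mod n = i - s * n" by (simp add: modulo_nat_def mult.commute)
      ultimately show ?thesis using i False by (simp add: IH fs add.commute)
    qed
  qed (simp add: IH fs add.commute)
qed

lemma diag_block_mat_carrier:
  fixes A :: "nat \<Rightarrow> 'a :: zero mat"
  assumes "\<And>t. t < s \<Longrightarrow> A t \<in> carrier_mat (r t) (c t)"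
  shows "diag_block_mat (map A [0..<s]) \<in> carrier_mat (\<Sum>t<s. r t) (\<Sum>t<s. c t)"
proof -
  have "map (dim_row \<circ> A) [0..<s] = map r [0..<s]" "map (dim_col \<circ> A) [0..<s] = map c [0..<s]"
    by (auto simp: carrier_matD[OF assms])
  then show ?thesis
    by (intro carrier_matI)
       (simp_all add: dim_diag_block_mat interv_sum_list_conv_sum_set_nat lessThan_atLeast0)
qed

lemma diag_block_mat_mult_vec_concat:
  assumes "\<And>t. t < s \<Longrightarrow> A t \<in> carrier_mat (r t) (c t)" "\<And>t. t < s \<Longrightarrow> f t \<in> carrier_vec (c t)"
  shows "diag_block_mat (map A [0..<s]) *\<^sub>v vec_concat s f = vec_concat s (\<lambda>t. A t *\<^sub>v f t)"
  using assms
proof (induction s)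
  case 0
  then show ?case by (intro eq_vecI) auto
next
  case (Suc s)
  let ?D = "diag_block_mat (map A [0..<s])"
  have D: "?D \<in> carrier_mat (\<Sum>t<s. r t) (\<Sum>t<s. c t)"
    by (rule diag_block_mat_carrier) (use Suc.prems in auto)
  have f: "vec_concat s f \<in> carrier_vec (\<Sum>t<s. c t)"
    by (rule vec_concat_carrier) (use Suc.prems in auto)
  have As: "A s \<in> carrier_mat (r s) (c s)" and fs: "f s \<in> carrier_vec (c s)" using Suc.prems by auto
  have dims: "dim_row ?D = (\<Sum>t<s. r t)" "dim_col ?D = (\<Sum>t<s. c t)" "dim_row (A s) = r s" "dim_col (A s) = c s"
    using D As by auto
  have "diag_block_mat (map A [0..<Suc s])
      = four_block_mat ?D (0\<^sub>m (\<Sum>t<s. r t) (c s)) (0\<^sub>m (r s) (\<Sum>t<s. c t)) (A s)"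
    using diag_block_mat_last[of "map A [0..<s]" "A s"] by (simp add: Let_def dims)
  then have "diag_block_mat (map A [0..<Suc s]) *\<^sub>v vec_concat (Suc s) f
      = (?D *\<^sub>v vec_concat s f + 0\<^sub>m (\<Sum>t<s. r t) (c s) *\<^sub>v f s)
        @\<^sub>v (0\<^sub>m (r s) (\<Sum>t<s. c t) *\<^sub>v vec_concat s f + A s *\<^sub>v f s)"
    using four_block_mat_mult_vec[OF D _ _ As f fs] by simp
  also have "0\<^sub>m (\<Sum>t<s. r t) (c s) *\<^sub>v f s = 0\<^sub>v (\<Sum>t<s. r t)"
    using fs by (intro eq_vecI) auto
  also have "0\<^sub>m (r s) (\<Sum>t<s. c t) *\<^sub>v vec_concat s f = 0\<^sub>v (r s)"
    using f by (intro eq_vecI) auto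
  also have "?D *\<^sub>v vec_concat s f + 0\<^sub>v (\<Sum>t<s. r t) = ?D *\<^sub>v vec_concat s f"
    using D f by (intro right_zero_vec mult_mat_vec_carrier)
  also have "0\<^sub>v (r s) + A s *\<^sub>v f s = A s *\<^sub>v f s"
    using As fs by (intro left_zero_vec mult_mat_vec_carrier)
  finally show ?case using Suc by simp
qed

section \<open>Doubled operators\<close>

lemma diag2_eq: "diag2 B = four_block_mat B (0\<^sub>m (dim_row B) (dim_col B)) (0\<^sub>m (dim_row B) (dim_col B)) B"
  unfolding diag2_def diag_block_mat.simps(2)[of B "[B]"] diag_block_mat_singleton Let_def ..

lemma diag2_carrier [simp]: "B \<in> carrier_mat r c \<Longrightarrow> diag2 B \<in> carrier_mat (2 * r) (2 * c)"
  using four_block_carrier_mat[of B r c B r c] by (simp add: diag2_eq mult_2)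

lemma transpose_diag2: "transpose_mat (diag2 B) = diag2 (B\<^sup>T)"
  unfolding diag2_eq by (subst transpose_four_block_mat[of B "dim_row B" "dim_col B" _ "dim_col B" _ "dim_row B"]) auto

lemma diag2_mult_append:
  assumes B: "B \<in> carrier_mat r c" and ab: "a \<in> carrier_vec c" "b \<in> carrier_vec c"
  shows "diag2 B *\<^sub>v (a @\<^sub>v b) = (B *\<^sub>v a) @\<^sub>v (B *\<^sub>v b)"
proof -
  have z: "0\<^sub>m r c *\<^sub>v x = 0\<^sub>v r" if "x \<in> carrier_vec c" for x :: "real vec"
    using that by (intro eq_vecI) auto
  have "B *\<^sub>v a \<in> carrier_vec r" "B *\<^sub>v b \<in> carrier_vec r" using assms by auto
  then show ?thesis
    using four_block_mat_mult_vec[OF B _ _ B ab, of "0\<^sub>m r c" "0\<^sub>m r c"] assms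
    by (simp add: diag2_eq z carrier_matD[OF B])
qed

lemma split_vec_halves:
  assumes "v \<in> carrier_vec (2 * c)"
  obtains a b where "a \<in> carrier_vec c" "b \<in> carrier_vec c" "v = a @\<^sub>v b"
  using that[of "vec_first v c" "vec_last v c"] vec_first_last_append[of v c c] assms
  by (simp add: mult_2)

lemma append_halves_carrier:
  "a \<in> carrier_vec c \<Longrightarrow> b \<in> carrier_vec c \<Longrightarrow> a @\<^sub>v b \<in> carrier_vec (2 * c)"
  unfolding mult_2 by (rule append_carrier_vec)

lemma diag2_isometry:
  assumes V: "V \<in> carrier_mat n d" "V\<^sup>T * V = 1\<^sub>m d" and v: "v \<in> carrier_vec (2 * d)"
  shows "transpose_mat (diag2 V) *\<^sub>v (diag2 V *\<^sub>v v) = v"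
proof -
  obtain a b where ab: "a \<in> carrier_vec d" "b \<in> carrier_vec d" and eq: "v = a @\<^sub>v b"
    using split_vec_halves[OF v] .
  have inv: "V\<^sup>T *\<^sub>v (V *\<^sub>v x) = x" if "x \<in> carrier_vec d" for x
    using that V assoc_mult_mat_vec[of "V\<^sup>T" d n V d x] by simp
  have Vt: "V\<^sup>T \<in> carrier_mat d n" using V by simp
  show ?thesis
    unfolding eq transpose_diag2 diag2_mult_append[OF V(1) ab]
    using V ab by (subst diag2_mult_append[OF Vt]) (auto simp: inv)
qed

lemma diag2_orthonormal:
  assumes V: "V \<in> carrier_mat n d" "V\<^sup>T * V = 1\<^sub>m d"
  shows "transpose_mat (diag2 V) * diag2 V = 1\<^sub>m (2 * d)"
proof (rule eq_matI)
  let ?T = "transpose_mat (diag2 V)" and ?V = "diag2 V"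
  have Vc: "?V \<in> carrier_mat (2 * n) (2 * d)" using V by simp
  fix i j assume "i < dim_row (1\<^sub>m (2 * d) :: real mat)" "j < dim_col (1\<^sub>m (2 * d) :: real mat)"
  then have ij: "i < 2 * d" "j < 2 * d" by auto
  have entry: "(A *\<^sub>v unit_vec (2 * d) j) $ i = A $$ (i, j)" if "A \<in> carrier_mat (2 * d) (2 * d)" for A :: "real mat"
    using that ij by simp
  have "(?T * ?V) $$ (i, j) = ((?T * ?V) *\<^sub>v unit_vec (2 * d) j) $ i"
    using ij Vc by (intro entry[symmetric] mult_carrier_mat[of _ _ "2 * n"]) auto
  also have "(?T * ?V) *\<^sub>v unit_vec (2 * d) j = unit_vec (2 * d) j"
    using diag2_isometry[OF V, of "unit_vec (2 * d) j"] Vc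
      assoc_mult_mat_vec[of ?T "2 * d" "2 * n" ?V "2 * d" "unit_vec (2 * d) j"] by simp
  finally show "(?T * ?V) $$ (i, j) = 1\<^sub>m (2 * d) $$ (i, j)" using ij by (auto simp: unit_vec_def)
qed (use carrier_matD[OF diag2_carrier[OF V(1)]] in auto)

lemma diag2_pow_mult_append:
  assumes B: "B \<in> carrier_mat n n" and ab: "a \<in> carrier_vec n" "b \<in> carrier_vec n"
  shows "diag2 B ^\<^sub>m i *\<^sub>v (a @\<^sub>v b) = (B ^\<^sub>m i *\<^sub>v a) @\<^sub>v (B ^\<^sub>m i *\<^sub>v b)"
proof (induction i)
  case 0
  have "a @\<^sub>v b \<in> carrier_vec (2 * n)" using ab by (rule append_halves_carrier)
  then show ?case using B ab carrier_matD[OF diag2_carrier[OF B]] by simp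
next
  case (Suc i)
  have c: "a @\<^sub>v b \<in> carrier_vec (2 * n)" using ab by (rule append_halves_carrier)
  have "diag2 B ^\<^sub>m Suc i *\<^sub>v (a @\<^sub>v b) = diag2 B *\<^sub>v (diag2 B ^\<^sub>m i *\<^sub>v (a @\<^sub>v b))"
    unfolding pow_mat_Suc_left[OF diag2_carrier[OF B]] using diag2_carrier[OF B] c
    by (intro assoc_mult_mat_vec[of _ "2 * n" "2 * n" _ "2 * n"]) auto
  also have "\<dots> = (B *\<^sub>v (B ^\<^sub>m i *\<^sub>v a)) @\<^sub>v (B *\<^sub>v (B ^\<^sub>m i *\<^sub>v b))"
    unfolding Suc using B ab by (intro diag2_mult_append[OF B]) auto
  finally show ?case
    using B ab by (simp add: pow_mat_Suc_left[OF B] assoc_mult_mat_vec[of _ n n _ n] del: pow_mat.simps)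
qed

section \<open>Polynomial functions of the Laplacian\<close>

lemma mat_diag_mult_vec:
  assumes "c \<in> carrier_vec n"
  shows "mat_diag n f *\<^sub>v c = vec n (\<lambda>j. f j * c $ j :: real)"
proof (rule eq_vecI)
  fix j assume "j < dim_vec (vec n (\<lambda>j. f j * c $ j))"
  then have j: "j < n" by simp
  have "(mat_diag n f *\<^sub>v c) $ j = (\<Sum>l\<in>{0..<n}. (if j = l then f l else 0) * c $ l)"
    using j assms by (simp add: mat_diag_def scalar_prod_def)
  also have "\<dots> = (\<Sum>l\<in>{0..<n}. if l = j then f j * c $ j else 0)"
    by (intro sum.cong) auto
  finally show "(mat_diag n f *\<^sub>v c) $ j = vec n (\<lambda>j. f j * c $ j) $ j" using j by simp
qed (simp add: mat_diag_def)

lemma mat_diag_quadratic_form: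
  assumes "c \<in> carrier_vec n"
  shows "quad_form (mat_diag n f) c = (\<Sum>j<n. f j * (c $ j :: real)\<^sup>2)"
  unfolding mat_diag_mult_vec[OF assms] using assms
  by (auto simp: scalar_prod_def lessThan_atLeast0 power2_eq_square intro!: sum.cong)

text \<open>
  In the eigenbasis U the powers of L are diagonal, so a polynomial in L acts on the coordinates of a by
  the values of the polynomial at the eigenvalues.
\<close>

lemma poly_quadratic_form:
  fixes U L :: "real mat"
  assumes U: "U \<in> carrier_mat n n" "U\<^sup>T * U = 1\<^sub>m n" "U * U\<^sup>T = 1\<^sub>m n"
    and L: "L = U * mat_diag n \<theta> * U\<^sup>T" and a: "a \<in> carrier_vec n"
  shows "(\<Sum>i\<le>degree g. coeff g i * quad_form (L ^\<^sub>m i) a) = (\<Sum>j<n. poly g (\<theta> j) * ((U\<^sup>T *\<^sub>v a) $ j)\<^sup>2)"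
proof -
  let ?c = "U\<^sup>T *\<^sub>v a"
  have Ut: "U\<^sup>T \<in> carrier_mat n n" using U by simp
  have c: "?c \<in> carrier_vec n" using U a by simp
  have D: "mat_diag n f \<in> carrier_mat n n" for f :: "nat \<Rightarrow> real" by simp
  have "similar_mat_wit L (mat_diag n \<theta>) U (U\<^sup>T)"
    using U L by (simp add: similar_mat_wit_def Let_def)
  then have pow: "L ^\<^sub>m i = U * mat_diag n (\<lambda>j. \<theta> j ^ i) * U\<^sup>T" for i
    using similar_mat_wit_pow_id[of L "mat_diag n \<theta>" U "U\<^sup>T" i] by (simp add: mat_diag_pow)
  have form: "quad_form (L ^\<^sub>m i) a = (\<Sum>j<n. \<theta> j ^ i * (?c $ j)\<^sup>2)" for i
  proof -
    have "L ^\<^sub>m i *\<^sub>v a = U *\<^sub>v (mat_diag n (\<lambda>j. \<theta> j ^ i) *\<^sub>v ?c)"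
      unfolding pow using U Ut D a
      by (simp add: assoc_mult_mat_vec[of _ n n _ n] del: mat_diag_diag)
    then have "quad_form (L ^\<^sub>m i) a = quad_form (mat_diag n (\<lambda>j. \<theta> j ^ i)) ?c"
      using quadratic_form_transpose[OF U(1) a, of "mat_diag n (\<lambda>j. \<theta> j ^ i) *\<^sub>v ?c"] c
        mult_mat_vec_carrier[OF D c] by simp
    also have "\<dots> = (\<Sum>j<n. \<theta> j ^ i * (?c $ j)\<^sup>2)"
      by (rule mat_diag_quadratic_form[OF c])
    finally show ?thesis .
  qed
  have "(\<Sum>i\<le>degree g. coeff g i * quad_form (L ^\<^sub>m i) a)
      = (\<Sum>i\<le>degree g. \<Sum>j<n. coeff g i * \<theta> j ^ i * (?c $ j)\<^sup>2)"
    by (simp add: form sum_distrib_left mult.assoc)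
  also have "\<dots> = (\<Sum>j<n. poly g (\<theta> j) * (?c $ j)\<^sup>2)"
    by (subst sum.swap) (simp add: poly_altdef sum_distrib_right)
  finally show ?thesis .
qed

lemma poly_mat_eval_diag2:
  assumes L: "L \<in> carrier_mat n n" and ab: "a \<in> carrier_vec n" "b \<in> carrier_vec n"
  shows "(a @\<^sub>v b) \<bullet> (poly_mat_eval g (diag2 L) *\<^sub>v (a @\<^sub>v b))
    = (\<Sum>i\<le>degree g. coeff g i * quad_form (L ^\<^sub>m i) a) + (\<Sum>i\<le>degree g. coeff g i * quad_form (L ^\<^sub>m i) b)"
proof -
  let ?v = "a @\<^sub>v b" and ?G = "diag2 L"
  have v: "?v \<in> carrier_vec (2 * n)" using ab by (rule append_halves_carrier)
  have G: "?G \<in> carrier_mat (2 * n) (2 * n)" using L by simp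
  have "quad_form (poly_mat_eval g ?G) ?v = (\<Sum>i\<le>degree g. quad_form (coeff g i \<cdot>\<^sub>m (?G ^\<^sub>m i)) ?v)"
    unfolding poly_mat_eval_def carrier_matD(1)[OF G] using G by (intro bilinear_form_sum_mat[OF _ v v]) simp
  also have "\<dots> = (\<Sum>i\<le>degree g. coeff g i * quad_form (L ^\<^sub>m i) a + coeff g i * quad_form (L ^\<^sub>m i) b)"
  proof (intro sum.cong refl)
    fix i
    have "(coeff g i \<cdot>\<^sub>m (?G ^\<^sub>m i)) *\<^sub>v ?v = coeff g i \<cdot>\<^sub>v ((L ^\<^sub>m i *\<^sub>v a) @\<^sub>v (L ^\<^sub>m i *\<^sub>v b))"
      using v G by (simp add: smult_mat_mult_vec[of _ "2 * n" "2 * n"] diag2_pow_mult_append[OF L ab])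
    moreover have "?v \<bullet> ((L ^\<^sub>m i *\<^sub>v a) @\<^sub>v (L ^\<^sub>m i *\<^sub>v b)) = quad_form (L ^\<^sub>m i) a + quad_form (L ^\<^sub>m i) b"
      using ab L by (intro scalar_prod_append[of _ n _ n]) auto
    moreover have "(L ^\<^sub>m i *\<^sub>v a) @\<^sub>v (L ^\<^sub>m i *\<^sub>v b) \<in> carrier_vec (n + n)"
      using L ab by (intro append_carrier_vec) auto
    ultimately show "quad_form (coeff g i \<cdot>\<^sub>m (?G ^\<^sub>m i)) ?v
        = coeff g i * quad_form (L ^\<^sub>m i) a + coeff g i * quad_form (L ^\<^sub>m i) b"
      using ab by (simp add: scalar_prod_smult_distrib[of _ "n + n"] distrib_left)
  qed
  finally show ?thesis by (simp add: sum.distrib)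
qed

text \<open>
  Here h holds the filtered eigenvalues, q is the value of the filter and P the energy of a in the first
  k coordinates. High coordinates are amplified by at least h k; if there are none, the factor is at
  most h (k - 1), the largest of the remaining ones.
\<close>

lemma spectral_filter_bounds:
  fixes U :: "real mat" and h :: "nat \<Rightarrow> real"
  assumes U: "U \<in> carrier_mat n n" "U * U\<^sup>T = 1\<^sub>m n" and k: "1 \<le> k" "k < n"
    and h: "\<And>i j. i \<le> j \<Longrightarrow> j < n \<Longrightarrow> h i \<le> h j" "\<And>i. i < n \<Longrightarrow> 0 \<le> h i"
    and a: "a \<in> carrier_vec n"
  defines "q \<equiv> (\<Sum>j<n. h j * ((U\<^sup>T *\<^sub>v a) $ j)\<^sup>2)"
    and "P \<equiv> (transpose_mat (first_cols U k) *\<^sub>v a) \<bullet> (transpose_mat (first_cols U k) *\<^sub>v a)"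
  shows "h k * (a \<bullet> a - P) \<le> q" "P = a \<bullet> a \<Longrightarrow> q \<le> h (k - 1) * (a \<bullet> a)"
proof -
  let ?c = "U\<^sup>T *\<^sub>v a"
  have c: "?c \<in> carrier_vec n" using U a by simp
  have "?c \<bullet> ?c = a \<bullet> a"
    using isometry_scalar_prod[of "U\<^sup>T" n n a a] U a by simp
  moreover have "x \<bullet> x = (\<Sum>j<n. (x $ j)\<^sup>2)" if "x \<in> carrier_vec n" for x :: "real vec"
    using that by (simp add: scalar_prod_def lessThan_atLeast0 power2_eq_square)
  ultimately have total: "a \<bullet> a = (\<Sum>j<n. (?c $ j)\<^sup>2)" using c by metis
  have ck: "(transpose_mat (first_cols U k) *\<^sub>v a) $ j = ?c $ j" if "j < k" for j
  proof -
    have "col (first_cols U k) j = col U j"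
      using that U k by (intro eq_vecI) (auto simp: first_cols_def)
    then show ?thesis using that U k by (simp add: first_cols_def)
  qed
  have dimk: "dim_vec (transpose_mat (first_cols U k) *\<^sub>v a) = k" by (simp add: first_cols_def)
  have P: "P = (\<Sum>j<k. (?c $ j)\<^sup>2)"
    unfolding P_def scalar_prod_def dimk by (simp add: ck lessThan_atLeast0 power2_eq_square)
  have split: "(\<Sum>j<n. f j) = (\<Sum>j<k. f j) + (\<Sum>j=k..<n. f j)" for f :: "nat \<Rightarrow> real"
    using k sum.atLeastLessThan_concat[of 0 k n f] by (simp add: lessThan_atLeast0)
  have tail: "a \<bullet> a - P = (\<Sum>j=k..<n. (?c $ j)\<^sup>2)" unfolding total P by (simp add: split)
  have "h k * (a \<bullet> a - P) \<le> (\<Sum>j=k..<n. h j * (?c $ j)\<^sup>2)"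
    unfolding tail sum_distrib_left using h by (intro sum_mono mult_right_mono) auto
  also have "\<dots> \<le> q"
    unfolding q_def split using h k by (auto intro!: sum_nonneg mult_nonneg_nonneg)
  finally show "h k * (a \<bullet> a - P) \<le> q" .
  assume "P = a \<bullet> a"
  then have "(\<Sum>j=k..<n. (?c $ j)\<^sup>2) = 0" using tail by simp
  then have zero: "(?c $ j)\<^sup>2 = 0" if "j \<in> {k..<n}" for j
    using that by (subst (asm) sum_nonneg_eq_0_iff) auto
  have "q = (\<Sum>j<k. h j * (?c $ j)\<^sup>2)"
    unfolding q_def split using zero by simp
  also have "\<dots> \<le> (\<Sum>j<k. h (k - 1) * (?c $ j)\<^sup>2)"
    using h k by (intro sum_mono mult_right_mono) auto
  also have "\<dots> = h (k - 1) * (a \<bullet> a)"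
    unfolding \<open>P = a \<bullet> a\<close>[symmetric] P by (simp add: sum_distrib_left)
  finally show "q \<le> h (k - 1) * (a \<bullet> a)" .
qed

text \<open>
  The doubled Laplacian acts on the two halves of v separately, and each half obeys the bounds of a
  single filter.
\<close>

lemma laplacian_filter_bounds:
  assumes U: "U \<in> carrier_mat n n" "U\<^sup>T * U = 1\<^sub>m n" "U * U\<^sup>T = 1\<^sub>m n"
    and L: "L = U * mat_diag n \<theta> * U\<^sup>T" and k: "1 \<le> k" "k < n"
    and \<theta>: "\<theta> 0 = 0" "\<forall>i j. i \<le> j \<and> j < n \<longrightarrow> \<theta> i \<le> \<theta> j"
    and g: "\<forall>x\<ge>0. 0 \<le> poly g x" "mono_on {0..} (poly g)"
  defines "V \<equiv> diag2 (first_cols U k)"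
  shows "v \<in> carrier_vec (2 * n) \<Longrightarrow>
      poly g (\<theta> k) * (v \<bullet> v - (V\<^sup>T *\<^sub>v v) \<bullet> (V\<^sup>T *\<^sub>v v))
        \<le> quad_form (poly_mat_eval g (diag2 L)) v"
    and "y \<in> carrier_vec (2 * k) \<Longrightarrow>
      (V *\<^sub>v y) \<bullet> (poly_mat_eval g (diag2 L) *\<^sub>v (V *\<^sub>v y)) \<le> poly g (\<theta> (k - 1)) * ((V *\<^sub>v y) \<bullet> (V *\<^sub>v y))"
proof -
  let ?Uk = "first_cols U k"
  let ?h = "\<lambda>j. poly g (\<theta> j)"
  have Lc: "L \<in> carrier_mat n n" using U L by simp
  have Uk: "?Uk \<in> carrier_mat n k" "?Uk\<^sup>T * ?Uk = 1\<^sub>m k"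
    using U k first_cols_isometry[of U n k] by auto
  have pos: "0 \<le> \<theta> i" if "i < n" for i using \<theta> that by (metis le0)
  have h: "?h i \<le> ?h j" if "i \<le> j" "j < n" for i j
    using that g(2) \<theta>(2) pos by (intro mono_onD[OF g(2)]) auto
  have h0: "0 \<le> ?h i" if "i < n" for i using g(1) pos[OF that] by simp
  have lower: "?h k * (a \<bullet> a - (?Uk\<^sup>T *\<^sub>v a) \<bullet> (?Uk\<^sup>T *\<^sub>v a))
      \<le> (\<Sum>j<n. ?h j * ((U\<^sup>T *\<^sub>v a) $ j)\<^sup>2)" if "a \<in> carrier_vec n" for a
    using that by (intro spectral_filter_bounds(1)[OF U(1,3) k, of ?h]) (auto simp: h h0)
  have upper: "(\<Sum>j<n. ?h j * ((U\<^sup>T *\<^sub>v a) $ j)\<^sup>2) \<le> ?h (k - 1) * (a \<bullet> a)"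
    if "a \<in> carrier_vec n" "(?Uk\<^sup>T *\<^sub>v a) \<bullet> (?Uk\<^sup>T *\<^sub>v a) = a \<bullet> a" for a
    using that by (intro spectral_filter_bounds(2)[OF U(1,3) k, of ?h]) (auto simp: h h0)
  show "poly g (\<theta> k) * (v \<bullet> v - (V\<^sup>T *\<^sub>v v) \<bullet> (V\<^sup>T *\<^sub>v v))
        \<le> quad_form (poly_mat_eval g (diag2 L)) v" if v: "v \<in> carrier_vec (2 * n)"
  proof -
    obtain a b where ab: "a \<in> carrier_vec n" "b \<in> carrier_vec n" and eq: "v = a @\<^sub>v b"
      using split_vec_halves[OF v] .
    have "(V\<^sup>T *\<^sub>v v) \<bullet> (V\<^sup>T *\<^sub>v v)
        = (?Uk\<^sup>T *\<^sub>v a) \<bullet> (?Uk\<^sup>T *\<^sub>v a) + (?Uk\<^sup>T *\<^sub>v b) \<bullet> (?Uk\<^sup>T *\<^sub>v b)"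
      unfolding V_def transpose_diag2 eq using ab Uk
      by (subst (1 2) diag2_mult_append[of _ k n]) (auto intro!: scalar_prod_append[of _ k _ k] mult_mat_vec_carrier[of _ k n])
    moreover have "v \<bullet> v = a \<bullet> a + b \<bullet> b" unfolding eq using ab by (intro scalar_prod_append) auto
    moreover note lower[OF ab(1)] lower[OF ab(2)]
    ultimately show ?thesis
      unfolding eq poly_mat_eval_diag2[OF Lc ab] poly_quadratic_form[OF U L ab(1)] poly_quadratic_form[OF U L ab(2)]
      by (simp add: algebra_simps)
  qed
  show "(V *\<^sub>v y) \<bullet> (poly_mat_eval g (diag2 L) *\<^sub>v (V *\<^sub>v y)) \<le> poly g (\<theta> (k - 1)) * ((V *\<^sub>v y) \<bullet> (V *\<^sub>v y))"
    if y: "y \<in> carrier_vec (2 * k)"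
  proof -
    obtain y1 y2 where y12: "y1 \<in> carrier_vec k" "y2 \<in> carrier_vec k" and eq: "y = y1 @\<^sub>v y2"
      using split_vec_halves[OF y] .
    let ?a = "?Uk *\<^sub>v y1" and ?b = "?Uk *\<^sub>v y2"
    have ab: "?a \<in> carrier_vec n" "?b \<in> carrier_vec n" using Uk y12 by auto
    have Vy: "V *\<^sub>v y = ?a @\<^sub>v ?b" unfolding V_def eq by (rule diag2_mult_append[OF Uk(1) y12])
    have full: "(?Uk\<^sup>T *\<^sub>v (?Uk *\<^sub>v x)) \<bullet> (?Uk\<^sup>T *\<^sub>v (?Uk *\<^sub>v x)) = (?Uk *\<^sub>v x) \<bullet> (?Uk *\<^sub>v x)"
      if x: "x \<in> carrier_vec k" for x
    proof -
      have "?Uk\<^sup>T *\<^sub>v (?Uk *\<^sub>v x) = x"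
        using assoc_mult_mat_vec[of "?Uk\<^sup>T" k n ?Uk k x] Uk x by simp
      then show ?thesis using isometry_scalar_prod[OF Uk x x] by simp
    qed
    have "(?a @\<^sub>v ?b) \<bullet> (?a @\<^sub>v ?b) = ?a \<bullet> ?a + ?b \<bullet> ?b" using ab by (intro scalar_prod_append) auto
    moreover note upper[OF ab(1) full[OF y12(1)]] upper[OF ab(2) full[OF y12(2)]]
    ultimately show ?thesis
      unfolding Vy poly_mat_eval_diag2[OF Lc ab] poly_quadratic_form[OF U L ab(1)] poly_quadratic_form[OF U L ab(2)]
      by (simp add: algebra_simps)
  qed
qed

section \<open>Regularized least squares\<close>

lemma projection_complement_norm:
  assumes V: "V \<in> carrier_mat N d" "V\<^sup>T * V = 1\<^sub>m d" and v: "v \<in> carrier_vec N"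
  shows "((1\<^sub>m N - V * V\<^sup>T) *\<^sub>v v) \<bullet> ((1\<^sub>m N - V * V\<^sup>T) *\<^sub>v v)
    = v \<bullet> v - (V\<^sup>T *\<^sub>v v) \<bullet> (V\<^sup>T *\<^sub>v (v :: real vec))"
proof -
  let ?y = "V\<^sup>T *\<^sub>v v"
  have y: "?y \<in> carrier_vec d" using V v by (intro mult_mat_vec_carrier[of _ d N]) auto
  have Vy: "V *\<^sub>v ?y \<in> carrier_vec N" using V y by (intro mult_mat_vec_carrier[of _ N d]) auto
  have "(1\<^sub>m N - V * V\<^sup>T) *\<^sub>v v = v - V *\<^sub>v ?y"
    using V v minus_mult_distrib_mat_vec[of "1\<^sub>m N" N N "V * V\<^sup>T" v]
      assoc_mult_mat_vec[of V N d "V\<^sup>T" N v] mult_carrier_mat[of V N d "V\<^sup>T" N]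
    by simp
  moreover have "v \<bullet> (V *\<^sub>v ?y) = ?y \<bullet> ?y" using quadratic_form_transpose[OF V(1) v y] .
  moreover have "(V *\<^sub>v ?y) \<bullet> (V *\<^sub>v ?y) = ?y \<bullet> ?y" using isometry_scalar_prod[OF V y y] .
  ultimately show ?thesis
    using v Vy comm_scalar_prod[OF Vy v]
    by (simp add: minus_scalar_prod_distrib[of _ N] scalar_prod_minus_distrib[of _ N])
qed

text \<open>
  The deterministic part for a general linear observation operator B with weights A and an orthonormal
  basis V of the signal space. The operator must ignore the orthogonal complement of V at ws (inv) and
  be bounded below on V (emb); the penalty must be at least h on the complement and at most l at the true
  signal w. Minimality of ws enters as the comparison of the objective at ws and at w (opt).
\<close>

lemma regularized_recovery_bound:
  assumes A: "A \<in> carrier_mat r M" and B: "B \<in> carrier_mat M N" and V: "V \<in> carrier_mat N d" "V\<^sup>T * V = 1\<^sub>m d"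
    and y: "y \<in> carrier_vec d" and e: "e \<in> carrier_vec M" and ws: "ws \<in> carrier_vec N"
    and inv: "B *\<^sub>v (V *\<^sub>v (V\<^sup>T *\<^sub>v ws)) = B *\<^sub>v ws"
    and emb: "\<And>u. u \<in> carrier_vec d \<Longrightarrow> \<kappa> * (u \<bullet> u) \<le> (l2_norm_vec (A *\<^sub>v (B *\<^sub>v (V *\<^sub>v u))))\<^sup>2"
    and pos: "0 < \<kappa>" "0 < \<gamma>" "0 < h" "0 \<le> l"
    and low: "h * (ws \<bullet> ws - (V\<^sup>T *\<^sub>v ws) \<bullet> (V\<^sup>T *\<^sub>v ws)) \<le> quad_form G ws"
    and w: "w = V *\<^sub>v y" and up: "quad_form G w \<le> l * (w \<bullet> w)"
    and opt: "(l2_norm_vec (A *\<^sub>v (B *\<^sub>v ws - (B *\<^sub>v w + e))))\<^sup>2 + \<gamma> * quad_form G ws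
      \<le> (l2_norm_vec (A *\<^sub>v (B *\<^sub>v w - (B *\<^sub>v w + e))))\<^sup>2 + \<gamma> * quad_form G w"
  shows "l2_norm_vec ((V * V\<^sup>T) *\<^sub>v ws - w)
      \<le> (2 * l2_norm_vec (A *\<^sub>v e) + sqrt (\<gamma> * l) * l2_norm_vec w) / sqrt \<kappa>"
    and "l2_norm_vec ((1\<^sub>m N - V * V\<^sup>T) *\<^sub>v ws)
      \<le> l2_norm_vec (A *\<^sub>v e) / sqrt (\<gamma> * h) + sqrt (l / h) * l2_norm_vec w"
proof -
  define E where "E = l2_norm_vec (A *\<^sub>v e)"
  define \<beta> where "\<beta> = (1\<^sub>m N - V * V\<^sup>T) *\<^sub>v ws"
  \<comment> \<open>K bounds both the residual and the penalized complement, since its square dominates the objective at w.\<close>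
  define K where "K = E + sqrt (\<gamma> * l) * l2_norm_vec w"
  define res where "res = A *\<^sub>v (B *\<^sub>v ws - (B *\<^sub>v w + e))"
  have wc: "w \<in> carrier_vec N" using V y by (simp add: w)
  have Bc: "B *\<^sub>v v \<in> carrier_vec M" if "v \<in> carrier_vec N" for v
    using that B by (intro mult_mat_vec_carrier[of _ M N]) auto
  have Ac: "A *\<^sub>v v \<in> carrier_vec r" if "v \<in> carrier_vec M" for v
    using that A by (intro mult_mat_vec_carrier[of _ r M]) auto
  have K0: "0 \<le> K" using pos by (simp add: K_def E_def)
  have "B *\<^sub>v w - (B *\<^sub>v w + e) = (-1) \<cdot>\<^sub>v e"
    using Bc[OF wc] e by (intro eq_vecI) (auto simp del: index_mult_mat_vec)
  then have "l2_norm_vec (A *\<^sub>v (B *\<^sub>v w - (B *\<^sub>v w + e))) = E"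
    using A e by (simp add: mult_mat_vec[of A r M] l2_norm_vec_smult E_def)
  then have "(l2_norm_vec res)\<^sup>2 + \<gamma> * quad_form G ws \<le> E\<^sup>2 + \<gamma> * quad_form G w"
    using opt by (simp add: res_def)
  also have "\<dots> \<le> E\<^sup>2 + \<gamma> * (l * (w \<bullet> w))"
    using up pos by (intro add_left_mono mult_left_mono) auto
  also have "\<dots> = E\<^sup>2 + (sqrt (\<gamma> * l) * l2_norm_vec w)\<^sup>2"
    using pos by (simp add: power_mult_distrib l2_norm_vec_square)
  also have "\<dots> \<le> K\<^sup>2"
    using pos unfolding K_def power2_sum by (simp add: E_def)
  finally have main: "(l2_norm_vec res)\<^sup>2 + \<gamma> * quad_form G ws \<le> K\<^sup>2" .
  have "\<gamma> * (h * (\<beta> \<bullet> \<beta>)) \<le> \<gamma> * quad_form G ws"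
    unfolding \<beta>_def projection_complement_norm[OF V ws] using low pos by (intro mult_left_mono) auto
  moreover have "0 \<le> \<gamma> * (h * (\<beta> \<bullet> \<beta>))" using pos scalar_prod_self_nonneg[of \<beta>] by simp
  ultimately have "(l2_norm_vec res)\<^sup>2 \<le> K\<^sup>2" "\<gamma> * h * (\<beta> \<bullet> \<beta>) \<le> K\<^sup>2"
    using main zero_le_power2[of "l2_norm_vec res"] unfolding mult.assoc by linarith+
  then have res: "l2_norm_vec res \<le> K" and "(sqrt (\<gamma> * h) * l2_norm_vec \<beta>)\<^sup>2 \<le> K\<^sup>2"
    using K0 pos by (auto intro: power2_le_imp_le simp: power_mult_distrib l2_norm_vec_square)
  then have "sqrt (\<gamma> * h) * l2_norm_vec \<beta> \<le> K" using K0 by (meson power2_le_imp_le)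
  then have "l2_norm_vec \<beta> \<le> K / sqrt (\<gamma> * h)"
    using pos by (simp add: pos_le_divide_eq mult.commute)
  also have "\<dots> = E / sqrt (\<gamma> * h) + sqrt (l / h) * l2_norm_vec w"
    using pos by (simp add: K_def add_divide_distrib real_sqrt_mult real_sqrt_divide)
  finally show "l2_norm_vec ((1\<^sub>m N - V * V\<^sup>T) *\<^sub>v ws)
      \<le> l2_norm_vec (A *\<^sub>v e) / sqrt (\<gamma> * h) + sqrt (l / h) * l2_norm_vec w"
    by (simp add: \<beta>_def E_def)
  \<comment> \<open>The coordinates of the estimation error inside the signal space.\<close>
  define u where "u = V\<^sup>T *\<^sub>v ws - y"
  have Vws: "V\<^sup>T *\<^sub>v ws \<in> carrier_vec d"
    using V ws by (intro mult_mat_vec_carrier[of _ d N]) auto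
  have u: "u \<in> carrier_vec d" unfolding u_def using y Vws by simp
  have Vu: "V *\<^sub>v u = V *\<^sub>v (V\<^sup>T *\<^sub>v ws) - w"
    unfolding u_def w using V Vws y by (intro mult_minus_distrib_mat_vec) auto
  \<comment> \<open>The noise is added back to the residual, which costs the second E in the bound.\<close>
  have shift: "x - x' = (x - (x' + e)) + e" if "x \<in> carrier_vec M" "x' \<in> carrier_vec M" for x x'
    using that e by (intro eq_vecI) auto
  have "B *\<^sub>v (V *\<^sub>v u) = B *\<^sub>v ws - B *\<^sub>v w"
    unfolding Vu using B V Vws wc inv
    by (subst mult_minus_distrib_mat_vec[of _ M N]) (auto intro: mult_mat_vec_carrier[of _ N d])
  also have "\<dots> = (B *\<^sub>v ws - (B *\<^sub>v w + e)) + e"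
    by (rule shift[OF Bc[OF ws] Bc[OF wc]])
  finally have "A *\<^sub>v (B *\<^sub>v (V *\<^sub>v u)) = res + A *\<^sub>v e"
    unfolding res_def using A Bc[OF wc] Bc[OF ws] e by (simp add: mult_add_distrib_mat_vec[of _ r M])
  then have "l2_norm_vec (A *\<^sub>v (B *\<^sub>v (V *\<^sub>v u))) \<le> l2_norm_vec res + E"
    unfolding E_def using Ac[OF e] Ac Bc[OF wc] Bc[OF ws] e
    by (simp add: res_def l2_norm_vec_triangle[of _ r])
  also have "\<dots> \<le> K + E" using res by simp
  finally have "l2_norm_vec (A *\<^sub>v (B *\<^sub>v (V *\<^sub>v u))) \<le> K + E" .
  then have "(l2_norm_vec (A *\<^sub>v (B *\<^sub>v (V *\<^sub>v u))))\<^sup>2 \<le> (K + E)\<^sup>2" by (rule power_mono) simp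
  then have "\<kappa> * (u \<bullet> u) \<le> (K + E)\<^sup>2" using emb[OF u] by linarith
  then have "(sqrt \<kappa> * l2_norm_vec u)\<^sup>2 \<le> (K + E)\<^sup>2"
    using pos by (simp add: power_mult_distrib l2_norm_vec_square)
  then have "sqrt \<kappa> * l2_norm_vec u \<le> K + E"
    by (rule power2_le_imp_le) (use K0 in \<open>simp add: E_def\<close>)
  then have "l2_norm_vec u \<le> (K + E) / sqrt \<kappa>"
    using pos by (simp add: pos_le_divide_eq mult.commute)
  moreover have "(V * V\<^sup>T) *\<^sub>v ws - w = V *\<^sub>v u"
    unfolding Vu using V ws by (simp add: assoc_mult_mat_vec[of V N d "V\<^sup>T" N])
  moreover have "l2_norm_vec (V *\<^sub>v u) = l2_norm_vec u"
    using isometry_scalar_prod[OF V u u] by (simp add: l2_norm_vec_def)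
  ultimately show "l2_norm_vec ((V * V\<^sup>T) *\<^sub>v ws - w)
      \<le> (2 * l2_norm_vec (A *\<^sub>v e) + sqrt (\<gamma> * l) * l2_norm_vec w) / sqrt \<kappa>"
    by (simp add: K_def E_def algebra_simps)
qed

section \<open>The sampled energy\<close>

text \<open>
  The squared norm of the weighted samples of the signal with coordinates y, in the form of a sum over
  times and draws.
\<close>

definition sampled_energy ::
  "real mat \<Rightarrow> (nat \<Rightarrow> real) \<Rightarrow> nat \<Rightarrow> nat \<Rightarrow> (nat \<Rightarrow> nat) \<Rightarrow> (nat \<Rightarrow> nat pmf) \<Rightarrow> (nat \<Rightarrow> nat \<Rightarrow> nat) \<Rightarrow> real vec \<Rightarrow> real"
where
  "sampled_energy U lam k s m p om y =
    (\<Sum>t<s. \<Sum>j<m t. (row (sensing_mat U lam k t) (om t j) \<bullet> y)\<^sup>2 / (real (m t) * pmf (p t) (om t j)))"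

lemma pi_op_eq_vec_concat:
  assumes U: "U \<in> carrier_mat n n" and v: "v \<in> carrier_vec (2 * n)"
  shows "pi_op U lam k s v
    = vec_concat s (\<lambda>t. sensing_mat U lam k t *\<^sub>v (transpose_mat (diag2 (first_cols U k)) *\<^sub>v v))"
proof -
  have Vt: "transpose_mat (diag2 (first_cols U k)) \<in> carrier_mat (2 * k) (2 * n)" using U by simp
  have R: "sensing_mat U lam k t \<in> carrier_mat n (2 * k)" for t using U by simp
  have "(first_cols U k * Lam_row k lam t * transpose_mat (diag2 (first_cols U k))) *\<^sub>v v
      = sensing_mat U lam k t *\<^sub>v (transpose_mat (diag2 (first_cols U k)) *\<^sub>v v)" for t
    unfolding sensing_mat_def[symmetric] by (rule assoc_mult_mat_vec[OF R Vt v])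
  then have "pi_op U lam k s v = vec (s * n) (\<lambda>i. (sensing_mat U lam k (i div n)
      *\<^sub>v (transpose_mat (diag2 (first_cols U k)) *\<^sub>v v)) $ (i mod n))"
    using U by (simp add: pi_op_def Let_def carrier_matD[OF U])
  also have "\<dots> = vec_concat s (\<lambda>t. sensing_mat U lam k t *\<^sub>v (transpose_mat (diag2 (first_cols U k)) *\<^sub>v v))"
    using mult_mat_vec_carrier[OF R mult_mat_vec_carrier[OF Vt v]] by (rule vec_concat_uniform)
  finally show ?thesis .
qed

lemma pi_op_linear:
  assumes U: "U \<in> carrier_mat n n" and n: "0 < n"
  obtains B where "B \<in> carrier_mat (s * n) (2 * n)" "\<And>v. v \<in> carrier_vec (2 * n) \<Longrightarrow> pi_op U lam k s v = B *\<^sub>v v"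
proof
  define T where "T t = first_cols U k * Lam_row k lam t * transpose_mat (diag2 (first_cols U k))" for t
  let ?B = "mat (s * n) (2 * n) (\<lambda>(i, j). T (i div n) $$ (i mod n, j))"
  have Vt: "transpose_mat (diag2 (first_cols U k)) \<in> carrier_mat (2 * k) (2 * n)" using U by simp
  have T: "T t \<in> carrier_mat n (2 * n)" for t
    unfolding T_def sensing_mat_def[symmetric] using U by (intro mult_carrier_mat[OF _ Vt]) simp
  have pi: "pi_op U lam k s v = vec (s * n) (\<lambda>i. (T (i div n) *\<^sub>v v) $ (i mod n))" for v
    by (simp add: pi_op_def Let_def carrier_matD[OF U] T_def)
  show "?B \<in> carrier_mat (s * n) (2 * n)" by simp
  show "pi_op U lam k s v = ?B *\<^sub>v v" if v: "v \<in> carrier_vec (2 * n)" for v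
  proof (rule eq_vecI)
    fix i assume "i < dim_vec (?B *\<^sub>v v)"
    then have i: "i < s * n" by simp
    have "row ?B i = row (T (i div n)) (i mod n)"
      using i n by (intro eq_vecI) (auto simp: carrier_matD[OF T])
    moreover have "(T (i div n) *\<^sub>v v) $ (i mod n) = row (T (i div n)) (i mod n) \<bullet> v"
      using n by (intro index_mult_mat_vec) (auto simp: carrier_matD[OF T])
    ultimately show "pi_op U lam k s v $ i = (?B *\<^sub>v v) $ i"
      using i by (simp add: pi)
  qed (simp add: pi)
qed

lemma sampling_block_carriers:
  "W_block s m \<in> carrier_mat (\<Sum>t<s. m t) (\<Sum>t<s. m t)"
  "P_block s m p om \<in> carrier_mat (\<Sum>t<s. m t) (\<Sum>t<s. m t)"
  "S_block n s m om \<in> carrier_mat (\<Sum>t<s. m t) (s * n)"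
proof -
  show "W_block s m \<in> carrier_mat (\<Sum>t<s. m t) (\<Sum>t<s. m t)"
    unfolding W_block_def by (rule diag_block_mat_carrier) simp
  show "P_block s m p om \<in> carrier_mat (\<Sum>t<s. m t) (\<Sum>t<s. m t)"
    unfolding P_block_def by (rule diag_block_mat_carrier) simp
  have "S_block n s m om \<in> carrier_mat (\<Sum>t<s. m t) (\<Sum>t<s. n)"
    unfolding S_block_def by (rule diag_block_mat_carrier) (simp add: samp_mat_def)
  then show "S_block n s m om \<in> carrier_mat (\<Sum>t<s. m t) (s * n)" by simp
qed

lemma samp_mat_mult_vec:
  assumes "x \<in> carrier_vec n" "\<And>j. j < m \<Longrightarrow> om j < n"
  shows "samp_mat n m om *\<^sub>v x = vec m (\<lambda>j. x $ om j)"
proof (rule eq_vecI)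
  fix j assume "j < dim_vec (vec m (\<lambda>j. x $ om j))"
  then have j: "j < m" by simp
  have "(samp_mat n m om *\<^sub>v x) $ j = (\<Sum>l\<in>{0..<n}. (if l = om j then 1 else 0) * x $ l)"
    using j assms by (simp add: samp_mat_def scalar_prod_def)
  also have "\<dots> = (\<Sum>l\<in>{0..<n}. if l = om j then x $ om j else 0)"
    by (intro sum.cong) auto
  finally show "(samp_mat n m om *\<^sub>v x) $ j = vec m (\<lambda>j. x $ om j) $ j" using j assms(2)[OF j] by simp
qed (simp add: samp_mat_def)

text \<open>
  Both weights are inverse square roots, so a draw of node l at time t enters with 1 / (m t * p t l)
  after squaring.
\<close>

lemma weighted_samples_energy:
  assumes U: "U \<in> carrier_mat n n" "U\<^sup>T * U = 1\<^sub>m n" "k \<le> n"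
    and om: "\<And>t j. t < s \<Longrightarrow> j < m t \<Longrightarrow> om t j < n" and y: "y \<in> carrier_vec (2 * k)"
  shows "(l2_norm_vec ((W_block s m * P_block s m p om) *\<^sub>v
      (S_block n s m om *\<^sub>v pi_op U lam k s (diag2 (first_cols U k) *\<^sub>v y))))\<^sup>2
    = sampled_energy U lam k s m p om y"
proof -
  let ?Uk = "first_cols U k"
  let ?R = "\<lambda>t. sensing_mat U lam k t"
  have Uk: "?Uk \<in> carrier_mat n k" "?Uk\<^sup>T * ?Uk = 1\<^sub>m k"
    using U first_cols_isometry[OF U] by auto
  have R: "?R t \<in> carrier_mat n (2 * k)" for t using U by simp
  have Ry: "?R t *\<^sub>v y \<in> carrier_vec n" for t using R y by (rule mult_mat_vec_carrier)
  define x1 where "x1 t = vec (m t) (\<lambda>j. (?R t *\<^sub>v y) $ om t j)" for t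
  define x2 where "x2 t = vec (m t) (\<lambda>j. 1 / sqrt (pmf (p t) (om t j)) * x1 t $ j)" for t
  define x3 where "x3 t = vec (m t) (\<lambda>j. 1 / sqrt (real (m t)) * x2 t $ j)" for t
  have x: "x1 t \<in> carrier_vec (m t)" "x2 t \<in> carrier_vec (m t)" "x3 t \<in> carrier_vec (m t)" for t
    by (simp_all add: x1_def x2_def x3_def)
  have concat_cong: "vec_concat s f = vec_concat s g" if "\<And>t. t < s \<Longrightarrow> f t = g t" for f g s
    using that by (induction s) auto
  have Vy: "diag2 ?Uk *\<^sub>v y \<in> carrier_vec (2 * n)" using Uk y by (intro mult_mat_vec_carrier) auto
  have "pi_op U lam k s (diag2 ?Uk *\<^sub>v y) = vec_concat s (\<lambda>t. ?R t *\<^sub>v y)"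
    unfolding pi_op_eq_vec_concat[OF U(1) Vy] diag2_isometry[OF Uk y] ..
  then have "S_block n s m om *\<^sub>v pi_op U lam k s (diag2 ?Uk *\<^sub>v y)
      = vec_concat s (\<lambda>t. samp_mat n (m t) (om t) *\<^sub>v (?R t *\<^sub>v y))"
    unfolding S_block_def using Ry
    by (simp only:) (intro diag_block_mat_mult_vec_concat[where r = m and c = "\<lambda>_. n"], auto simp: samp_mat_def)
  also have "\<dots> = vec_concat s x1"
    unfolding x1_def using om Ry by (intro concat_cong samp_mat_mult_vec) auto
  finally have S: "S_block n s m om *\<^sub>v pi_op U lam k s (diag2 ?Uk *\<^sub>v y) = vec_concat s x1" .
  have "P_block s m p om *\<^sub>v vec_concat s x1
      = vec_concat s (\<lambda>t. mat_diag (m t) (\<lambda>j. 1 / sqrt (pmf (p t) (om t j))) *\<^sub>v x1 t)"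
    unfolding P_block_def using x by (intro diag_block_mat_mult_vec_concat[where r = m and c = m]) auto
  also have "\<dots> = vec_concat s x2"
    unfolding x2_def using x by (intro concat_cong mat_diag_mult_vec)
  finally have P: "P_block s m p om *\<^sub>v vec_concat s x1 = vec_concat s x2" .
  have "W_block s m *\<^sub>v vec_concat s x2
      = vec_concat s (\<lambda>t. ((1 / sqrt (real (m t))) \<cdot>\<^sub>m 1\<^sub>m (m t)) *\<^sub>v x2 t)"
    unfolding W_block_def using x by (intro diag_block_mat_mult_vec_concat[where r = m and c = m]) auto
  also have "\<dots> = vec_concat s x3"
  proof (rule concat_cong)
    fix t
    show "((1 / sqrt (real (m t))) \<cdot>\<^sub>m 1\<^sub>m (m t)) *\<^sub>v x2 t = x3 t"
      using x(2)[of t] smult_mat_mult_vec[of "1\<^sub>m (m t)" "m t" "m t" "x2 t" "1 / sqrt (real (m t))"]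
      by (simp add: x3_def) (intro eq_vecI, auto)
  qed
  finally have W: "W_block s m *\<^sub>v vec_concat s x2 = vec_concat s x3" .
  have c1: "vec_concat s x1 \<in> carrier_vec (\<Sum>t<s. m t)" using x by (intro vec_concat_carrier) auto
  have "(W_block s m * P_block s m p om) *\<^sub>v vec_concat s x1 = vec_concat s x3"
    using assoc_mult_mat_vec[OF sampling_block_carriers(1,2) c1] by (simp add: P W)
  then have "(l2_norm_vec ((W_block s m * P_block s m p om) *\<^sub>v
      (S_block n s m om *\<^sub>v pi_op U lam k s (diag2 ?Uk *\<^sub>v y))))\<^sup>2 = (\<Sum>t<s. x3 t \<bullet> x3 t)"
    unfolding S l2_norm_vec_square using vec_concat_scalar_prod[of s x3 m] x by simp
  also have "\<dots> = sampled_energy U lam k s m p om y"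
    unfolding sampled_energy_def
  proof (intro sum.cong refl)
    fix t assume t: "t \<in> {..<s}"
    have "x3 t \<bullet> x3 t = (\<Sum>j<m t. (x3 t $ j)\<^sup>2)"
      using x(3)[of t] by (simp add: scalar_prod_def lessThan_atLeast0 power2_eq_square)
    also have "\<dots> = (\<Sum>j<m t. (row (?R t) (om t j) \<bullet> y)\<^sup>2 / (real (m t) * pmf (p t) (om t j)))"
      using om t carrier_matD[OF R]
      by (intro sum.cong refl) (simp add: x3_def x2_def x1_def power_mult_distrib power_divide)
    finally show "x3 t \<bullet> x3 t = (\<Sum>j<m t. (row (?R t) (om t j) \<bullet> y)\<^sup>2 / (real (m t) * pmf (p t) (om t j)))" .
  qed
  finally show ?thesis .
qed

section \<open>Stable embedding under the two sampling regimes\<close>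

lemma gramian_rows:
  assumes U: "U \<in> carrier_mat n n" "U\<^sup>T * U = 1\<^sub>m n" "k \<le> n"
    and uv: "u \<in> carrier_vec (2 * k)" "v \<in> carrier_vec (2 * k)"
  shows "u \<bullet> (Y_mat lam k s *\<^sub>v v)
    = (\<Sum>t<s. \<Sum>l<n. (row (sensing_mat U lam k t) l \<bullet> u) * (row (sensing_mat U lam k t) l \<bullet> v))"
  unfolding Y_mat_bilinear_form[OF uv] sensing_mat_isometry[OF U uv, symmetric]
    gram_bilinear_form_rows[OF sensing_mat_carrier[OF U(1)] uv] ..

text \<open>
  For m = 0 the quotient is 0 by convention, whence the hypothesis on the sign of rho.
\<close>

lemma divide_le_of_le_mult: "\<nu> \<le> \<rho> * real m \<Longrightarrow> 0 \<le> \<rho> \<Longrightarrow> \<nu> / real m \<le> \<rho>"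
  by (cases "m = 0") (auto simp: divide_le_eq)

text \<open>
  The nodes are drawn once and observed at all times, so one draw contributes the sum over time of the
  rank one matrices of its node, and the draws are identically distributed with mean Y / m. If no node is
  drawn, the condition coh forces the coherence to be nonpositive, hence Y to vanish, and the bound on
  the mean still holds.
\<close>

lemma regime1_embedding:
  assumes U: "U \<in> carrier_mat n n" "U\<^sup>T * U = 1\<^sub>m n" "k \<le> n" and k: "1 \<le> k"
    and p: "set_pmf p0 = {..<n}" and \<delta>: "0 < \<delta>" "\<delta> < 1" and \<rho>: "0 < \<rho>"
    and same: "\<And>t. t < s \<Longrightarrow> m t = m0" "\<And>t. t < s \<Longrightarrow> p t = p0"
    and coh: "coherence1 U lam k s p0 \<le> \<rho> * real m0"
  shows "1 - real (2 * k) * exp (- (c_const lam k s * \<delta>\<^sup>2 / (3 * \<rho>)))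
    \<le> measure_pmf.prob (regime1_law m0 p0) {om. \<forall>y\<in>carrier_vec (2 * k).
        (1 - \<delta>) * c_const lam k s * (y \<bullet> y) \<le> sampled_energy U lam k s m p om y}"
proof -
  let ?d = "2 * k" and ?c = "c_const lam k s"
  let ?r = "\<lambda>t l. row (sensing_mat U lam k t) l"
  define S where "S l = sum_mat ?d ?d (\<lambda>t. outer_square ?d (?r t l)) {..<s}" for l
  have r: "?r t l \<in> carrier_vec ?d" for t l
    using carrier_matD(2)[OF sensing_mat_carrier[OF U(1)]] by (intro carrier_vecI) simp
  have S: "S l \<in> carrier_mat ?d ?d" "transpose_mat (S l) = S l" for l
    unfolding S_def using outer_square_symmetric by (auto intro!: sum_mat_symmetric)
  have form: "u \<bullet> (S l *\<^sub>v v) = (\<Sum>t<s. (?r t l \<bullet> u) * (?r t l \<bullet> v))"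
    if "u \<in> carrier_vec ?d" "v \<in> carrier_vec ?d" for u v l
    unfolding S_def using that r outer_square_symmetric
    by (subst bilinear_form_sum_mat) (auto simp: outer_square_bilinear_form[of _ ?d])
  have total: "(\<Sum>l<n. u \<bullet> (S l *\<^sub>v v)) = u \<bullet> (Y_mat lam k s *\<^sub>v v)"
    if "u \<in> carrier_vec ?d" "v \<in> carrier_vec ?d" for u v
    unfolding gramian_rows[OF U that] form[OF that] by (rule sum.swap)
  have bound: "1 / pmf p0 l * quad_form (S l) v \<le> coherence1 U lam k s p0 * (v \<bullet> v)"
    if l: "l < n" and v: "v \<in> carrier_vec ?d" for l v
  proof -
    have "1 / pmf p0 l * quad_form (S l) v \<le> 1 / pmf p0 l * (spectral_norm (S l) * (v \<bullet> v))"
      using quadratic_form_le_spectral_norm[OF S(1) v] by (intro mult_left_mono) auto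
    also have "\<dots> = (1 / pmf p0 l * spectral_norm (S l)) * (v \<bullet> v)" by simp
    also have "\<dots> \<le> coherence1 U lam k s p0 * (v \<bullet> v)"
      using coherence1_ge[OF U(1) l] scalar_prod_self_nonneg unfolding S_def by (rule mult_right_mono)
    finally show ?thesis .
  qed
  have psd: "0 \<le> quad_form (S l) v" if "v \<in> carrier_vec ?d" for l v
    unfolding form[OF that that] by (intro sum_nonneg) simp
  have fam: "psd_family ?d p0 (\<lambda>l. (1 / (real m0 * pmf p0 l)) \<cdot>\<^sub>m S l) ((1 / real m0) \<cdot>\<^sub>m Y_mat lam k s) \<rho>"
    using p S psd bound Y_mat_symmetric total divide_le_of_le_mult[OF coh] \<rho>
    by (intro psd_family_importance_sampling[where \<nu> = "coherence1 U lam k s p0"]) auto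
  have mean: "?c * (v \<bullet> v) \<le> real m0 * (quad_form ((1 / real m0) \<cdot>\<^sub>m Y_mat lam k s) v)"
    if v: "v \<in> carrier_vec ?d" for v
  proof -
    have le: "?c * (v \<bullet> v) \<le> quad_form (Y_mat lam k s) v" using k v by (intro c_const_le) auto
    have eq: "quad_form ((1 / real m0) \<cdot>\<^sub>m Y_mat lam k s) v = quad_form (Y_mat lam k s) v / real m0"
      using v Y_mat_symmetric(1) smult_mat_mult_vec[OF Y_mat_symmetric(1) v, of "1 / real m0"]
        mult_mat_vec_carrier[OF Y_mat_symmetric(1) v]
      by simp
    show ?thesis
    proof (cases "m0 = 0")
      case True
      have "quad_form (S l) v \<le> 0" if l: "l < n" for l
      proof -
        have "0 < pmf p0 l" using p l by (simp add: pmf_positive_iff)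
        moreover have "coherence1 U lam k s p0 * (v \<bullet> v) \<le> 0"
          using coh True scalar_prod_self_nonneg[of v] by (simp add: mult_nonpos_nonneg)
        then have "1 / pmf p0 l * quad_form (S l) v \<le> 0" using bound[OF l v] by linarith
        ultimately show ?thesis by (simp add: divide_le_0_iff)
      qed
      then have "quad_form (Y_mat lam k s) v \<le> 0"
        unfolding total[OF v v, symmetric] by (intro sum_nonpos) auto
      then show ?thesis using le True by simp
    next
      case False
      then show ?thesis using le by (simp add: eq)
    qed
  qed
  have "sampled_energy U lam k s m p (\<lambda>t. om) y
      = (\<Sum>j<m0. quad_form ((1 / (real m0 * pmf p0 (om j))) \<cdot>\<^sub>m S (om j)) y)"
    if y: "y \<in> carrier_vec ?d" for om y
  proof -
    have "sampled_energy U lam k s m p (\<lambda>t. om) y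
        = (\<Sum>t<s. \<Sum>j<m0. (?r t (om j) \<bullet> y)\<^sup>2 / (real m0 * pmf p0 (om j)))"
      unfolding sampled_energy_def using same by (intro sum.cong) auto
    also have "\<dots> = (\<Sum>j<m0. \<Sum>t<s. (?r t (om j) \<bullet> y)\<^sup>2 / (real m0 * pmf p0 (om j)))"
      by (rule sum.swap)
    also have "\<dots> = (\<Sum>j<m0. quad_form ((1 / (real m0 * pmf p0 (om j))) \<cdot>\<^sub>m S (om j)) y)"
      using y S form mult_mat_vec_carrier[OF S(1) y]
      by (intro sum.cong refl) (simp add: smult_mat_mult_vec[of _ ?d ?d] power2_eq_square sum_divide_distrib)
    finally show ?thesis .
  qed
  then have vimage: "(\<lambda>om t. om) -` {om. \<forall>y\<in>carrier_vec ?d. (1 - \<delta>) * ?c * (y \<bullet> y) \<le> sampled_energy U lam k s m p om y}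
      = {om. \<forall>y\<in>carrier_vec ?d. (1 - \<delta>) * ?c * (y \<bullet> y)
           \<le> (\<Sum>j<m0. quad_form ((1 / (real m0 * pmf p0 (om j))) \<cdot>\<^sub>m S (om j)) y)}"
    by auto
  show ?thesis
    unfolding regime1_law_def measure_map_pmf vimage
    by (rule chernoff_iid[OF fam \<rho> \<delta> mean])
qed

text \<open>
  Each draw contributes a single rank one matrix, and the means of the batches add up to Y. A batch
  without draws is harmless: the condition coh then forces all rows of its sensing matrix to vanish, so
  that nothing is missing from the mean.
\<close>

lemma regime2_embedding:
  assumes U: "U \<in> carrier_mat n n" "U\<^sup>T * U = 1\<^sub>m n" "k \<le> n" and k: "1 \<le> k"
    and p: "\<And>t. t < s \<Longrightarrow> set_pmf (p t) = {..<n}" and \<delta>: "0 < \<delta>" "\<delta> < 1" and \<rho>: "0 < \<rho>"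
    and coh: "\<And>t. t < s \<Longrightarrow> coherence2 U lam k p t \<le> \<rho> * real (m t)"
  shows "1 - real (2 * k) * exp (- (c_const lam k s * \<delta>\<^sup>2 / (3 * \<rho>)))
    \<le> measure_pmf.prob (regime2_law s m p) {om. \<forall>y\<in>carrier_vec (2 * k).
        (1 - \<delta>) * c_const lam k s * (y \<bullet> y) \<le> sampled_energy U lam k s m p om y}"
proof -
  let ?d = "2 * k" and ?c = "c_const lam k s"
  let ?R = "\<lambda>t. sensing_mat U lam k t"
  let ?S = "\<lambda>t l. outer_square ?d (row (?R t) l)"
  let ?G = "\<lambda>t. transpose_mat (?R t) * ?R t"
  let ?X = "\<lambda>t l. (1 / (real (m t) * pmf (p t) l)) \<cdot>\<^sub>m ?S t l"
  have R: "?R t \<in> carrier_mat n ?d" for t using U by simp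
  have r: "row (?R t) l \<in> carrier_vec ?d" for t l
    using carrier_matD(2)[OF R] by (intro carrier_vecI) simp
  have form: "u \<bullet> (?S t l *\<^sub>v v) = (row (?R t) l \<bullet> u) * (row (?R t) l \<bullet> v)"
    if "u \<in> carrier_vec ?d" "v \<in> carrier_vec ?d" for u v t l
    using that r by (intro outer_square_bilinear_form) auto
  have total: "(\<Sum>l<n. u \<bullet> (?S t l *\<^sub>v v)) = u \<bullet> (?G t *\<^sub>v v)"
    if uv: "u \<in> carrier_vec ?d" "v \<in> carrier_vec ?d" for u v t
    unfolding gram_bilinear_form[OF R uv] gram_bilinear_form_rows[OF R uv] form[OF uv] ..
  have bound: "1 / pmf (p t) l * quad_form (?S t l) v \<le> coherence2 U lam k p t * (v \<bullet> v)"
    if l: "l < n" and v: "v \<in> carrier_vec ?d" for t l v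
  proof -
    have "\<bar>row (?R t) l \<bullet> v\<bar>\<^sup>2 \<le> (l2_norm_vec (row (?R t) l) * l2_norm_vec v)\<^sup>2"
      using r v by (intro power_mono abs_scalar_prod_le[of _ ?d]) auto
    then have "quad_form (?S t l) v \<le> (row (?R t) l \<bullet> row (?R t) l) * (v \<bullet> v)"
      unfolding form[OF v v] by (simp add: power_mult_distrib l2_norm_vec_square power2_eq_square[of "_ \<bullet> _"])
    then have "1 / pmf (p t) l * quad_form (?S t l) v \<le> 1 / pmf (p t) l * ((row (?R t) l \<bullet> row (?R t) l) * (v \<bullet> v))"
      by (rule mult_left_mono) simp
    also have "\<dots> = (1 / pmf (p t) l * (row (?R t) l \<bullet> row (?R t) l)) * (v \<bullet> v)" by simp
    also have "\<dots> \<le> coherence2 U lam k p t * (v \<bullet> v)"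
      using coherence2_ge[OF U(1) l] scalar_prod_self_nonneg by (rule mult_right_mono)
    finally show ?thesis .
  qed
  have psd: "0 \<le> quad_form (?S t l) v" if "v \<in> carrier_vec ?d" for t l v
    unfolding form[OF that that] by simp
  have fam: "psd_family ?d (p t) (?X t) ((1 / real (m t)) \<cdot>\<^sub>m ?G t) \<rho>" if t: "t < s" for t
    using p[OF t] outer_square_symmetric psd bound gram_symmetric[OF R] total divide_le_of_le_mult[OF coh[OF t]] \<rho>
    by (intro psd_family_importance_sampling[where \<nu> = "coherence2 U lam k p t"]) auto
  have batch: "real (m t) * (quad_form ((1 / real (m t)) \<cdot>\<^sub>m ?G t) v) = quad_form (?G t) v"
    if t: "t < s" and v: "v \<in> carrier_vec ?d" for t v
  proof (cases "m t = 0")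
    case True
    have "quad_form (?S t l) v = 0" if l: "l < n" for l
    proof -
      have "0 < pmf (p t) l" using p[OF t] l by (simp add: pmf_positive_iff)
      moreover have "coherence2 U lam k p t * (v \<bullet> v) \<le> 0"
        using coh[OF t] True scalar_prod_self_nonneg[of v] by (simp add: mult_nonpos_nonneg)
      then have "1 / pmf (p t) l * quad_form (?S t l) v \<le> 0" using bound[OF l v, of t] by linarith
      ultimately show ?thesis using psd[OF v, of t l] by (simp add: divide_le_0_iff)
    qed
    then have "quad_form (?G t) v = 0" unfolding total[OF v v, symmetric] by simp
    then show ?thesis using True by simp
  next
    case False
    then show ?thesis
      using smult_mat_mult_vec[OF gram_symmetric(1)[OF R] v, of "1 / real (m t)"]
        mult_mat_vec_carrier[OF gram_symmetric(1)[OF R] v] v by simp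
  qed
  have mean: "?c * (v \<bullet> v) \<le> (\<Sum>t<s. real (m t) * (quad_form ((1 / real (m t)) \<cdot>\<^sub>m ?G t) v))"
    if v: "v \<in> carrier_vec ?d" for v
  proof -
    have "?c * (v \<bullet> v) \<le> quad_form (Y_mat lam k s) v" using k v by (intro c_const_le) auto
    also have "\<dots> = (\<Sum>t<s. quad_form (?G t) v)"
      unfolding gramian_rows[OF U v v] gram_bilinear_form[OF R v v] gram_bilinear_form_rows[OF R v v] ..
    also have "\<dots> = (\<Sum>t<s. real (m t) * (quad_form ((1 / real (m t)) \<cdot>\<^sub>m ?G t) v))"
      using v by (intro sum.cong refl) (simp add: batch)
    finally show ?thesis .
  qed
  have "sampled_energy U lam k s m p om y = (\<Sum>t<s. \<Sum>j<m t. quad_form (?X t (om t j)) y)"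
    if y: "y \<in> carrier_vec ?d" for om y
  proof -
    have X: "?X t l *\<^sub>v y = (1 / (real (m t) * pmf (p t) l)) \<cdot>\<^sub>v (?S t l *\<^sub>v y)" for t l
      using smult_mat_mult_vec[OF outer_square_symmetric(1) y] .
    have "quad_form (?X t l) y = (row (?R t) l \<bullet> y)\<^sup>2 / (real (m t) * pmf (p t) l)" for t l
      unfolding X using y mult_mat_vec_carrier[OF outer_square_symmetric(1) y] form[OF y y]
      by (simp add: power2_eq_square)
    then show ?thesis by (simp add: sampled_energy_def)
  qed
  then have eq: "{om. \<forall>y\<in>carrier_vec ?d. (1 - \<delta>) * ?c * (y \<bullet> y) \<le> sampled_energy U lam k s m p om y}
      = {om. \<forall>y\<in>carrier_vec ?d. (1 - \<delta>) * ?c * (y \<bullet> y) \<le> (\<Sum>t<s. \<Sum>j<m t. quad_form (?X t (om t j)) y)}"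
    by auto
  show ?thesis
    unfolding regime2_law_def eq by (rule chernoff_independent_batches[OF fam \<rho> \<delta> mean])
qed

section \<open>Recovery with high probability\<close>

theorem theorem6:
  fixes n k s :: nat
    and W U L A :: "real mat"
    and \<theta> lam :: "nat \<Rightarrow> real"
    and p :: "nat \<Rightarrow> nat pmf"
    and m :: "nat \<Rightarrow> nat"
    and Q :: "(nat \<Rightarrow> nat \<Rightarrow> nat) pmf"
    and \<epsilon> \<delta> R :: real
  assumes W_carrier: "W \<in> carrier_mat n n"
    and W_sym: "transpose_mat W = W"
    and W_nonneg: "\<forall>i<n. \<forall>j<n. 0 \<le> W $$ (i, j)"
    and W_simple: "\<forall>i<n. W $$ (i, i) = 0"
    and W_degree: "\<forall>i<n. 0 < (\<Sum>j<n. W $$ (i, j))"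
    and L_eq: "L = normalized_laplacian n W"
    and U_carrier: "U \<in> carrier_mat n n"
    and U_orth: "transpose_mat U * U = 1\<^sub>m n" "U * transpose_mat U = 1\<^sub>m n"
    and L_eigen: "L = U * mat_diag n \<theta> * transpose_mat U"
    and \<theta>_first: "\<theta> 0 = 0"
    and \<theta>_mono: "\<forall>i j. i \<le> j \<and> j < n \<longrightarrow> \<theta> i \<le> \<theta> j"
    and A_eq: "A = U * mat_diag n lam * transpose_mat U"
    and s_ge: "2 \<le> s"
    and k_range: "1 \<le> k" "k < n"
    and \<epsilon>_range: "0 < \<epsilon>" "\<epsilon> < 1"
    and \<delta>_range: "0 < \<delta>" "\<delta> < 1"
    and p_support: "\<forall>t<s. set_pmf (p t) = {..<n}"
    and R_pos: "0 < R"
    and R_bound: "\<forall>om\<in>set_pmf Q.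
          spectral_norm (W_block s m * P_block s m p om * S_block n s m om) \<le> R"
    and regime:
      "(Q = regime1_law (m 0) (p 0) \<and> (\<forall>t<s. m t = m 0 \<and> p t = p 0) \<and>
          real (m 0) \<ge> 3 * coherence1 U lam k s (p 0) / (c_const lam k s * \<delta>\<^sup>2)
                        * ln (4 * real k / \<epsilon>))
       \<or>
       (Q = regime2_law s m p \<and>
          (\<forall>t<s. real (m t) \<ge> 3 * coherence2 U lam k p t / (c_const lam k s * \<delta>\<^sup>2)
                        * ln (4 * real k / \<epsilon>)))"
  shows "measure_pmf.prob Q
     {om. \<forall>w \<in> vec_space.col_space (2 * n) (diag2 (first_cols U k)).
          \<forall>e \<in> carrier_vec (\<Sum>t<s. m t). \<forall>\<gamma>>0. \<forall>g :: real poly.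
          (\<forall>x\<ge>0. 0 \<le> poly g x) \<and> mono_on {0..} (poly g) \<and> 0 < poly g (\<theta> k) \<longrightarrow>
          (let WP = W_block s m * P_block s m p om;
               S = S_block n s m om;
               z = S *\<^sub>v pi_op U lam k s w + e;
               Uaug = diag2 (first_cols U k);
               E = l2_norm_vec (WP *\<^sub>v e);
               c = c_const lam k s;
               C = C_const lam n s;
               gk = poly g (\<theta> (k - 1));
               gk1 = poly g (\<theta> k)
           in \<forall>wstar.
             is_arg_min (objective WP S (pi_op U lam k s) z \<gamma> (poly_mat_eval g (diag2 L)))
               (\<lambda>v. v \<in> carrier_vec (2 * n)) wstar \<longrightarrow>
             (let \<alpha> = (Uaug * transpose_mat Uaug) *\<^sub>v wstar;
                  \<beta> = (1\<^sub>m (2 * n) - Uaug * transpose_mat Uaug) *\<^sub>v wstar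
              in l2_norm_vec (\<alpha> - w)
                   \<le> (2 + R * C / sqrt (\<gamma> * gk1)) / sqrt ((1 - \<delta>) * c) * E
                     + (R * C * sqrt (gk / gk1) + sqrt (\<gamma> * gk)) / sqrt ((1 - \<delta>) * c)
                       * l2_norm_vec w
                 \<and> l2_norm_vec \<beta>
                   \<le> E / sqrt (\<gamma> * gk1) + sqrt (gk / gk1) * l2_norm_vec w))}
     \<ge> 1 - \<epsilon>"
proof -
  let ?c = "c_const lam k s" and ?L = "ln (4 * real k / \<epsilon>)"
  \<comment> \<open>The largest size of the summands for which the tail bound is 2 k exp (- log (4 k / epsilon)).\<close>
  define \<rho> where "\<rho> = ?c * \<delta>\<^sup>2 / (3 * ?L)"
  let ?V = "diag2 (first_cols U k)"
  let ?Good = "{om. \<forall>y\<in>carrier_vec (2 * k). (1 - \<delta>) * ?c * (y \<bullet> y) \<le> sampled_energy U lam k s m p om y}"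
  have c: "0 < ?c" using s_ge k_range by (intro c_const_pos) auto
  have "1 < 4 * real k / \<epsilon>" using k_range \<epsilon>_range by (simp add: field_simps)
  then have L: "0 < ?L" by simp
  have \<rho>: "0 < \<rho>" using c L \<delta>_range by (simp add: \<rho>_def)
  have budget: "\<nu> \<le> \<rho> * x" if "3 * \<nu> / (?c * \<delta>\<^sup>2) * ?L \<le> x" for \<nu> x
  proof -
    have "\<nu> = \<rho> * (3 * \<nu> / (?c * \<delta>\<^sup>2) * ?L)" using c L \<delta>_range by (simp add: \<rho>_def)
    also have "\<dots> \<le> \<rho> * x" using that \<rho> by (intro mult_left_mono) auto
    finally show ?thesis .
  qed
  have "exp (- (?c * \<delta>\<^sup>2 / (3 * \<rho>))) = \<epsilon> / (4 * real k)"
  proof -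
    have "?c * \<delta>\<^sup>2 / (3 * \<rho>) = ?L" using c L \<delta>_range by (simp add: \<rho>_def)
    then show ?thesis using k_range \<epsilon>_range by (simp add: exp_minus)
  qed
  then have fail: "1 - \<epsilon> \<le> 1 - real (2 * k) * exp (- (?c * \<delta>\<^sup>2 / (3 * \<rho>)))"
    using k_range \<epsilon>_range by simp
  have k_le: "k \<le> n" using k_range by simp
  have prob: "1 - \<epsilon> \<le> measure_pmf.prob Q ?Good"
    using regime
  proof (elim disjE conjE)
    assume Q: "Q = regime1_law (m 0) (p 0)" and same: "\<forall>t<s. m t = m 0 \<and> p t = p 0"
      and m: "real (m 0) \<ge> 3 * coherence1 U lam k s (p 0) / (?c * \<delta>\<^sup>2) * ?L"
    have "set_pmf (p 0) = {..<n}" using p_support s_ge by simp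
    from regime1_embedding[OF U_carrier U_orth(1) k_le k_range(1) this \<delta>_range \<rho> _ _ budget[OF m], of m p]
    show ?thesis unfolding Q using fail same by (meson order_trans)
  next
    assume Q: "Q = regime2_law s m p"
      and m: "\<forall>t<s. real (m t) \<ge> 3 * coherence2 U lam k p t / (?c * \<delta>\<^sup>2) * ?L"
    have supp: "set_pmf (p t) = {..<n}" if "t < s" for t using p_support that by simp
    have coh: "coherence2 U lam k p t \<le> \<rho> * real (m t)" if "t < s" for t
      using m that by (intro budget) simp
    show ?thesis
      unfolding Q
      by (rule order_trans[OF fail regime2_embedding[OF U_carrier U_orth(1) k_le k_range(1) supp \<delta>_range \<rho> coh]])
  qed
  have valid: "om t j < n" if om: "om \<in> set_pmf Q" and tj: "t < s" "j < m t" for om t j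
    using regime
  proof (elim disjE conjE)
    assume Q: "Q = regime1_law (m 0) (p 0)" and same: "\<forall>t<s. m t = m 0 \<and> p t = p 0"
    obtain om' where om': "om' \<in> set_pmf (Pi_pmf {..<m 0} 0 (\<lambda>_. p 0))" "om = (\<lambda>t. om')"
      using om unfolding Q regime1_law_def by auto
    have "m t = m 0" using same tj(1) by blast
    then have "j < m 0" using tj(2) by simp
    then have "om' j \<in> set_pmf (p 0)"
      using om'(1) by (subst (asm) set_Pi_pmf) (auto simp: PiE_dflt_def)
    then show ?thesis using p_support s_ge om'(2) by auto
  next
    assume Q: "Q = regime2_law s m p"
    have "om t \<in> set_pmf (Pi_pmf {..<m t} 0 (\<lambda>_. p t))"
      using om tj unfolding Q regime2_law_def by (subst (asm) set_Pi_pmf) (auto simp: PiE_dflt_def)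
    then have "om t j \<in> set_pmf (p t)" using tj by (subst (asm) set_Pi_pmf) (auto simp: PiE_dflt_def)
    then show ?thesis using p_support tj by auto
  qed
  have Uk: "first_cols U k \<in> carrier_mat n k" "transpose_mat (first_cols U k) * first_cols U k = 1\<^sub>m k"
    using U_carrier U_orth k_range first_cols_isometry[of U n k] by auto
  have V: "?V \<in> carrier_mat (2 * n) (2 * k)" "?V\<^sup>T * ?V = 1\<^sub>m (2 * k)"
    using Uk diag2_orthonormal by auto
  obtain B where B: "B \<in> carrier_mat (s * n) (2 * n)"
    and pi: "\<And>v. v \<in> carrier_vec (2 * n) \<Longrightarrow> pi_op U lam k s v = B *\<^sub>v v"
    using pi_op_linear[OF U_carrier] k_range by (metis le_less_trans zero_le)
  have C: "0 \<le> C_const lam n s" using k_range by (intro C_const_nonneg) auto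
  let ?Concl = "\<lambda>om w e \<gamma> g wstar.
     l2_norm_vec ((?V * ?V\<^sup>T) *\<^sub>v wstar - w)
       \<le> (2 + R * C_const lam n s / sqrt (\<gamma> * poly g (\<theta> k))) / sqrt ((1 - \<delta>) * ?c)
            * l2_norm_vec ((W_block s m * P_block s m p om) *\<^sub>v e)
         + (R * C_const lam n s * sqrt (poly g (\<theta> (k - 1)) / poly g (\<theta> k)) + sqrt (\<gamma> * poly g (\<theta> (k - 1))))
            / sqrt ((1 - \<delta>) * ?c) * l2_norm_vec w
     \<and> l2_norm_vec ((1\<^sub>m (2 * n) - ?V * ?V\<^sup>T) *\<^sub>v wstar)
       \<le> l2_norm_vec ((W_block s m * P_block s m p om) *\<^sub>v e) / sqrt (\<gamma> * poly g (\<theta> k))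
         + sqrt (poly g (\<theta> (k - 1)) / poly g (\<theta> k)) * l2_norm_vec w"
  have recover: "?Concl om w e \<gamma> g wstar"
    if om: "om \<in> set_pmf Q" "om \<in> ?Good"
      and w: "w \<in> vec_space.col_space (2 * n) ?V" and e: "e \<in> carrier_vec (\<Sum>t<s. m t)" and \<gamma>: "0 < \<gamma>"
      and g: "\<forall>x\<ge>0. 0 \<le> poly g x" "mono_on {0..} (poly g)" "0 < poly g (\<theta> k)"
      and opt: "is_arg_min (objective (W_block s m * P_block s m p om) (S_block n s m om) (pi_op U lam k s)
           (S_block n s m om *\<^sub>v pi_op U lam k s w + e) \<gamma> (poly_mat_eval g (diag2 L)))
           (\<lambda>v. v \<in> carrier_vec (2 * n)) wstar"
    for om w e \<gamma> g wstar
  proof -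
    let ?M = "\<Sum>t<s. m t"
    let ?WP = "W_block s m * P_block s m p om" and ?S = "S_block n s m om"
    let ?G = "poly_mat_eval g (diag2 L)"
    have WP: "?WP \<in> carrier_mat ?M ?M" using sampling_block_carriers(1,2) by (rule mult_carrier_mat)
    have SB: "?S * B \<in> carrier_mat ?M (2 * n)" using sampling_block_carriers(3) B by (rule mult_carrier_mat)
    have SBv: "?S *\<^sub>v pi_op U lam k s v = (?S * B) *\<^sub>v v" if "v \<in> carrier_vec (2 * n)" for v
      unfolding pi[OF that] using assoc_mult_mat_vec[OF sampling_block_carriers(3) B that] by simp
    obtain y where y: "y \<in> carrier_vec (2 * k)" "w = ?V *\<^sub>v y"
      using w V(1) unfolding vec_space.col_space_eq[OF V(1)] by auto
    have wc: "w \<in> carrier_vec (2 * n)" using y V by (auto intro: mult_mat_vec_carrier)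
    have ws: "wstar \<in> carrier_vec (2 * n)"
      and le: "objective ?WP ?S (pi_op U lam k s) (?S *\<^sub>v pi_op U lam k s w + e) \<gamma> ?G wstar
        \<le> objective ?WP ?S (pi_op U lam k s) (?S *\<^sub>v pi_op U lam k s w + e) \<gamma> ?G w"
      using opt wc by (auto simp: is_arg_min_def not_less)
    have Vtw: "?V\<^sup>T *\<^sub>v wstar \<in> carrier_vec (2 * k)"
      using V ws by (intro mult_mat_vec_carrier[of _ "2 * k" "2 * n"]) auto
    have VVw: "?V *\<^sub>v (?V\<^sup>T *\<^sub>v wstar) \<in> carrier_vec (2 * n)"
      using V(1) Vtw by (rule mult_mat_vec_carrier)
    have inv: "(?S * B) *\<^sub>v (?V *\<^sub>v (?V\<^sup>T *\<^sub>v wstar)) = (?S * B) *\<^sub>v wstar"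
      unfolding SBv[OF ws, symmetric] SBv[OF VVw, symmetric] pi_op_eq_vec_concat[OF U_carrier ws]
        pi_op_eq_vec_concat[OF U_carrier VVw] diag2_isometry[OF Uk Vtw] ..
    have emb: "(1 - \<delta>) * ?c * (u \<bullet> u) \<le> (l2_norm_vec (?WP *\<^sub>v ((?S * B) *\<^sub>v (?V *\<^sub>v u))))\<^sup>2"
      if u: "u \<in> carrier_vec (2 * k)" for u
    proof -
      have Vu: "?V *\<^sub>v u \<in> carrier_vec (2 * n)" using V(1) u by (rule mult_mat_vec_carrier)
      have "(l2_norm_vec (?WP *\<^sub>v ((?S * B) *\<^sub>v (?V *\<^sub>v u))))\<^sup>2 = sampled_energy U lam k s m p om u"
        unfolding SBv[OF Vu, symmetric]
        by (rule weighted_samples_energy[OF U_carrier U_orth(1) k_le _ u]) (rule valid[OF om(1)])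
      then show ?thesis using om(2) u by simp
    qed
    have \<theta>0: "0 \<le> \<theta> (k - 1)" using \<theta>_mono[rule_format, of 0 "k - 1"] \<theta>_first k_range by simp
    then have gk: "0 \<le> poly g (\<theta> (k - 1))" using g(1) by simp
    note filter = laplacian_filter_bounds[OF U_carrier U_orth L_eigen k_range \<theta>_first \<theta>_mono g(1,2)]
    note bounds = regularized_recovery_bound[OF WP SB V y(1) e ws inv emb _ \<gamma> g(3) gk
        filter(1)[OF ws] y(2) filter(2)[OF y(1), folded y(2)]]
    have \<kappa>: "0 < (1 - \<delta>) * ?c" using c \<delta>_range by simp
    have le': "(l2_norm_vec (?WP *\<^sub>v ((?S * B) *\<^sub>v wstar - ((?S * B) *\<^sub>v w + e))))\<^sup>2 + \<gamma> * quad_form ?G wstar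
      \<le> (l2_norm_vec (?WP *\<^sub>v ((?S * B) *\<^sub>v w - ((?S * B) *\<^sub>v w + e))))\<^sup>2 + \<gamma> * quad_form ?G w"
      using le unfolding objective_def SBv[OF ws] SBv[OF wc] .
    let ?E = "l2_norm_vec (?WP *\<^sub>v e)" and ?w = "l2_norm_vec w" and ?k = "sqrt ((1 - \<delta>) * ?c)"
    let ?a = "R * C_const lam n s / sqrt (\<gamma> * poly g (\<theta> k))"
    let ?b = "R * C_const lam n s * sqrt (poly g (\<theta> (k - 1)) / poly g (\<theta> k))"
    \<comment> \<open>The comparison gives the bound with ?a = ?b = 0, and both of these terms are nonnegative.\<close>
    have ab: "0 \<le> ?a" "0 \<le> ?b" using R_pos C \<gamma> g(3) gk by auto
    have "l2_norm_vec ((?V * ?V\<^sup>T) *\<^sub>v wstar - w)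
        \<le> (2 * ?E + sqrt (\<gamma> * poly g (\<theta> (k - 1))) * ?w) / ?k"
      by (rule bounds(1)[OF _ \<kappa> le'])
    also have "\<dots> = 2 / ?k * ?E + sqrt (\<gamma> * poly g (\<theta> (k - 1))) / ?k * ?w"
      by (simp add: add_divide_distrib)
    also have "\<dots> \<le> (2 + ?a) / ?k * ?E + (?b + sqrt (\<gamma> * poly g (\<theta> (k - 1)))) / ?k * ?w"
      using ab \<kappa> by (intro add_mono mult_right_mono divide_right_mono) auto
    finally have "l2_norm_vec ((?V * ?V\<^sup>T) *\<^sub>v wstar - w)
        \<le> (2 + ?a) / ?k * ?E + (?b + sqrt (\<gamma> * poly g (\<theta> (k - 1)))) / ?k * ?w" .
    moreover have "l2_norm_vec ((1\<^sub>m (2 * n) - ?V * ?V\<^sup>T) *\<^sub>v wstar)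
        \<le> ?E / sqrt (\<gamma> * poly g (\<theta> k)) + sqrt (poly g (\<theta> (k - 1)) / poly g (\<theta> k)) * ?w"
      by (rule bounds(2)[OF _ \<kappa> le'])
    ultimately show ?thesis by blast
  qed
  note prob
  also have "measure_pmf.prob Q ?Good \<le> measure_pmf.prob Q
     {om. \<forall>w \<in> vec_space.col_space (2 * n) ?V. \<forall>e \<in> carrier_vec (\<Sum>t<s. m t). \<forall>\<gamma>>0. \<forall>g :: real poly.
        (\<forall>x\<ge>0. 0 \<le> poly g x) \<and> mono_on {0..} (poly g) \<and> 0 < poly g (\<theta> k) \<longrightarrow>
        (\<forall>wstar. is_arg_min (objective (W_block s m * P_block s m p om) (S_block n s m om) (pi_op U lam k s)
             (S_block n s m om *\<^sub>v pi_op U lam k s w + e) \<gamma> (poly_mat_eval g (diag2 L)))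
             (\<lambda>v. v \<in> carrier_vec (2 * n)) wstar \<longrightarrow> ?Concl om w e \<gamma> g wstar)}"
    (is "_ \<le> measure_pmf.prob Q ?Target")
  proof (rule measure_pmf.finite_measure_mono_AE)
    show "AE om in measure_pmf Q. om \<in> ?Good \<longrightarrow> om \<in> ?Target"
      unfolding AE_measure_pmf_iff
    proof (intro ballI impI)
      fix om assume om: "om \<in> set_pmf Q" "om \<in> ?Good"
      show "om \<in> ?Target"
        by (intro CollectI ballI allI impI, elim conjE, rule recover[OF om]; assumption)
    qed
  qed simp
  finally show ?thesis unfolding Let_def .
qed

end
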